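(* Let $X=V(f)\subseteq\mathbb{P}^n$ be a smooth hypersurface of degree $d$ over $\mathbb{C}$, with $n\geq3$ and $d\geq n+2$. Then the hyperplane-section map $$\Phi(f):\mathbb{P}^{n*}\dashrightarrow\mathcal{M}(d,n-1)$$ is generically finite onto its image.
   Context: $f\in\mathbb{C}[x_0,\ldots,x_n]$ is a homogeneous polynomial of degree $d$ defining $X$. $\mathcal{M}(d,n-1)$ is the coarse moduli space of smooth degree $d$ hypersurfaces in $\mathbb{P}^{n-1}$, i.e. the geometric (GIT) quotient by $PGL_n(\mathbb{C})$ of the open subset of $\mathbb{P}(\mathbb{C}[x_1,\ldots,x_n]_d)$ parametrizing smooth hypersurfaces. $U_f=\{H\in\mathbb{P}^{n*}\mid X\cap H\text{ is smooth}\}$ is a nonempty Zariski open subset of the dual projective space, and $\Phi(f)$ is the rational map given on $U_f$ by $H\mapsto[X\cap H]$, where $X\cap H\subseteq H\simeq\mathbb{P}^{n-1}$. It is generically finite onto its image if the general fiber of $\mathbb{P}^{n*}\dashrightarrow\operatorname{Im}\Phi(f)$ is finite, equivalently $\dim\operatorname{Im}\Phi(f)=n$. *)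

theory Defs
  imports
    "HOL-Library.Poly_Mapping"
    "HOL-Analysis.Abstract_Topology"
    "Jordan_Normal_Form.Matrix"
begin

section \<open>Polynomials\<close>

type_synonym 'v mpoly = "('v \<Rightarrow>\<^sub>0 nat) \<Rightarrow>\<^sub>0 complex"

definition monomials :: "'v set \<Rightarrow> nat \<Rightarrow> ('v \<Rightarrow>\<^sub>0 nat) set" where
  "monomials V d =
     {m. Poly_Mapping.keys m \<subseteq> V \<and> (\<Sum>i\<in>Poly_Mapping.keys m. Poly_Mapping.lookup m i) = d}"

definition homogeneous :: "'v set \<Rightarrow> nat \<Rightarrow> 'v mpoly \<Rightarrow> bool" where
  "homogeneous V d p \<longleftrightarrow> Poly_Mapping.keys p \<subseteq> monomials V d"

text \<open>Substitution of elements of a commutative \<open>\<complex>\<close>-algebra with structure map \<open>c\<close>.\<close>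
definition peval :: "(complex \<Rightarrow> 'r::comm_semiring_1) \<Rightarrow> ('v \<Rightarrow> 'r) \<Rightarrow> 'v mpoly \<Rightarrow> 'r" where
  "peval c x p =
     (\<Sum>m\<in>Poly_Mapping.keys p. c (Poly_Mapping.lookup p m) *
        (\<Prod>i\<in>Poly_Mapping.keys m. x i ^ Poly_Mapping.lookup m i))"

abbreviation eval_at :: "('v \<Rightarrow> complex) \<Rightarrow> 'v mpoly \<Rightarrow> complex" where
  "eval_at x p \<equiv> peval (\<lambda>c. c) x p"

definition const :: "complex \<Rightarrow> 'v mpoly" where
  "const c = Poly_Mapping.single 0 c"

definition var :: "'v \<Rightarrow> 'v mpoly" where
  "var i = Poly_Mapping.single (Poly_Mapping.single i 1) 1"

definition partial :: "'v \<Rightarrow> 'v mpoly \<Rightarrow> 'v mpoly" where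
  "partial i p = (\<Sum>m\<in>Poly_Mapping.keys p. Poly_Mapping.single
      (m - Poly_Mapping.single i 1) (of_nat (Poly_Mapping.lookup m i) * Poly_Mapping.lookup p m))"

text \<open>The polynomial \<open>f(B y)\<close>, for \<open>f\<close> in \<open>dim_row B\<close> variables; it has \<open>dim_col B\<close> variables.\<close>
definition pullback :: "complex mat \<Rightarrow> nat mpoly \<Rightarrow> nat mpoly" where
  "pullback B f = peval const (\<lambda>i. \<Sum>j<dim_col B. const (B $$ (i, j)) * var j) f"

section \<open>Smooth hypersurfaces and their moduli space\<close>

text \<open>
  Throughout, \<open>N\<close> is the number of homogeneous coordinates \<open>x\<^sub>0, \<dots>, x\<^bsub>N-1\<^esub>\<close>,
  so the ambient projective space has dimension \<open>N - 1\<close>. The condition is the Jacobian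
  criterion for the scheme \<open>V(f)\<close>; it excludes \<open>f = 0\<close> and non-reduced equations.
\<close>
definition smooth_hypersurface :: "nat \<Rightarrow> nat mpoly \<Rightarrow> bool" where
  "smooth_hypersurface N f \<longleftrightarrow>
     (\<forall>x\<in>carrier_vec N. x \<noteq> 0\<^sub>v N \<and> eval_at (($) x) f = 0 \<longrightarrow>
        (\<exists>i<N. eval_at (($) x) (partial i f) \<noteq> 0))"

text \<open>A point of \<open>\<P>(\<complex>[x\<^sub>0, \<dots>, x\<^bsub>N-1\<^esub>]\<^sub>d)\<close> is the set of nonzero multiples of a nonzero form.\<close>
definition proj_class :: "nat mpoly \<Rightarrow> nat mpoly set" where
  "proj_class F = {const c * F | c. c \<noteq> 0}"

definition proj_forms :: "nat \<Rightarrow> nat \<Rightarrow> nat mpoly set set" where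
  "proj_forms d N = {proj_class F | F. homogeneous {..<N} d F \<and> F \<noteq> 0}"

text \<open>
  The projective Zariski topology, generated by the principal open sets \<open>P \<noteq> 0\<close>. Here \<open>P\<close> is a
  homogeneous polynomial in the coefficients of the form, so that its variables are
  indexed by the monomials of degree \<open>d\<close> and are evaluated at the function \<open>lookup F\<close>.
\<close>
definition principal_open :: "nat \<Rightarrow> nat \<Rightarrow> (nat \<Rightarrow>\<^sub>0 nat) mpoly \<Rightarrow> nat mpoly set set" where
  "principal_open d N P =
     {proj_class F | F. homogeneous {..<N} d F \<and> F \<noteq> 0 \<and>
        eval_at (Poly_Mapping.lookup F) P \<noteq> 0}"

definition zariski_forms :: "nat \<Rightarrow> nat \<Rightarrow> nat mpoly set topology" where
  "zariski_forms d N = topology_generated_by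
     {principal_open d N P | P e. homogeneous (monomials {..<N} d) e P}"

definition smooth_locus :: "nat \<Rightarrow> nat \<Rightarrow> nat mpoly set set" where
  "smooth_locus d N = {proj_class F | F. homogeneous {..<N} d F \<and> smooth_hypersurface N F}"

text \<open>
  The \<open>PGL\<^sub>N\<close>-orbit of a point of the parameter space. Scalar matrices act trivially there,
  so this is the same as the \<open>GL\<^sub>N\<close>-orbit.
\<close>
definition PGL_orbit :: "nat \<Rightarrow> nat mpoly set \<Rightarrow> nat mpoly set set" where
  "PGL_orbit N p = {pullback A ` p | A. A \<in> carrier_mat N N \<and> invertible_mat A}"

definition quotient_topology :: "'a topology \<Rightarrow> ('a \<Rightarrow> 'b) \<Rightarrow> 'b topology" where
  "quotient_topology X q =
     topology (\<lambda>W. W \<subseteq> q ` topspace X \<and> openin X {x \<in> topspace X. q x \<in> W})"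

lemma openin_quotient_topology:
  "openin (quotient_topology X q) W \<longleftrightarrow>
     W \<subseteq> q ` topspace X \<and> openin X {x \<in> topspace X. q x \<in> W}"
proof -
  let ?P = "\<lambda>W. W \<subseteq> q ` topspace X \<and> openin X {x \<in> topspace X. q x \<in> W}"
  have "istopology ?P"
    unfolding istopology_def
  proof (intro conjI allI impI)
    fix S T assume S: "?P S" and T: "?P T"
    show "S \<inter> T \<subseteq> q ` topspace X"
      using S by blast
    have "{x \<in> topspace X. q x \<in> S \<inter> T} =
        {x \<in> topspace X. q x \<in> S} \<inter> {x \<in> topspace X. q x \<in> T}"
      by blast
    then show "openin X {x \<in> topspace X. q x \<in> S \<inter> T}"
      using S T by auto
  next
    fix K assume K: "\<forall>S\<in>K. ?P S"
    show "\<Union>K \<subseteq> q ` topspace X"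
      using K by blast
    have "{x \<in> topspace X. q x \<in> \<Union>K} = (\<Union>S\<in>K. {x \<in> topspace X. q x \<in> S})"
      by blast
    then show "openin X {x \<in> topspace X. q x \<in> \<Union>K}"
      using K by auto
  qed
  then show ?thesis
    unfolding quotient_topology_def by (simp add: topology_inverse')
qed

text \<open>
  The closed points of the geometric quotient, with its Zariski topology: the points are the
  orbits of smooth hypersurfaces, and a geometric quotient carries the quotient topology.
  In terms of the dimension of the ambient projective space,
  \<open>\<M>(d, N - 1)\<close> is \<open>moduli_space d N\<close>.
\<close>
definition moduli_space :: "nat \<Rightarrow> nat \<Rightarrow> nat mpoly set set topology" where
  "moduli_space d N =
     quotient_topology (subtopology (zariski_forms d N) (smooth_locus d N)) (PGL_orbit N)"

section \<open>The hyperplane-section map\<close>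

text \<open>
  The points of the dual projective space of \<open>\<P>\<^sup>n\<close> are the hyperplanes of \<open>\<P>\<^sup>n\<close>, represented
  by the corresponding linear subspaces of \<open>\<complex>\<^bsup>n+1\<^esup>\<close>.
\<close>
definition dual_projective_space :: "nat \<Rightarrow> complex vec set set" where
  "dual_projective_space n =
     {{x \<in> carrier_vec (Suc n). scalar_prod a x = 0} | a.
        a \<in> carrier_vec (Suc n) \<and> a \<noteq> 0\<^sub>v (Suc n)}"

text \<open>
  A choice of an isomorphism \<open>\<P>\<^bsup>n-1\<^esup> \<simeq> H\<close>, as the matrix of a linear isomorphism \<open>\<complex>\<^sup>n \<simeq> H\<close>.
  Two choices differ by an element of \<open>GL\<^sub>n\<close>, which affects neither the smoothness of the
  section nor its class in the moduli space.
\<close>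
definition hyperplane_coords :: "nat \<Rightarrow> complex vec set \<Rightarrow> complex mat" where
  "hyperplane_coords n H =
     (SOME B. B \<in> carrier_mat (Suc n) n \<and> bij_betw (\<lambda>y. B *\<^sub>v y) (carrier_vec n) H)"

text \<open>The equation of \<open>V(f) \<inter> H\<close> in \<open>H \<simeq> \<P>\<^bsup>n-1\<^esup>\<close>.\<close>
definition hyperplane_section :: "nat \<Rightarrow> nat mpoly \<Rightarrow> complex vec set \<Rightarrow> nat mpoly" where
  "hyperplane_section n f H = pullback (hyperplane_coords n H) f"

definition smooth_sections :: "nat \<Rightarrow> nat mpoly \<Rightarrow> complex vec set set" where
  "smooth_sections n f =
     {H \<in> dual_projective_space n. smooth_hypersurface n (hyperplane_section n f H)}"

definition hyperplane_section_map ::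
    "nat \<Rightarrow> nat mpoly \<Rightarrow> complex vec set \<Rightarrow> nat mpoly set set" where
  "hyperplane_section_map n f H = PGL_orbit n (proj_class (hyperplane_section n f H))"

text \<open>
  A map \<open>\<phi>\<close> with domain of definition \<open>U\<close> and target \<open>Y\<close> is generically finite onto its image if
  its general fibre is finite, that is, if the fibres over all points of a nonempty dense open
  subset of the image are finite. Nonemptiness of \<open>W\<close> forces \<open>U\<close> to be nonempty.
\<close>
definition generically_finite_onto_image :: "'a set \<Rightarrow> 'b topology \<Rightarrow> ('a \<Rightarrow> 'b) \<Rightarrow> bool" where
  "generically_finite_onto_image U Y \<phi> \<longleftrightarrow>
     (\<exists>W. openin (subtopology Y (\<phi> ` U)) W \<and> W \<noteq> {} \<and>
          subtopology Y (\<phi> ` U) closure_of W = \<phi> ` U \<and>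
          (\<forall>y\<in>W. finite {H \<in> U. \<phi> H = y}))"

end

theory Submission
  imports Defs
    "HOL-Computational_Algebra.Fundamental_Theorem_Algebra"
    "HOL-Analysis.Continuum_Not_Denumerable"
    "Jordan_Normal_Form.Char_Poly"
begin

text \<open>
  A tangent vector to a fibre of \<open>H \<mapsto> [X \<inter> H]\<close> is a relation \<open>\<Sum> L\<^sub>i \<partial>\<^sub>i f = 0\<close> on \<open>H\<close> with linear
  forms \<open>L\<^sub>i\<close>. The \<open>n + 1\<close> partial derivatives have no common zero on \<open>H\<close>, so their Koszul
  homology over the \<open>n\<close> coordinates of \<open>H\<close> vanishes in degrees above one; hence any two relations
  on \<open>H\<close> whose degrees add up to less than \<open>d - 1\<close> are proportional. When \<open>H\<close> moves, the derivatives
  of a linear relation \<open>L\<close> produce further relations on \<open>H\<close> of degree one and two, which are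
  therefore multiples of \<open>L\<close>. If \<open>\<ell>\<close> is the equation of \<open>H\<close>, this shows that, after correcting \<open>L\<close>
  by a multiple of \<open>\<ell>\<close>, the form \<open>\<Sum> L\<^sub>i \<partial>\<^sub>i f\<close> is divisible by \<open>\<ell>\<^sup>2\<close>, then by \<open>\<ell>\<^sup>3\<close>, and so on
  beyond its degree, so \<open>L\<close> vanishes on a generic \<open>H\<close>.

  Thus the differential of \<open>B \<mapsto> f(B y)\<close> on \<open>(n + 1) \<times> n\<close> matrices is generically injective, and the
  entries of \<open>B\<close> are algebraic over the coefficients of \<open>f(B y)\<close>. Away from the zeros of one
  nonzero coefficient of each algebraic equation, a form \<open>F\<close> has only finitely many \<open>B\<close> with
  \<open>f(B y) = F\<close>. The orbits of such forms are an open subset of the moduli space, and it is dense in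
  the image because two nonzero polynomials in the entries of \<open>B\<close> have a common nonzero.
\<close>

section \<open>Evaluation of polynomials\<close>

text \<open>The hypothesis on \<open>d\<close> is used in the form \<open>e = d - 1 \<ge> 4\<close>:
  relations of degrees one and two are compared, and \<open>1 + 2 < e\<close>. The bound
  \<open>n \<ge> 3\<close> supplies the three coordinates of the cyclic identities. A relation is
  given on one hyperplane at a time, yet it has to be differentiated. It solves a linear system
  whose coefficients are polynomials in \<open>a\<close>; for \<open>a\<close> outside the zeros of
  some polynomial, every solution extends to a polynomial family in \<open>a\<close>. Counting
  monomials takes the place of dimension theory: more polynomials than variables are dependent.
  Functionals supported at finitely many points pick out as many functions of the section as there
  are matrix entries. The polynomial \<open>Q\<close> whose nonvanishing makes the preimages finite
  need be neither homogeneous nor invariant, so its nonzero set is saturated under scalars and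
  \<open>GL_n\<close>; on a fibre the scalar is absorbed into the matrix by a root of order
  \<open>d\<close>. The image consists of classes of smooth sections, so density also needs that any
  satisfiable polynomial condition on matrices holds at one with a smooth section. This is where the
  dual variety enters.\<close>

abbreviation (input) lookup where "lookup \<equiv> Poly_Mapping.lookup"
abbreviation (input) keys where "keys \<equiv> Poly_Mapping.keys"
abbreviation (input) single where "single \<equiv> Poly_Mapping.single"

definition mon_eval :: "('v \<Rightarrow> 'r::comm_semiring_1) \<Rightarrow> ('v \<Rightarrow>\<^sub>0 nat) \<Rightarrow> 'r" where
  "mon_eval x m = (\<Prod>i\<in>keys m. x i ^ lookup m i)"

lemma mon_eval_superset:
  assumes "finite A" "keys m \<subseteq> A"
  shows "mon_eval x m = (\<Prod>i\<in>A. x i ^ lookup m i)"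
  unfolding mon_eval_def
  by (rule prod.mono_neutral_left) (use assms in \<open>auto simp: in_keys_iff\<close>)

lemma mon_eval_0 [simp]: "mon_eval x 0 = 1"
  by (simp add: mon_eval_def)

lemma mon_eval_add: "mon_eval x (m + m') = mon_eval x m * mon_eval x m'"
proof -
  let ?A = "keys m \<union> keys m'"
  have "keys (m + m') \<subseteq> ?A" by (rule keys_add)
  then show ?thesis
    by (simp add: mon_eval_superset[of ?A] lookup_add power_add prod.distrib)
qed

lemma mon_eval_single: "mon_eval x (single i k) = x i ^ k"
  by (cases "k = 0") (simp_all add: mon_eval_def)

lemma peval_alt: "peval c x p = (\<Sum>m\<in>keys p. c (lookup p m) * mon_eval x m)"
  by (simp add: peval_def mon_eval_def)

text \<open>A ring homomorphism, kept abstract so that one set of rules serves both evaluation at a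
  point (the identity) and substitution of polynomials (\<open>const\<close>).\<close>

definition coeff_hom :: "(complex \<Rightarrow> 'r::comm_semiring_1) \<Rightarrow> bool" where
  "coeff_hom c \<longleftrightarrow> c 0 = 0 \<and> c 1 = 1 \<and> (\<forall>a b. c (a + b) = c a + c b) \<and> (\<forall>a b. c (a * b) = c a * c b)"

lemma coeff_hom_id [simp]: "coeff_hom (\<lambda>c. c)"
  by (simp add: coeff_hom_def)

lemma coeff_hom_const [simp]: "coeff_hom const"
  by (auto simp: coeff_hom_def const_def single_add mult_single)

lemma mpoly_sum_monomials: "p = (\<Sum>m\<in>keys p. single m (lookup p m))"
proof (rule poly_mapping_eqI)
  fix k
  show "lookup p k = lookup (\<Sum>m\<in>keys p. single m (lookup p m)) k"
    by (cases "k \<in> keys p")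
       (auto simp: lookup_sum lookup_single when_def sum.delta in_keys_iff)
qed

lemma peval_superset:
  assumes "coeff_hom c" "finite A" "keys p \<subseteq> A"
  shows "peval c x p = (\<Sum>m\<in>A. c (lookup p m) * mon_eval x m)"
  unfolding peval_alt
  by (rule sum.mono_neutral_left) (use assms in \<open>auto simp: in_keys_iff coeff_hom_def\<close>)

lemma peval_add:
  assumes "coeff_hom c"
  shows "peval c x (p + q) = peval c x p + peval c x q"
proof -
  let ?A = "keys p \<union> keys q"
  have "keys (p + q) \<subseteq> ?A" by (rule keys_add)
  then show ?thesis
    using assms by (simp add: peval_superset[of c ?A] lookup_add sum.distrib coeff_hom_def distrib_right)
qed

lemma peval_0 [simp]: "peval c x 0 = 0"
  by (simp add: peval_def)

lemma peval_sum:
  assumes "coeff_hom c"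
  shows "peval c x (\<Sum>i\<in>A. p i) = (\<Sum>i\<in>A. peval c x (p i))"
  by (induction A rule: infinite_finite_induct) (simp_all add: peval_add assms)

lemma peval_single:
  assumes "coeff_hom c"
  shows "peval c x (single m a) = c a * mon_eval x m"
  using assms by (cases "a = 0") (simp_all add: peval_alt coeff_hom_def)

lemma peval_mult:
  assumes "coeff_hom c"
  shows "peval c x (p * q) = peval c x p * peval c x q"
proof -
  have c: "c (a * b) = c a * c b" for a b
    using assms by (simp add: coeff_hom_def)
  have "p * q = (\<Sum>m\<in>keys p. single m (lookup p m)) * (\<Sum>m\<in>keys q. single m (lookup q m))"
    using mpoly_sum_monomials[of p] mpoly_sum_monomials[of q] by simp
  also have "\<dots> = (\<Sum>m\<in>keys p. \<Sum>l\<in>keys q. single (m + l) (lookup p m * lookup q l))"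
    by (simp add: sum_product mult_single)
  finally have "peval c x (p * q) = (\<Sum>m\<in>keys p. \<Sum>l\<in>keys q.
      (c (lookup p m) * mon_eval x m) * (c (lookup q l) * mon_eval x l))"
    by (simp add: peval_sum assms peval_single c mon_eval_add mult_ac)
  then show ?thesis
    by (simp add: peval_alt sum_product)
qed

lemma peval_const: "coeff_hom c \<Longrightarrow> peval c x (const a) = c a"
  by (simp add: const_def peval_single)

lemma peval_var: "coeff_hom c \<Longrightarrow> peval c x (var i) = x i"
  by (simp add: var_def peval_single mon_eval_single coeff_hom_def)

lemma const_0 [simp]: "const 0 = 0" and const_1 [simp]: "const 1 = 1"
  by (simp_all add: const_def)

lemma const_add: "const (a + b) = const a + const b"
  and const_mult: "const (a * b) = const a * const b"
  by (simp_all add: const_def single_add mult_single)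

lemma const_uminus: "const (- a) = - const a"
  by (simp add: const_def single_uminus)

lemma const_diff: "const (a - b) = const a - const b"
  by (simp add: const_def single_diff)

lemma const_eq_iff [simp]: "const a = const b \<longleftrightarrow> a = b"
  unfolding const_def by (metis lookup_single_eq)

lemma const_eq_0_iff [simp]: "const a = 0 \<longleftrightarrow> a = 0"
  using const_eq_iff[of a 0] by simp

lemma peval_1: "coeff_hom c \<Longrightarrow> peval c x 1 = 1"
  using peval_const[of c x 1] by (simp add: coeff_hom_def)

lemma peval_power: "coeff_hom c \<Longrightarrow> peval c x (p ^ k) = peval c x p ^ k"
  by (induction k) (simp_all add: peval_1 peval_mult)

lemma peval_prod:
  assumes "coeff_hom c"
  shows "peval c x (\<Prod>i\<in>A. p i) = (\<Prod>i\<in>A. peval c x (p i))"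
  by (induction A rule: infinite_finite_induct) (simp_all add: peval_mult peval_1 assms)

lemma peval_uminus:
  fixes c :: "complex \<Rightarrow> 'r::comm_ring_1"
  assumes "coeff_hom c"
  shows "peval c x (- p) = - peval c x p"
  using peval_add[OF assms, of x p "- p"] by (simp add: eq_neg_iff_add_eq_0 add.commute)

lemma peval_diff:
  fixes c :: "complex \<Rightarrow> 'r::comm_ring_1"
  assumes "coeff_hom c"
  shows "peval c x (p - q) = peval c x p - peval c x q"
  using peval_add[OF assms, of x p "- q"] by (simp add: peval_uminus assms)

lemmas peval_simps =
  peval_add peval_mult peval_const peval_var peval_1 peval_power peval_sum peval_prod
  peval_uminus peval_diff

lemmas eval_simps [simp] = peval_simps[OF coeff_hom_id]
lemmas subst_simps [simp] = peval_simps[OF coeff_hom_const]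

lemma var_power: "var i ^ k = single (single i k) 1"
  by (induction k) (simp_all add: var_def mult_single flip: single_add)

lemma single_eq_const_mon: "single m a = const a * mon_eval var m"
proof -
  have "(\<Prod>i\<in>A. single (single i (lookup m i)) 1) = (single (\<Sum>i\<in>A. single i (lookup m i)) 1 :: 'a mpoly)" for A
    by (induction A rule: infinite_finite_induct) (simp_all add: mult_single)
  moreover have "(\<Sum>i\<in>keys m. single i (lookup m i)) = m"
  proof (rule poly_mapping_eqI)
    fix k
    show "lookup (\<Sum>i\<in>keys m. single i (lookup m i)) k = lookup m k"
      by (cases "k \<in> keys m")
         (auto simp: lookup_sum lookup_single when_def sum.delta in_keys_iff)
  qed
  ultimately show ?thesis
    by (simp add: mon_eval_def var_power const_def mult_single)
qed

text \<open>Evaluation, substitution and congruences respect sums and products, so statements about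
  them need to be checked on constants and variables alone.\<close>

lemma mpoly_induct [case_names const var add mult]:
  assumes "\<And>a. P (const a)" "\<And>i. P (var i)"
    and "\<And>p q. P p \<Longrightarrow> P q \<Longrightarrow> P (p + q)" "\<And>p q. P p \<Longrightarrow> P q \<Longrightarrow> P (p * q)"
  shows "P (p :: 'v mpoly)"
proof -
  have P0: "P 0" and P1: "P 1"
    using assms(1)[of 0] assms(1)[of 1] by simp_all
  have pw: "P (var i ^ k)" for i k
    by (induction k) (simp_all add: P1 assms)
  have "P (mon_eval var m)" for m
  proof -
    have "P (\<Prod>i\<in>A. var i ^ lookup m i)" for A
      by (induction A rule: infinite_finite_induct) (simp_all add: P1 assms pw)
    then show ?thesis by (simp add: mon_eval_def)
  qed
  then have "P (single m a)" for m a
    by (simp add: single_eq_const_mon assms)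
  then have "P (\<Sum>m\<in>A. single m (lookup p m))" for A
    by (induction A rule: infinite_finite_induct) (simp_all add: P0 assms)
  then show ?thesis
    using mpoly_sum_monomials[of p] by metis
qed

lemma peval_peval:
  assumes "coeff_hom c"
  shows "peval c x (peval const y p) = peval c (\<lambda>i. peval c x (y i)) p"
  by (induction p rule: mpoly_induct) (simp_all add: peval_simps assms)

lemma subst_var [simp]: "peval const var p = p"
  by (induction p rule: mpoly_induct) simp_all

lemma eval_pullback:
  "eval_at y (pullback B f) = eval_at (\<lambda>i. \<Sum>j<dim_col B. B $$ (i, j) * y j) f"
  by (simp add: pullback_def peval_peval)

text \<open>Distinct monomials are distinct characters of a torus, hence linearly independent.\<close>
lemma monomials_independent:
  assumes "finite E" "\<And>x :: 'v \<Rightarrow> complex. (\<Sum>m\<in>E. c m * mon_eval x m) = 0" "m \<in> E"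
  shows "c m = 0"
  using assms
proof (induction E arbitrary: c m rule: finite_induct)
  case (insert m0 E)
  have E0: "c m1 = 0" if m1: "m1 \<in> E" for m1
  proof -
    have "m1 \<noteq> m0" using insert m1 by auto
    then obtain i where i: "lookup m1 i \<noteq> lookup m0 i"
      by (meson poly_mapping_eqI)
    define x0 :: "'v \<Rightarrow> complex" where "x0 = (\<lambda>j. if j = i then 2 else 1)"
    have x0: "mon_eval x0 m = 2 ^ lookup m i" for m
    proof -
      have "mon_eval x0 m = (\<Prod>j\<in>insert i (keys m). x0 j ^ lookup m j)"
        by (rule mon_eval_superset) auto
      also have "\<dots> = x0 i ^ lookup m i"
        by (subst prod.remove[of _ i]) (auto simp: x0_def intro!: prod.neutral)
      finally show ?thesis by (simp add: x0_def)
    qed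
    have mul: "mon_eval (\<lambda>j. x0 j * x j) m = mon_eval x0 m * mon_eval x m" for x m
      by (simp add: mon_eval_def power_mult_distrib prod.distrib)
    \<comment> \<open>The relation translated by \<open>x0\<close>, minus
      \<open>mon_eval x0 m0\<close> times the original, loses its term \<open>m0\<close>. The value
      2 at the coordinate \<open>i\<close> keeps the term \<open>m1\<close>, since distinct powers
      of 2 are different.\<close>
    have "(\<Sum>m\<in>E. (c m * (mon_eval x0 m - mon_eval x0 m0)) * mon_eval x m) = 0" for x
    proof -
      have "(\<Sum>m\<in>insert m0 E. c m * mon_eval (\<lambda>j. x0 j * x j) m) -
          mon_eval x0 m0 * (\<Sum>m\<in>insert m0 E. c m * mon_eval x m) = 0"
        using insert.prems(1)[of "\<lambda>j. x0 j * x j"] insert.prems(1)[of x] by simp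
      then have "(\<Sum>m\<in>insert m0 E. (c m * (mon_eval x0 m - mon_eval x0 m0)) * mon_eval x m) = 0"
        by (simp only: mul sum_distrib_left sum_subtractf [symmetric]) (simp add: algebra_simps)
      then show ?thesis using insert.hyps by simp
    qed
    then have "c m1 * (mon_eval x0 m1 - mon_eval x0 m0) = 0"
      using insert.IH[of "\<lambda>m. c m * (mon_eval x0 m - mon_eval x0 m0)" m1] m1 by blast
    moreover have "mon_eval x0 m1 \<noteq> mon_eval x0 m0"
    proof
      assume "mon_eval x0 m1 = mon_eval x0 m0"
      then have "of_nat (2 ^ lookup m1 i) = (of_nat (2 ^ lookup m0 i) :: complex)"
        by (simp add: x0)
      then have "(2::nat) ^ lookup m1 i = 2 ^ lookup m0 i" by (simp only: of_nat_eq_iff)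
      then show False using i by simp
    qed
    ultimately show ?thesis by simp
  qed
  then have "c m0 = 0"
    using insert.prems(1)[of "\<lambda>_. 1"] insert.hyps by (simp add: mon_eval_def)
  then show ?case using E0 insert.prems by auto
qed simp

lemma mpoly_eq_0I:
  assumes "\<And>x. eval_at x p = 0"
  shows "p = 0"
proof (rule poly_mapping_eqI)
  fix m
  show "lookup p m = lookup 0 m"
    using monomials_independent[of "keys p" "lookup p" m] assms
    by (auto simp: peval_alt in_keys_iff)
qed

lemma mpoly_eqI: "(\<And>x. eval_at x p = eval_at x q) \<Longrightarrow> p = q"
  using mpoly_eq_0I[of "p - q"] by simp

lemma eval_nonzeroE:
  assumes "p \<noteq> 0"
  obtains x where "eval_at x p \<noteq> 0"
  using assms mpoly_eq_0I by blast

text \<open>Restriction to a line reduces questions in several variables to univariate polynomials: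
  existence of derivatives, and common nonzeros of two polynomials.\<close>

lemma eval_along_line: "\<exists>q :: complex poly. \<forall>t. eval_at (\<lambda>i. x i + t * y i) p = poly q t"
proof (induction p rule: mpoly_induct)
  case (const a)
  show ?case by (rule exI[of _ "[:a:]"]) simp
next
  case (var i)
  show ?case by (rule exI[of _ "[:x i, y i:]"]) (simp add: algebra_simps)
next
  case (add p q)
  then obtain P Q where "\<forall>t. eval_at (\<lambda>i. x i + t * y i) p = poly P t"
    "\<forall>t. eval_at (\<lambda>i. x i + t * y i) q = poly Q t" by auto
  then show ?case by (intro exI[of _ "P + Q"]) simp
next
  case (mult p q)
  then obtain P Q where "\<forall>t. eval_at (\<lambda>i. x i + t * y i) p = poly P t"
    "\<forall>t. eval_at (\<lambda>i. x i + t * y i) q = poly Q t" by auto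
  then show ?case by (intro exI[of _ "P * Q"]) simp
qed

section \<open>Homogeneous polynomials and derivatives\<close>

definition mdeg :: "('v \<Rightarrow>\<^sub>0 nat) \<Rightarrow> nat" where
  "mdeg m = (\<Sum>i\<in>keys m. lookup m i)"

lemma mdeg_superset:
  assumes "finite A" "keys m \<subseteq> A"
  shows "mdeg m = (\<Sum>i\<in>A. lookup m i)"
  unfolding mdeg_def
  by (rule sum.mono_neutral_left) (use assms in \<open>auto simp: in_keys_iff\<close>)

lemma mdeg_add: "mdeg (m + m') = mdeg m + mdeg m'"
proof -
  let ?A = "keys m \<union> keys m'"
  have "keys (m + m') \<subseteq> ?A" by (rule keys_add)
  then show ?thesis
    by (simp add: mdeg_superset[of ?A] lookup_add sum.distrib)
qed

lemma mdeg_0 [simp]: "mdeg 0 = 0"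
  by (simp add: mdeg_def)

lemma mdeg_single [simp]: "mdeg (single i k) = k"
  by (cases "k = 0") (simp_all add: mdeg_def)

lemma monomials_iff: "m \<in> monomials V d \<longleftrightarrow> keys m \<subseteq> V \<and> mdeg m = d"
  by (simp add: monomials_def mdeg_def)

lemma homogeneous_iff: "homogeneous V d p \<longleftrightarrow> (\<forall>m\<in>keys p. keys m \<subseteq> V \<and> mdeg m = d)"
  unfolding homogeneous_def subset_iff [of _ "monomials V d"] Ball_def monomials_iff by blast

lemma homogeneous_0 [simp]: "homogeneous V d 0"
  by (simp add: homogeneous_iff)

lemma homogeneous_add: "homogeneous V d p \<Longrightarrow> homogeneous V d q \<Longrightarrow> homogeneous V d (p + q)"
  unfolding homogeneous_def using keys_add[of p q] by blast

lemma homogeneous_uminus: "homogeneous V d p \<Longrightarrow> homogeneous V d (- p)"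
  by (simp add: homogeneous_def in_keys_iff subset_iff)

lemma homogeneous_diff: "homogeneous V d p \<Longrightarrow> homogeneous V d q \<Longrightarrow> homogeneous V d (p - q)"
  using homogeneous_add[of V d p "- q"] by (simp add: homogeneous_uminus)

lemma homogeneous_sum:
  "(\<And>i. i \<in> A \<Longrightarrow> homogeneous V d (p i)) \<Longrightarrow> homogeneous V d (\<Sum>i\<in>A. p i)"
  by (induction A rule: infinite_finite_induct) (simp_all add: homogeneous_add)

lemma keys_mult_subset: "m \<in> keys (p * q) \<Longrightarrow> \<exists>k\<in>keys p. \<exists>l\<in>keys q. m = k + l"
  using keys_mult[of p q] by blast

lemma homogeneous_mult:
  assumes "homogeneous V d p" "homogeneous V d' q"
  shows "homogeneous V (d + d') (p * q)"
  unfolding homogeneous_iff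
proof
  fix m assume "m \<in> keys (p * q)"
  then obtain k l where "k \<in> keys p" "l \<in> keys q" "m = k + l"
    using keys_mult_subset by metis
  then show "keys m \<subseteq> V \<and> mdeg m = d + d'"
    using assms keys_add[of k l] by (fastforce simp: homogeneous_iff mdeg_add)
qed

lemma homogeneous_const [simp]: "homogeneous V 0 (const c)"
  by (simp add: homogeneous_iff const_def)

lemma homogeneous_1 [simp]: "homogeneous V 0 1"
  using homogeneous_const[of V 1] by simp

lemma homogeneous_var: "i \<in> V \<Longrightarrow> homogeneous V 1 (var i)"
  by (simp add: homogeneous_iff var_def)

lemma homogeneous_const_mult: "homogeneous V d p \<Longrightarrow> homogeneous V d (const c * p)"
  using homogeneous_mult[of V 0 "const c" d p] by simp

lemma homogeneous_power: "homogeneous V d p \<Longrightarrow> homogeneous V (k * d) (p ^ k)"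
proof (induction k)
  case (Suc k)
  then show ?case using homogeneous_mult[of V d p "k * d" "p ^ k"] by simp
qed simp

lemma homogeneous_prod:
  "(\<And>i. i \<in> A \<Longrightarrow> homogeneous V (d i) (p i)) \<Longrightarrow> homogeneous V (\<Sum>i\<in>A. d i) (\<Prod>i\<in>A. p i)"
  by (induction A rule: infinite_finite_induct) (simp_all add: homogeneous_mult)

lemma homogeneous_single: "m \<in> monomials V d \<Longrightarrow> homogeneous V d (single m a)"
  by (simp add: homogeneous_def)

lemma homogeneous_subst:
  assumes "homogeneous V d p" "\<And>i. i \<in> V \<Longrightarrow> homogeneous W 1 (y i)"
  shows "homogeneous W d (peval const y p)"
  unfolding peval_alt
proof (rule homogeneous_sum)
  fix m assume "m \<in> keys p"
  then have m: "keys m \<subseteq> V" "mdeg m = d" using assms by (auto simp: homogeneous_iff)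
  have "homogeneous W (\<Sum>i\<in>keys m. lookup m i * 1) (mon_eval y m)"
    unfolding mon_eval_def
    by (intro homogeneous_prod homogeneous_power assms) (use m in auto)
  then show "homogeneous W d (const (lookup p m) * mon_eval y m)"
    using m by (intro homogeneous_const_mult) (simp add: mdeg_def)
qed

lemma mon_eval_scale: "mon_eval (\<lambda>i. s * x i) m = s ^ mdeg m * mon_eval x m"
  by (simp add: mon_eval_def mdeg_def power_mult_distrib prod.distrib power_sum)

lemma eval_scale:
  assumes "homogeneous V d p"
  shows "eval_at (\<lambda>i. s * x i) p = s ^ d * eval_at x p"
  using assms by (simp add: peval_alt mon_eval_scale homogeneous_iff sum_distrib_left mult_ac)

lemma eval_cong:
  assumes "homogeneous V d p" "\<And>i. i \<in> V \<Longrightarrow> x i = y i"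
  shows "peval c x p = peval c y p"
proof -
  have "mon_eval x m = mon_eval y m" if "m \<in> keys p" for m
    unfolding mon_eval_def
    by (rule prod.cong) (use assms that in \<open>auto simp: homogeneous_iff subset_iff\<close>)
  then show ?thesis by (simp add: peval_alt)
qed

text \<open>Every monomial on the right has degree at least \<open>e\<close>, whatever the cofactors
  \<open>c i\<close> are; they need not be homogeneous.\<close>

lemma ideal_low_degree:
  assumes "p = (\<Sum>i\<in>A. c i * f i)" "\<And>i. i \<in> A \<Longrightarrow> homogeneous V e (f i)" "homogeneous W s p" "s < e"
  shows "p = 0"
proof (rule ccontr)
  assume "p \<noteq> 0"
  then obtain m where m: "m \<in> keys p" by (metis keys_eq_empty ex_in_conv)
  then have "m \<in> (\<Union>i\<in>A. keys (c i * f i))"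
    using keys_sum[of "\<lambda>i. c i * f i" A] assms(1) by blast
  then obtain i where i: "i \<in> A" "m \<in> keys (c i * f i)" by blast
  obtain k l where "k \<in> keys (c i)" "l \<in> keys (f i)" "m = k + l"
    using keys_mult_subset[OF i(2)] by blast
  with i(1) have "mdeg m \<ge> e" using assms(2) by (auto simp: homogeneous_iff mdeg_add)
  then show False using assms(3,4) m by (auto simp: homogeneous_iff)
qed

lemma homogeneous_partial:
  assumes "homogeneous V d p"
  shows "homogeneous V (d - 1) (partial i p)"
  unfolding partial_def
proof (rule homogeneous_sum)
  fix m assume m: "m \<in> keys p"
  show "homogeneous V (d - 1) (single (m - single i 1) (of_nat (lookup m i) * lookup p m))"
  \<comment> \<open>If \<open>i\<close> does not occur in \<open>m\<close>, truncated subtraction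
    leaves \<open>m\<close> unchanged, but the coefficient is then zero.\<close>
  proof (cases "lookup m i = 0")
    case False
    have eq: "m = (m - single i 1) + single i 1"
      by (rule poly_mapping_eqI) (use False in \<open>auto simp: lookup_add lookup_minus lookup_single when_def\<close>)
    have "mdeg m = mdeg (m - single i 1) + 1"
      using arg_cong[OF eq, of mdeg] by (simp only: mdeg_add mdeg_single)
    moreover have "keys (m - single i 1) \<subseteq> keys m"
      by (auto simp: in_keys_iff lookup_minus)
    ultimately have "m - single i 1 \<in> monomials V (d - 1)"
      using m assms unfolding monomials_iff homogeneous_iff by fastforce
    then show ?thesis by (rule homogeneous_single)
  qed simp
qed

text \<open>Links the formal derivative to analysis, so that the Euler identity and the chain rule
  follow from uniqueness of derivatives along a line.\<close>

lemma eval_partial_derivative: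
  assumes "finite A" "\<And>m. m \<in> keys p \<Longrightarrow> keys m \<subseteq> A"
  shows "((\<lambda>t. eval_at (\<lambda>i. x i + t * v i) p) has_field_derivative
      (\<Sum>i\<in>A. v i * eval_at x (partial i p))) (at 0)"
proof -
  have mon: "((\<lambda>t. mon_eval (\<lambda>i. x i + t * v i) m) has_field_derivative
      (\<Sum>i\<in>A. v i * (of_nat (lookup m i) * mon_eval x (m - single i 1)))) (at 0)"
    if m: "keys m \<subseteq> A" for m
  proof -
    have d: "((\<lambda>t. \<Prod>i\<in>A. (x i + t * v i) ^ lookup m i) has_field_derivative
      (\<Sum>i\<in>A. (of_nat (lookup m i) * (x i) ^ (lookup m i - 1) * v i) *
         (\<Prod>j\<in>A - {i}. x j ^ lookup m j))) (at 0)"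
    proof (rule DERIV_cong[OF has_field_derivative_prod])
      fix i show "((\<lambda>t. (x i + t * v i) ^ lookup m i) has_field_derivative
          of_nat (lookup m i) * (x i) ^ (lookup m i - 1) * v i) (at 0)"
        by (auto intro!: derivative_eq_intros)
    qed simp
    have *: "(of_nat (lookup m i) * (x i) ^ (lookup m i - 1) * v i) *
         (\<Prod>j\<in>A - {i}. x j ^ lookup m j) = v i * (of_nat (lookup m i) * mon_eval x (m - single i 1))"
      if i: "i \<in> A" for i
    proof -
      have "keys (m - single i 1) \<subseteq> A"
        using m by (auto simp: in_keys_iff lookup_minus)
      then have "mon_eval x (m - single i 1) = (\<Prod>j\<in>A. x j ^ lookup (m - single i 1) j)"
        using assms(1) by (intro mon_eval_superset)
      also have "\<dots> = x i ^ lookup (m - single i 1) i * (\<Prod>j\<in>A - {i}. x j ^ lookup (m - single i 1) j)"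
        using i assms(1) by (rule prod.remove[rotated])
      also have "\<dots> = x i ^ (lookup m i - 1) * (\<Prod>j\<in>A - {i}. x j ^ lookup m j)"
        by (auto simp: lookup_minus lookup_single when_def intro!: prod.cong)
      finally show ?thesis by (simp add: mult_ac)
    qed
    show ?thesis
      using d assms(1) m by (simp only: mon_eval_superset[of A] sum.cong[OF refl *])
  qed
  have "((\<lambda>t. \<Sum>m\<in>keys p. lookup p m * mon_eval (\<lambda>i. x i + t * v i) m) has_field_derivative
     (\<Sum>m\<in>keys p. lookup p m * (\<Sum>i\<in>A. v i * (of_nat (lookup m i) * mon_eval x (m - single i 1))))) (at 0)"
    by (intro DERIV_sum DERIV_cmult mon assms)
  moreover have "eval_at x (partial i p) =
      (\<Sum>m\<in>keys p. lookup p m * (of_nat (lookup m i) * mon_eval x (m - single i 1)))" for i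
    unfolding partial_def by (simp add: peval_single mult_ac)
  moreover have "(\<Sum>m\<in>keys p. lookup p m * (\<Sum>i\<in>A. v i * (of_nat (lookup m i) * mon_eval x (m - single i 1)))) =
      (\<Sum>i\<in>A. v i * (\<Sum>m\<in>keys p. lookup p m * (of_nat (lookup m i) * mon_eval x (m - single i 1))))"
    unfolding sum_distrib_left by (subst sum.swap) (simp only: mult_ac)
  ultimately show ?thesis
    unfolding peval_alt[of _ _ p] by simp
qed

lemma homogeneous_keys: "homogeneous V d p \<Longrightarrow> m \<in> keys p \<Longrightarrow> keys m \<subseteq> V"
  by (auto simp: homogeneous_iff)

text \<open>Both sides are the derivative at \<open>t = 0\<close> of the value of \<open>p\<close>
  at \<open>(1 + t) x\<close>.\<close>

lemma euler_identity:
  assumes "homogeneous V d p" "finite V"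
  shows "(\<Sum>i\<in>V. x i * eval_at x (partial i p)) = of_nat d * eval_at x p"
proof -
  have "((\<lambda>t. eval_at (\<lambda>i. x i + t * x i) p) has_field_derivative
      (\<Sum>i\<in>V. x i * eval_at x (partial i p))) (at 0)"
    by (rule eval_partial_derivative) (use assms homogeneous_keys[OF assms(1)] in auto)
  moreover have "eval_at (\<lambda>i. x i + t * x i) p = (1 + t) ^ d * eval_at x p" for t
    using eval_scale[OF assms(1), of "1 + t" x] by (simp add: algebra_simps)
  moreover have "((\<lambda>t. (1 + t) ^ d * eval_at x p) has_field_derivative
      (of_nat d * eval_at x p)) (at 0)"
    by (auto intro!: derivative_eq_intros)
  ultimately show ?thesis using DERIV_unique by simp
qed

lemma homogeneous_pullback:
  assumes "homogeneous {..<N} d f"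
  shows "homogeneous {..<dim_col B} d (pullback B f)"
  unfolding pullback_def
  by (rule homogeneous_subst[OF assms], intro homogeneous_sum homogeneous_const_mult homogeneous_var) simp

lemma eval_partial_pullback:
  assumes f: "homogeneous {..<N} d f" and j: "j < dim_col B"
  shows "eval_at y (partial j (pullback B f)) =
    (\<Sum>i<N. B $$ (i, j) * eval_at (\<lambda>i. \<Sum>j<dim_col B. B $$ (i, j) * y j) (partial i f))"
proof -
  let ?v = "\<lambda>i. if i = j then 1 else 0 :: complex"
  let ?B = "\<lambda>y i. \<Sum>j<dim_col B. B $$ (i, j) * y j"
  have h: "homogeneous {..<dim_col B} d (pullback B f)"
    using f by (rule homogeneous_pullback)
  have 1: "((\<lambda>t. eval_at (\<lambda>i. y i + t * ?v i) (pullback B f)) has_field_derivative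
      (\<Sum>i<dim_col B. ?v i * eval_at y (partial i (pullback B f)))) (at 0)"
    by (rule eval_partial_derivative) (use homogeneous_keys[OF h] in auto)
  have 2: "((\<lambda>t. eval_at (\<lambda>i. ?B y i + t * B $$ (i, j)) f) has_field_derivative
      (\<Sum>i<N. B $$ (i, j) * eval_at (?B y) (partial i f))) (at 0)"
    by (rule eval_partial_derivative) (use homogeneous_keys[OF f] in auto)
  have 3: "eval_at (\<lambda>i. y i + t * ?v i) (pullback B f) = eval_at (\<lambda>i. ?B y i + t * B $$ (i, j)) f" for t
  proof -
    have "(\<Sum>k<dim_col B. B $$ (i, k) * (y k + t * ?v k)) = ?B y i + t * B $$ (i, j)" for i
    proof -
      have "(\<Sum>k<dim_col B. B $$ (i, k) * (y k + t * ?v k)) =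
          ?B y i + (\<Sum>k<dim_col B. if k = j then t * B $$ (i, j) else 0)"
        unfolding sum.distrib [symmetric] by (rule sum.cong) (auto simp: algebra_simps)
      then show ?thesis using j by simp
    qed
    then show ?thesis by (simp add: eval_pullback)
  qed
  have "(\<Sum>i<dim_col B. ?v i * eval_at y (partial i (pullback B f))) =
      (\<Sum>i<dim_col B. if i = j then eval_at y (partial j (pullback B f)) else 0)"
    by (rule sum.cong) auto
  then have "(\<Sum>i<dim_col B. ?v i * eval_at y (partial i (pullback B f))) =
      eval_at y (partial j (pullback B f))"
    using j by simp
  then show ?thesis
    using DERIV_unique[OF 1[unfolded 3] 2] by simp
qed

section \<open>Linear algebra\<close>

text \<open>Gaussian elimination, one coordinate at a time: a vector \<open>c0\<close> with nonzero
  \<open>b\<close>-entry clears that entry in the others and is then set aside, which lowers both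
  cardinalities by one.\<close>

lemma linear_dependence:
  fixes u :: "'i \<Rightarrow> 'b \<Rightarrow> 'k::field"
  assumes "finite B" "finite T" "card B < card T"
  shows "\<exists>l. (\<exists>c\<in>T. l c \<noteq> 0) \<and> (\<forall>b\<in>B. (\<Sum>c\<in>T. l c * u c b) = 0)"
  using assms
proof (induction B arbitrary: T u rule: finite_induct)
  case empty
  then have "T \<noteq> {}" by auto
  then show ?case by (intro exI[of _ "\<lambda>_. 1"]) auto
next
  case (insert b B)
  show ?case
  proof (cases "\<forall>c\<in>T. u c b = 0")
    case True
    then show ?thesis using insert.IH[of T u] insert.prems insert.hyps by auto
  next
    case False
    then obtain c0 where c0: "c0 \<in> T" "u c0 b \<noteq> 0" by auto
    let ?T = "T - {c0}"
    have "finite ?T" "card B < card ?T" using insert c0 by auto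
    from insert.IH[OF this, of "\<lambda>c b'. u c b' - u c b / u c0 b * u c0 b'"]
    obtain l where l: "\<exists>c\<in>?T. l c \<noteq> 0"
      "\<And>b'. b' \<in> B \<Longrightarrow> (\<Sum>c\<in>?T. l c * (u c b' - u c b / u c0 b * u c0 b')) = 0" by blast
    define s where "s = (\<Sum>c\<in>?T. l c * (u c b / u c0 b))"
    let ?l = "\<lambda>c. if c = c0 then - s else l c"
    have split: "(\<Sum>c\<in>T. ?l c * u c b') = (\<Sum>c\<in>?T. l c * u c b') - s * u c0 b'" for b'
    proof -
      have "(\<Sum>c\<in>T. ?l c * u c b') = - s * u c0 b' + (\<Sum>c\<in>?T. ?l c * u c b')"
        using c0 insert.prems by (subst sum.remove[of _ c0]) auto
      also have "(\<Sum>c\<in>?T. ?l c * u c b') = (\<Sum>c\<in>?T. l c * u c b')"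
        by (rule sum.cong) auto
      finally show ?thesis by simp
    qed
    have "(\<Sum>c\<in>T. ?l c * u c b') = 0" if "b' \<in> insert b B" for b'
    proof (cases "b' = b")
      case True
      have "s * u c0 b = (\<Sum>c\<in>?T. l c * u c b)"
        unfolding s_def sum_distrib_right by (rule sum.cong) (use c0 in auto)
      then show ?thesis unfolding split True by simp
    next
      case False
      have "s * u c0 b' = (\<Sum>c\<in>?T. l c * (u c b / u c0 b * u c0 b'))"
        by (simp add: s_def sum_distrib_right mult.assoc)
      moreover have "b' \<in> B" using False that by simp
      ultimately show ?thesis using l(2)[of b'] unfolding split right_diff_distrib sum_subtractf
        by simp
    qed
    then show ?thesis using l(1) by (intro exI[of _ ?l]) auto
  qed
qed

text \<open>Functionals supported at finitely many points serve as coordinates on spaces of forms.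
  They commute with differentiation in a parameter, and applied to the values of a form they are
  polynomial in its coefficients.\<close>

definition fin_functional :: "(('x \<Rightarrow> complex) \<Rightarrow> complex) \<Rightarrow> bool" where
  "fin_functional L \<longleftrightarrow> (\<exists>X w. finite X \<and> (\<forall>F. L F = (\<Sum>x\<in>X. w x * F x)))"

lemma fin_functional_eval: "fin_functional (\<lambda>F. F x)"
  unfolding fin_functional_def by (rule exI[of _ "{x}"], rule exI[of _ "\<lambda>_. 1"]) simp

lemma fin_functional_0: "fin_functional (\<lambda>F. 0)"
  unfolding fin_functional_def by (rule exI[of _ "{}"]) simp

lemma fin_functional_cmult:
  assumes "fin_functional L" shows "fin_functional (\<lambda>F. c * L F)"
proof -
  obtain X w where "finite X" "\<And>F. L F = (\<Sum>x\<in>X. w x * F x)"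
    using assms by (auto simp: fin_functional_def)
  then show ?thesis unfolding fin_functional_def
    by (intro exI[of _ X] exI[of _ "\<lambda>x. c * w x"]) (simp add: sum_distrib_left mult.assoc)
qed

lemma fin_functional_add:
  assumes "fin_functional L" "fin_functional M" shows "fin_functional (\<lambda>F. L F + M F)"
proof -
  obtain X w where L: "finite X" "\<And>F. L F = (\<Sum>x\<in>X. w x * F x)"
    using assms by (auto simp: fin_functional_def)
  obtain Y v where M: "finite Y" "\<And>F. M F = (\<Sum>x\<in>Y. v x * F x)"
    using assms by (auto simp: fin_functional_def)
  let ?w = "\<lambda>x. (if x \<in> X then w x else 0) + (if x \<in> Y then v x else 0)"
  have "L F + M F = (\<Sum>x\<in>X \<union> Y. ?w x * F x)" for F
  proof -
    have "(\<Sum>x\<in>X \<union> Y. (if x \<in> X then w x else 0) * F x) = L F"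
      unfolding L(2) by (rule sum.mono_neutral_cong_right) (use L M in auto)
    moreover have "(\<Sum>x\<in>X \<union> Y. (if x \<in> Y then v x else 0) * F x) = M F"
      unfolding M(2) by (rule sum.mono_neutral_cong_right) (use L M in auto)
    ultimately show ?thesis by (simp add: distrib_right sum.distrib)
  qed
  then show ?thesis unfolding fin_functional_def
    by (intro exI[of _ "X \<union> Y"] exI[of _ ?w]) (use L(1) M(1) in simp)
qed

lemma fin_functional_sum:
  "(\<And>i. i \<in> A \<Longrightarrow> fin_functional (L i)) \<Longrightarrow> fin_functional (\<lambda>F. \<Sum>i\<in>A. L i F)"
  by (induction A rule: infinite_finite_induct) (simp_all add: fin_functional_0 fin_functional_add)

lemma fin_functional_linear:
  assumes "fin_functional L"
  shows "L (\<lambda>x. \<Sum>i\<in>A. c i * F i x) = (\<Sum>i\<in>A. c i * L (F i))"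
    and "L (\<lambda>x. G x - H x) = L G - L H"
proof -
  obtain X w where L: "finite X" "\<And>F. L F = (\<Sum>x\<in>X. w x * F x)"
    using assms by (auto simp: fin_functional_def)
  show "L (\<lambda>x. \<Sum>i\<in>A. c i * F i x) = (\<Sum>i\<in>A. c i * L (F i))"
    unfolding L sum_distrib_left by (subst sum.swap) (simp add: mult_ac)
  show "L (\<lambda>x. G x - H x) = L G - L H"
    unfolding L by (simp add: algebra_simps sum_subtractf)
qed

text \<open>Independence provides a point \<open>x0\<close> at which the part \<open>r\<close> of
  the new function not explained by the earlier ones is nonzero. Evaluating the analogous remainder
  at \<open>x0\<close> gives the new functional, and the old ones are corrected by multiples of
  it.\<close>

lemma dual_functionals:
  fixes p :: "'i \<Rightarrow> 'x \<Rightarrow> complex"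
  assumes "finite I" "\<And>c. (\<And>x. (\<Sum>i\<in>I. c i * p i x) = 0) \<Longrightarrow> \<forall>i\<in>I. c i = 0"
  shows "\<exists>L. (\<forall>i\<in>I. fin_functional (L i)) \<and>
    (\<forall>i\<in>I. \<forall>j\<in>I. L i (p j) = (if i = j then 1 else 0))"
  using assms
proof (induction I rule: finite_induct)
  case (insert k I)
  have "\<forall>i\<in>I. c i = 0" if "\<And>x. (\<Sum>i\<in>I. c i * p i x) = 0" for c
  proof -
    have "(\<Sum>i\<in>insert k I. (if i = k then 0 else c i) * p i x) = 0" for x
    proof -
      have "(\<Sum>i\<in>I. (if i = k then 0 else c i) * p i x) = (\<Sum>i\<in>I. c i * p i x)"
        by (rule sum.cong) (use insert.hyps in auto)
      then show ?thesis using insert.hyps that by simp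
    qed
    from insert.prems[OF this] show ?thesis using insert.hyps by (auto split: if_splits)
  qed
  from insert.IH[OF this] obtain L where
    L: "\<And>i. i \<in> I \<Longrightarrow> fin_functional (L i)"
       "\<And>i j. i \<in> I \<Longrightarrow> j \<in> I \<Longrightarrow> L i (p j) = (if i = j then 1 else 0)" by blast
  define r where "r x = p k x - (\<Sum>i\<in>I. L i (p k) * p i x)" for x
  have "\<exists>x. r x \<noteq> 0"
  proof (rule ccontr)
    assume "\<nexists>x. r x \<noteq> 0"
    then have r: "r x = 0" for x by auto
    have "(\<Sum>i\<in>insert k I. (if i = k then 1 else - L i (p k)) * p i x) = 0" for x
    proof -
      have "(\<Sum>i\<in>I. (if i = k then 1 else - L i (p k)) * p i x) = (\<Sum>i\<in>I. - L i (p k) * p i x)"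
        by (rule sum.cong) (use insert.hyps in auto)
      then show ?thesis using r[of x] insert.hyps by (simp add: r_def sum_negf)
    qed
    from insert.prems[OF this] show False by auto
  qed
  then obtain x0 where x0: "r x0 \<noteq> 0" by blast
  define K where "K F = (1 / r x0) * (F x0 + (-1) * (\<Sum>i\<in>I. p i x0 * L i F))" for F
  have K: "fin_functional K"
    unfolding K_def
    by (intro fin_functional_cmult fin_functional_add fin_functional_eval fin_functional_sum L)
  have Kj: "K (p j) = 0" if "j \<in> I" for j
  proof -
    have "(\<Sum>i\<in>I. p i x0 * L i (p j)) = (\<Sum>i\<in>I. if i = j then p i x0 else 0)"
      by (rule sum.cong) (use L that in auto)
    also have "\<dots> = p j x0" using that insert.hyps by simp
    finally show ?thesis by (simp add: K_def)
  qed
  have Kk: "K (p k) = 1"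
    using x0 by (simp add: K_def r_def mult.commute)
  define M where "M i F = (if i = k then K F else L i F + (- L i (p k)) * K F)" for i F
  have "fin_functional (M i)" if "i \<in> insert k I" for i
  proof (cases "i = k")
    case False
    then have "fin_functional (\<lambda>F. L i F + (- L i (p k)) * K F)"
      using that L K by (intro fin_functional_add fin_functional_cmult) auto
    then show ?thesis using False by (simp add: M_def [abs_def])
  qed (use K in \<open>simp add: M_def [abs_def]\<close>)
  moreover have "M i (p j) = (if i = j then 1 else 0)" if "i \<in> insert k I" "j \<in> insert k I" for i j
    using that L Kj Kk insert.hyps by (auto simp: M_def)
  ultimately show ?case by blast
qed simp

text \<open>By fraction-free Gaussian elimination, one vector at a time.\<close>
lemma generic_relation_lift:
  fixes p :: "'i \<Rightarrow> 'x \<Rightarrow> nat mpoly"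
  assumes "finite I"
  shows "\<exists>q. q \<noteq> 0 \<and> (\<forall>a c. eval_at a q \<noteq> 0 \<longrightarrow> (\<forall>x. (\<Sum>i\<in>I. c i * eval_at a (p i x)) = 0) \<longrightarrow>
     (\<exists>C. (\<forall>x. (\<Sum>i\<in>I. C i * p i x) = 0) \<and> (\<forall>i\<in>I. eval_at a (C i) = c i)))"
  using assms
proof (induction I arbitrary: p rule: finite_induct)
  case empty
  show ?case by (rule exI[of _ 1]) simp
next
  case (insert k I)
  have upd: "(\<Sum>i\<in>insert k I. (if i = k then z else C i) * P i) = z * P k + (\<Sum>i\<in>I. C i * P i)"
    for z C and P :: "'i \<Rightarrow> nat mpoly"
  proof -
    have "(\<Sum>i\<in>I. (if i = k then z else C i) * P i) = (\<Sum>i\<in>I. C i * P i)"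
      by (rule sum.cong) (use insert.hyps in auto)
    then show ?thesis using insert.hyps by simp
  qed
  show ?case
  proof (cases "\<forall>x. p k x = 0")
    case True
    obtain q where q: "q \<noteq> 0" "\<And>a c. eval_at a q \<noteq> 0 \<Longrightarrow> (\<forall>x. (\<Sum>i\<in>I. c i * eval_at a (p i x)) = 0) \<Longrightarrow>
       (\<exists>C. (\<forall>x. (\<Sum>i\<in>I. C i * p i x) = 0) \<and> (\<forall>i\<in>I. eval_at a (C i) = c i))"
      using insert.IH[of p] by blast
    have "\<exists>C. (\<forall>x. (\<Sum>i\<in>insert k I. C i * p i x) = 0) \<and> (\<forall>i\<in>insert k I. eval_at a (C i) = c i)"
      if a: "eval_at a q \<noteq> 0" and c: "\<forall>x. (\<Sum>i\<in>insert k I. c i * eval_at a (p i x)) = 0" for a c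
    proof -
      have "\<forall>x. (\<Sum>i\<in>I. c i * eval_at a (p i x)) = 0"
        using c True insert.hyps by simp
      then obtain C where C: "\<And>x. (\<Sum>i\<in>I. C i * p i x) = 0" "\<And>i. i \<in> I \<Longrightarrow> eval_at a (C i) = c i"
        using q(2)[OF a] by blast
      show ?thesis
        by (rule exI[of _ "\<lambda>i. if i = k then const (c k) else C i"])
           (use C True insert.hyps in \<open>auto simp: upd\<close>)
    qed
    then show ?thesis using q(1) by blast
  next
    case False
    then obtain x0 where x0: "p k x0 \<noteq> 0" by blast
    define p' where "p' i x = p k x0 * p i x - p i x0 * p k x" for i x
    obtain q where q: "q \<noteq> 0" "\<And>a c. eval_at a q \<noteq> 0 \<Longrightarrow> (\<forall>x. (\<Sum>i\<in>I. c i * eval_at a (p' i x)) = 0) \<Longrightarrow>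
       (\<exists>C. (\<forall>x. (\<Sum>i\<in>I. C i * p' i x) = 0) \<and> (\<forall>i\<in>I. eval_at a (C i) = c i))"
      using insert.IH[of p'] by blast
    have "\<exists>C. (\<forall>x. (\<Sum>i\<in>insert k I. C i * p i x) = 0) \<and> (\<forall>i\<in>insert k I. eval_at a (C i) = c i)"
      if a: "eval_at a (q * p k x0) \<noteq> 0" and c: "\<forall>x. (\<Sum>i\<in>insert k I. c i * eval_at a (p i x)) = 0" for a c
    proof -
      let ?z = "eval_at a (p k x0)"
      have z: "?z \<noteq> 0" and aq: "eval_at a q \<noteq> 0" using a by auto
      have cI: "(\<Sum>i\<in>I. c i * eval_at a (p i x)) = - c k * eval_at a (p k x)" for x
        using c[rule_format, of x] insert.hyps by (simp add: eq_neg_iff_add_eq_0 add.commute)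
      have "(\<Sum>i\<in>I. c i * eval_at a (p' i x)) = ?z * (\<Sum>i\<in>I. c i * eval_at a (p i x))
         - (\<Sum>i\<in>I. c i * eval_at a (p i x0)) * eval_at a (p k x)" for x
        by (simp add: p'_def algebra_simps sum_subtractf sum_distrib_left)
      then have "\<forall>x. (\<Sum>i\<in>I. c i * eval_at a (p' i x)) = 0"
        unfolding cI by (simp add: algebra_simps)
      then obtain C where C: "\<And>x. (\<Sum>i\<in>I. C i * p' i x) = 0" "\<And>i. i \<in> I \<Longrightarrow> eval_at a (C i) = c i"
        using q(2)[OF aq] by blast
      define s where "s = (\<Sum>i\<in>I. C i * p i x0)"
      have C': "p k x0 * (\<Sum>i\<in>I. C i * p i x) - s * p k x = 0" for x
        using C(1)[of x] unfolding p'_def s_def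
        by (simp add: algebra_simps sum_subtractf sum_distrib_left)
      \<comment> \<open>Division is by the number \<open>?z\<close>, the value of the pivot at
        \<open>a\<close>, so \<open>?C\<close> stays polynomial and still takes the prescribed
        values at \<open>a\<close>.\<close>
      let ?C = "\<lambda>i. if i = k then const (1 / ?z) * (- s) else const (1 / ?z) * p k x0 * C i"
      have "(\<Sum>i\<in>insert k I. ?C i * p i x) = 0" for x
      proof -
        have "(\<Sum>i\<in>insert k I. ?C i * p i x) = const (1 / ?z) * (p k x0 * (\<Sum>i\<in>I. C i * p i x) - s * p k x)"
          unfolding upd by (simp add: algebra_simps sum_distrib_left)
        then show ?thesis by (simp add: C')
      qed
      moreover have "eval_at a s = - c k * ?z"
        unfolding s_def using C(2) cI[of x0] by simp
      then have "\<forall>i\<in>insert k I. eval_at a (?C i) = c i"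
        using z C(2) by auto
      ultimately show ?thesis by (intro exI[of _ ?C]) simp
    qed
    moreover have "q * p k x0 \<noteq> 0" using q(1) x0 by simp
    ultimately show ?thesis by blast
  qed
qed

section \<open>Ideals and Koszul relations\<close>

definition gen_ideal :: "('i \<Rightarrow> 'r::comm_ring_1) \<Rightarrow> 'i set \<Rightarrow> 'r set" where
  "gen_ideal f A = {p. \<exists>c. p = (\<Sum>i\<in>A. c i * f i)}"

lemma gen_idealI: "p = (\<Sum>i\<in>A. c i * f i) \<Longrightarrow> p \<in> gen_ideal f A"
  unfolding gen_ideal_def by auto

lemma gen_ideal_0 [simp]: "0 \<in> gen_ideal f A"
  unfolding gen_ideal_def by (auto intro!: exI[of _ "\<lambda>_. 0"])

lemma gen_ideal_add: "p \<in> gen_ideal f A \<Longrightarrow> q \<in> gen_ideal f A \<Longrightarrow> p + q \<in> gen_ideal f A"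
  unfolding gen_ideal_def by (auto simp flip: sum.distrib distrib_right)

lemma gen_ideal_mult: "p \<in> gen_ideal f A \<Longrightarrow> r * p \<in> gen_ideal f A"
proof -
  assume "p \<in> gen_ideal f A"
  then obtain c where "p = (\<Sum>i\<in>A. c i * f i)" by (auto simp: gen_ideal_def)
  then have "r * p = (\<Sum>i\<in>A. (r * c i) * f i)" by (simp add: sum_distrib_left mult.assoc)
  then show ?thesis by (rule gen_idealI)
qed

lemma gen_ideal_uminus: "p \<in> gen_ideal f A \<Longrightarrow> - p \<in> gen_ideal f A"
  using gen_ideal_mult[of p f A "-1"] by simp

lemma gen_ideal_sum: "(\<And>i. i \<in> B \<Longrightarrow> p i \<in> gen_ideal f A) \<Longrightarrow> (\<Sum>i\<in>B. p i) \<in> gen_ideal f A"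
  by (induction B rule: infinite_finite_induct) (simp_all add: gen_ideal_add)

lemma gen_ideal_base: "finite A \<Longrightarrow> i \<in> A \<Longrightarrow> f i \<in> gen_ideal f A"
  unfolding gen_ideal_def
  by (auto intro!: exI[of _ "\<lambda>j. if j = i then 1 else 0"] simp: if_distrib[of "\<lambda>c. c * _"] cong: if_cong)

lemma gen_ideal_lessThan_Suc:
  "p \<in> gen_ideal g {..<Suc j} \<longleftrightarrow> (\<exists>q\<in>gen_ideal g {..<j}. \<exists>r. p = q + r * g j)"
proof
  assume "p \<in> gen_ideal g {..<Suc j}"
  then show "\<exists>q\<in>gen_ideal g {..<j}. \<exists>r. p = q + r * g j"
    unfolding gen_ideal_def by auto
next
  assume "\<exists>q\<in>gen_ideal g {..<j}. \<exists>r. p = q + r * g j"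
  then obtain c r where "p = (\<Sum>i<j. c i * g i) + r * g j" by (auto simp: gen_ideal_def)
  then have "p = (\<Sum>i<Suc j. (if i = j then r else c i) * g i)" by simp
  then show "p \<in> gen_ideal g {..<Suc j}" by (rule gen_idealI)
qed

section \<open>The Koszul complex in coordinates\<close>

definition ksign :: "nat \<Rightarrow> nat set \<Rightarrow> 'r::comm_ring_1" where
  "ksign i J = (-1) ^ card {j\<in>J. j < i}"

text \<open>The Koszul differential: a chain is the family \<open>w J\<close> of its coefficients at
  the exterior basis elements, with all degrees kept in one function. The coefficient at
  \<open>J\<close> involves sets with one more element.\<close>

definition koszul :: "(nat \<Rightarrow> 'r::comm_ring_1) \<Rightarrow> nat set \<Rightarrow> (nat set \<Rightarrow> 'r) \<Rightarrow> nat set \<Rightarrow> 'r" where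
  "koszul f I w J = (\<Sum>i\<in>I - J. ksign i J * f i * w (insert i J))"

text \<open>Left exterior multiplication by the element of degree one with coefficients
  \<open>c\<close>.\<close>

definition koszul_wedge :: "(nat \<Rightarrow> 'r::comm_ring_1) \<Rightarrow> (nat set \<Rightarrow> 'r) \<Rightarrow> nat set \<Rightarrow> 'r" where
  "koszul_wedge c w J = (\<Sum>j\<in>J. ksign j (J - {j}) * c j * w (J - {j}))"

lemma ksign_square [simp]: "ksign i J * ksign i J = (1 :: 'r::comm_ring_1)"
  by (simp add: ksign_def flip: power_add)

lemma ksign_insert:
  assumes "finite J" "k \<notin> J"
  shows "ksign i (insert k J) = (if k < i then - ksign i J else ksign i J :: 'r::comm_ring_1)"
proof -
  have "{j \<in> insert k J. j < i} = (if k < i then insert k {j\<in>J. j < i} else {j\<in>J. j < i})"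
    by auto
  then show ?thesis using assms by (simp add: ksign_def)
qed

text \<open>The terms for \<open>(i, k)\<close> and \<open>(k, i)\<close> are opposite, so the
  double sum equals its negative; characteristic zero makes it vanish.\<close>

lemma koszul_koszul:
  assumes "finite I" "finite J"
  shows "koszul f I (koszul f I w) J = (0 :: 'r::{idom, ring_char_0})"
proof -
  let ?T = "\<lambda>i k. if i = k then 0 else ksign i J * f i * (ksign k (insert i J) * f k * w (insert k (insert i J)))"
  have "koszul f I (koszul f I w) J = (\<Sum>i\<in>I - J. \<Sum>k\<in>I - insert i J.
     ksign i J * f i * (ksign k (insert i J) * f k * w (insert k (insert i J))))"
    by (simp add: koszul_def sum_distrib_left)
  also have "\<dots> = (\<Sum>i\<in>I - J. \<Sum>k\<in>I - J. ?T i k)"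
  proof (rule sum.cong)
    fix i assume "i \<in> I - J"
    show "(\<Sum>k\<in>I - insert i J. ksign i J * f i * (ksign k (insert i J) * f k * w (insert k (insert i J)))) =
      (\<Sum>k\<in>I - J. ?T i k)"
      by (rule sum.mono_neutral_cong_left) (use assms in auto)
  qed simp
  finally have eq: "koszul f I (koszul f I w) J = (\<Sum>i\<in>I - J. \<Sum>k\<in>I - J. ?T i k)" .
  have anti: "?T i k = - ?T k i" if "i \<in> I - J" "k \<in> I - J" for i k
    using that assms by (auto simp: ksign_insert insert_commute)
  have "(\<Sum>i\<in>I - J. \<Sum>k\<in>I - J. ?T i k) = (\<Sum>i\<in>I - J. \<Sum>k\<in>I - J. - ?T k i)"
    by (intro sum.cong refl anti)
  also have "\<dots> = - (\<Sum>k\<in>I - J. \<Sum>i\<in>I - J. ?T k i)"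
    by (subst sum.swap) (simp only: sum_negf)
  finally have "2 * (\<Sum>i\<in>I - J. \<Sum>k\<in>I - J. ?T i k) = 0"
    by (simp only: eq_neg_iff_add_eq_0 mult_2)
  then show ?thesis using eq by simp
qed

text \<open>The Leibniz rule. It is the reason why every element of the ideal of the
  \<open>f i\<close> annihilates Koszul homology.\<close>

lemma koszul_homotopy:
  assumes "finite I" "J \<subseteq> I"
  shows "koszul f I (koszul_wedge c w) J + koszul_wedge c (koszul f I w) J = (\<Sum>i\<in>I. c i * f i) * w J"
proof -
  have finJ: "finite J" using assms finite_subset by blast
  let ?X = "\<lambda>i j. ksign i J * f i * (ksign j (insert i (J - {j})) * c j * w (insert i (J - {j})))"
  let ?Y = "\<lambda>i j. ksign j (J - {j}) * c j * (ksign i (J - {j}) * f i * w (insert i (J - {j})))"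
  have "koszul f I (koszul_wedge c w) J =
      (\<Sum>i\<in>I - J. f i * c i * w J + (\<Sum>j\<in>J. ?X i j))"
    unfolding koszul_def
  proof (rule sum.cong)
    fix i assume i: "i \<in> I - J"
    have "koszul_wedge c w (insert i J) = ksign i J * c i * w J +
       (\<Sum>j\<in>J. ksign j (insert i J - {j}) * c j * w (insert i J - {j}))"
      using i finJ by (simp add: koszul_wedge_def)
    also have "(\<Sum>j\<in>J. ksign j (insert i J - {j}) * c j * w (insert i J - {j})) =
      (\<Sum>j\<in>J. ksign j (insert i (J - {j})) * c j * w (insert i (J - {j})))"
    proof (rule sum.cong)
      fix j assume "j \<in> J"
      then have "insert i J - {j} = insert i (J - {j})" using i by auto
      then show "ksign j (insert i J - {j}) * c j * w (insert i J - {j}) =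
        ksign j (insert i (J - {j})) * c j * w (insert i (J - {j}))" by simp
    qed simp
    finally have "ksign i J * f i * koszul_wedge c w (insert i J) =
      (ksign i J * ksign i J) * f i * c i * w J + (\<Sum>j\<in>J. ?X i j)"
      by (simp only: distrib_left sum_distrib_left mult_ac)
    then show "ksign i J * f i * koszul_wedge c w (insert i J) = f i * c i * w J + (\<Sum>j\<in>J. ?X i j)"
      by simp
  qed simp
  moreover have "koszul_wedge c (koszul f I w) J =
      (\<Sum>j\<in>J. f j * c j * w J + (\<Sum>i\<in>I - J. ?Y i j))"
    unfolding koszul_wedge_def
  proof (rule sum.cong)
    fix j assume j: "j \<in> J"
    have I: "I - (J - {j}) = insert j (I - J)" using j assms by auto
    have "koszul f I w (J - {j}) = ksign j (J - {j}) * f j * w J +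
       (\<Sum>i\<in>I - J. ksign i (J - {j}) * f i * w (insert i (J - {j})))"
      using j assms by (simp add: koszul_def I insert_absorb)
    then have "ksign j (J - {j}) * c j * koszul f I w (J - {j}) =
      (ksign j (J - {j}) * ksign j (J - {j})) * f j * c j * w J + (\<Sum>i\<in>I - J. ?Y i j)"
      by (simp only: distrib_left sum_distrib_left mult_ac)
    then show "ksign j (J - {j}) * c j * koszul f I w (J - {j}) = f j * c j * w J + (\<Sum>i\<in>I - J. ?Y i j)"
      by simp
  qed simp
  \<comment> \<open>Exchanging the insertion of \<open>i\<close> with the removal of
    \<open>j\<close> flips exactly one of the two signs: the first if \<open>j < i\<close>, the
    second if \<open>i < j\<close>.\<close>
  moreover have "?X i j + ?Y i j = 0" if "i \<in> I - J" "j \<in> J" for i j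
  proof -
    have "ksign i J = (if j < i then - ksign i (J - {j}) else ksign i (J - {j}) :: 'a)"
      using ksign_insert[of "J - {j}" j i] that finJ by (simp add: insert_absorb)
    moreover have "ksign j (insert i (J - {j})) =
        (if i < j then - ksign j (J - {j}) else ksign j (J - {j}) :: 'a)"
      using ksign_insert[of "J - {j}" i j] that finJ by simp
    moreover have "i < j \<or> j < i" using that by (metis DiffD2 linorder_neqE_nat)
    ultimately show ?thesis by (auto simp: mult_ac)
  qed
  then have "(\<Sum>i\<in>I - J. \<Sum>j\<in>J. ?X i j) + (\<Sum>j\<in>J. \<Sum>i\<in>I - J. ?Y i j) = 0"
    by (subst (2) sum.swap) (simp flip: sum.distrib)
  moreover have "(\<Sum>i\<in>I. c i * f i) = (\<Sum>i\<in>I - J. f i * c i) + (\<Sum>j\<in>J. f j * c j)"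
    using sum.subset_diff[OF assms(2,1), of "\<lambda>i. f i * c i"] by (simp add: mult.commute)
  ultimately show ?thesis
    by (simp add: sum.distrib distrib_right sum_distrib_right sum_distrib_left algebra_simps)
qed

text \<open>
  If \<open>g\<close> is a regular sequence of length \<open>N\<close> inside the ideal generated by the \<open>f i\<close>, then each
  \<open>g j\<close> acts as zero on Koszul homology, so the long exact sequence of multiplication by \<open>g j\<close>
  shifts a nonzero class one step up while one \<open>g\<close> is divided out.
\<close>
lemma koszul_exact:
  fixes f :: "nat \<Rightarrow> 'r::{idom, ring_char_0}"
  assumes I: "finite I" and gI: "\<And>j. j < N \<Longrightarrow> g j \<in> gen_ideal f I"
    and reg: "\<And>j p. j < N \<Longrightarrow> g j * p \<in> gen_ideal g {..<j} \<Longrightarrow> p \<in> gen_ideal g {..<j}"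
    and "j \<le> N" "card I < i + (N - j)" "i > 0"
    and "\<And>J. J \<subseteq> I \<Longrightarrow> card J = i - 1 \<Longrightarrow> koszul f I w J \<in> gen_ideal g {..<j}"
  shows "\<exists>h. \<forall>J. J \<subseteq> I \<longrightarrow> card J = i \<longrightarrow> w J - koszul f I h J \<in> gen_ideal g {..<j}"
  using assms(4-)
proof (induction "N - j" arbitrary: i j w)
  case 0
  \<comment> \<open>Once the whole sequence is divided out, the numerical hypothesis leaves no set
    of size \<open>i\<close>.\<close>
  have "card J < i" if "J \<subseteq> I" for J
    using card_mono[OF I that] 0 by simp
  then show ?case by (metis less_irrefl)
next
  case (Suc n)
  then have j: "j < N" by simp
  let ?G = "gen_ideal g {..<j}" and ?G' = "gen_ideal g {..<Suc j}"
  obtain c where c: "g j = (\<Sum>i\<in>I. c i * f i)" using gI[OF j] by (auto simp: gen_ideal_def)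
  \<comment> \<open>The connecting homomorphism: modulo \<open>?G\<close> the differential of
    \<open>?s\<close> is \<open>g j * w\<close>, so modulo \<open>?G'\<close> it is a cycle one
    degree higher, to which the induction hypothesis applies.\<close>
  let ?s = "koszul_wedge c w"
  have hom: "g j * w J - koszul f I ?s J \<in> ?G" if J: "J \<subseteq> I" "card J = i" for J
  proof -
    have "koszul_wedge c (koszul f I w) J \<in> ?G"
      unfolding koszul_wedge_def
    proof (intro gen_ideal_sum gen_ideal_mult)
      fix k assume "k \<in> J"
      then have "card (J - {k}) = i - 1" "J - {k} \<subseteq> I"
        using J I finite_subset by auto
      then show "koszul f I w (J - {k}) \<in> ?G" using Suc.prems by blast
    qed
    moreover have "g j * w J - koszul f I ?s J = koszul_wedge c (koszul f I w) J"
      using koszul_homotopy[OF I J(1), of f c w] unfolding c [symmetric]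
      by (metis add_diff_cancel_left')
    ultimately show ?thesis by simp
  qed
  have "\<exists>h. \<forall>J. J \<subseteq> I \<longrightarrow> card J = Suc i \<longrightarrow> ?s J - koszul f I h J \<in> ?G'"
  proof (rule Suc.hyps(1))
    show "n = N - Suc j" "Suc j \<le> N" "card I < Suc i + (N - Suc j)" "0 < Suc i"
      using Suc.hyps Suc.prems j by auto
    fix J assume J: "J \<subseteq> I" "card J = Suc i - 1"
    have "koszul f I ?s J = - (g j * w J - koszul f I ?s J) + w J * g j" by simp
    then show "koszul f I ?s J \<in> ?G'"
      unfolding gen_ideal_lessThan_Suc using hom[of J] J gen_ideal_uminus by (metis diff_Suc_1)
  qed
  then obtain h where h: "\<And>J. J \<subseteq> I \<Longrightarrow> card J = Suc i \<Longrightarrow> ?s J - koszul f I h J \<in> ?G'" by blast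
  have "\<forall>J. \<exists>r. J \<subseteq> I \<and> card J = Suc i \<longrightarrow> ?s J - koszul f I h J - r * g j \<in> ?G"
  proof
    fix J
    show "\<exists>r. J \<subseteq> I \<and> card J = Suc i \<longrightarrow> ?s J - koszul f I h J - r * g j \<in> ?G"
    proof (cases "J \<subseteq> I \<and> card J = Suc i")
      case True
      then obtain q r where "q \<in> ?G" "?s J - koszul f I h J = q + r * g j"
        using h[of J] unfolding gen_ideal_lessThan_Suc by blast
      then show ?thesis by (intro exI[of _ r]) simp
    qed blast
  qed
  from choice[OF this] obtain r
    where r: "\<And>J. J \<subseteq> I \<Longrightarrow> card J = Suc i \<Longrightarrow> ?s J - koszul f I h J - r J * g j \<in> ?G"
    by blast
  have "w J - koszul f I r J \<in> ?G" if J: "J \<subseteq> I" "card J = i" for J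
  proof -
    have finJ: "finite J" using J I finite_subset by blast
    \<comment> \<open>Applying the differential removes the boundary of \<open>h\<close> and turns
      \<open>?s\<close> into \<open>g j * w\<close> modulo \<open>?G\<close>. Regularity then
      cancels \<open>g j\<close> and exhibits \<open>r\<close> as the required chain.\<close>
    have "koszul f I (\<lambda>J. ?s J - koszul f I h J - r J * g j) J \<in> ?G"
      unfolding koszul_def[of f I "\<lambda>J. ?s J - koszul f I h J - r J * g j"]
    proof (intro gen_ideal_sum gen_ideal_mult)
      fix k assume k: "k \<in> I - J"
      then have "insert k J \<subseteq> I" "card (insert k J) = Suc i" using J finJ by auto
      then show "?s (insert k J) - koszul f I h (insert k J) - r (insert k J) * g j \<in> ?G"
        by (rule r)
    qed
    also have "koszul f I (\<lambda>J. ?s J - koszul f I h J - r J * g j) J =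
        koszul f I ?s J - koszul f I (koszul f I h) J - g j * koszul f I r J"
      by (simp add: koszul_def[of _ _ _ J] algebra_simps sum_subtractf sum.distrib sum_distrib_left)
    finally have "(g j * w J - koszul f I ?s J) + (koszul f I ?s J - g j * koszul f I r J) \<in> ?G"
      using hom[OF J] koszul_koszul[OF I finJ, of f h] by (intro gen_ideal_add) simp_all
    then have "g j * (w J - koszul f I r J) \<in> ?G" by (simp add: algebra_simps)
    then show ?thesis using reg[OF j] by blast
  qed
  then show ?case by blast
qed

section \<open>Powers of the variables as a regular sequence\<close>

lemma lookup_single_mult: "lookup (single s a * p :: 'v mpoly) (s + m) = a * lookup p m"
proof -
  have "single s a * p = (\<Sum>k\<in>keys p. single (s + k) (a * lookup p k))"
    by (subst (1) mpoly_sum_monomials[of p]) (simp add: sum_distrib_left mult_single)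
  then have "lookup (single s a * p) (s + m) = (\<Sum>k\<in>keys p. if k = m then a * lookup p k else 0)"
    by (simp add: lookup_sum lookup_single when_def)
  then show ?thesis by (simp add: in_keys_iff)
qed

lemma lookup_const_mult: "lookup (const c * p) m = c * lookup p m"
  using lookup_single_mult[of 0 c p m] by (simp add: const_def)

lemma mem_gen_ideal_var_power:
  fixes p :: "nat mpoly"
  shows "p \<in> gen_ideal (\<lambda>j. var j ^ k) {..<j} \<longleftrightarrow> (\<forall>m\<in>keys p. \<exists>i<j. k \<le> lookup m i)"
proof
  assume "p \<in> gen_ideal (\<lambda>j. var j ^ k) {..<j}"
  then obtain c where p: "p = (\<Sum>i<j. c i * var i ^ k)" by (auto simp: gen_ideal_def)
  show "\<forall>m\<in>keys p. \<exists>i<j. k \<le> lookup m i"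
  proof
    fix m assume "m \<in> keys p"
    then obtain i where i: "i < j" "m \<in> keys (c i * var i ^ k)"
      using keys_sum[of "\<lambda>i. c i * var i ^ k" "{..<j}"] unfolding p by blast
    obtain l b where lb: "m = l + b" "b \<in> keys (single (single i k) (1 :: complex))"
      using keys_mult_subset[OF i(2)[unfolded var_power]] by blast
    then have "m = l + single i k" by simp
    then show "\<exists>i<j. k \<le> lookup m i" using i(1) by (auto simp: lookup_add)
  qed
next
  assume *: "\<forall>m\<in>keys p. \<exists>i<j. k \<le> lookup m i"
  have "single m (lookup p m) \<in> gen_ideal (\<lambda>j. var j ^ k) {..<j}" if mp: "m \<in> keys p" for m
  proof -
    obtain i where i: "i < j" "k \<le> lookup m i" using bspec[OF * mp] by auto
    have m: "m = (m - single i k) + single i k"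
      by (rule poly_mapping_eqI) (use i in \<open>auto simp: lookup_add lookup_minus lookup_single when_def\<close>)
    have "single m a = single (m - single i k) a * var i ^ k" for a
      using arg_cong[OF m, of "\<lambda>m. single m a"] by (simp only: var_power mult_single mult_1_right)
    moreover have "var i ^ k \<in> gen_ideal (\<lambda>j. var j ^ k :: nat mpoly) {..<j}"
      using gen_ideal_base[of "{..<j}" i "\<lambda>j. var j ^ k"] i(1) by simp
    ultimately show ?thesis
      by (metis gen_ideal_mult)
  qed
  then have "(\<Sum>m\<in>keys p. single m (lookup p m)) \<in> gen_ideal (\<lambda>j. var j ^ k) {..<j}"
    by (rule gen_ideal_sum)
  then show "p \<in> gen_ideal (\<lambda>j. var j ^ k) {..<j}"
    using mpoly_sum_monomials[of p] by simp
qed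

text \<open>Multiplication by \<open>var j ^ k\<close> permutes no monomials and leaves the
  exponents of the variables below \<open>j\<close> alone; these exponents decide
  membership.\<close>

lemma var_power_regular:
  assumes "var j ^ k * p \<in> gen_ideal (\<lambda>j. var j ^ k) {..<j}"
  shows "(p :: nat mpoly) \<in> gen_ideal (\<lambda>j. var j ^ k) {..<j}"
  unfolding mem_gen_ideal_var_power
proof
  fix m assume m: "m \<in> keys p"
  have "single j k + m \<in> keys (var j ^ k * p)"
    using m unfolding in_keys_iff var_power lookup_single_mult by simp
  then obtain i where "i < j" "k \<le> lookup (single j k + m) i"
    using assms unfolding mem_gen_ideal_var_power by blast
  then show "\<exists>i<j. k \<le> lookup m i"
    by (auto simp: lookup_add lookup_single when_def split: if_splits)
qed

lemma koszul_exact_var_power: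
  fixes f :: "nat \<Rightarrow> nat mpoly"
  assumes "finite I" "\<And>j. j < N \<Longrightarrow> var j ^ k \<in> gen_ideal f I" "card I < i + N" "i > 0"
    and "\<And>J. J \<subseteq> I \<Longrightarrow> card J = i - 1 \<Longrightarrow> koszul f I w J = 0"
  obtains h where "\<And>J. J \<subseteq> I \<Longrightarrow> card J = i \<Longrightarrow> w J = koszul f I h J"
proof -
  have "\<exists>h. \<forall>J. J \<subseteq> I \<longrightarrow> card J = i \<longrightarrow> w J - koszul f I h J \<in> gen_ideal (\<lambda>j. var j ^ k) {..<0}"
    by (rule koszul_exact[of I N _ f 0]) (use assms var_power_regular in auto)
  then show thesis using that by (auto simp: gen_ideal_def)
qed

section \<open>Relations of low degree\<close>

lemma koszul_low_degree:
  assumes "\<And>i. i \<in> I \<Longrightarrow> homogeneous V e (f i)" "homogeneous W s (koszul f I h J)" "s < e"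
  shows "koszul f I h J = 0"
proof (rule ideal_low_degree[of _ "\<lambda>i. ksign i J * h (insert i J)" f "I - J"])
  show "koszul f I h J = (\<Sum>i\<in>I - J. ksign i J * h (insert i J) * f i)"
    by (simp add: koszul_def mult_ac)
qed (use assms in auto)

text \<open>A relation is a Koszul cycle of degree one. With no more generators than variables it is
  a boundary, so its coefficients lie in the ideal of the \<open>f i\<close>, which has no nonzero
  element of degree \<open>s < e\<close>.\<close>

lemma no_low_syzygy:
  fixes f :: "nat \<Rightarrow> nat mpoly"
  assumes I: "finite I" "\<And>j. j < N \<Longrightarrow> var j ^ k \<in> gen_ideal f I" "card I \<le> N"
    and f: "\<And>i. i \<in> I \<Longrightarrow> homogeneous V e (f i)"
    and L: "\<And>i. i \<in> I \<Longrightarrow> homogeneous W s (L i)" "s < e"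
    and syz: "(\<Sum>i\<in>I. L i * f i) = 0" and i: "i \<in> I"
  shows "L i = 0"
proof -
  define w where "w J = L (the_elem J)" for J
  have "koszul f I w {} = 0"
    using syz by (simp add: koszul_def w_def ksign_def mult.commute)
  have w0: "koszul f I w J = 0" if "J \<subseteq> I" "card J = 1 - 1" for J
  proof -
    have "finite J" using that(1) I(1) finite_subset by blast
    then have "J = {}" using that(2) by simp
    then show ?thesis using \<open>koszul f I w {} = 0\<close> by simp
  qed
  obtain h where h: "\<And>J. J \<subseteq> I \<Longrightarrow> card J = 1 \<Longrightarrow> w J = koszul f I h J"
    using koszul_exact_var_power[of I N k f 1 w, OF I(1,2) _ _ w0] I(3) by auto
  have "L i = koszul f I h {i}" using h[of "{i}"] i by (simp add: w_def)
  then show ?thesis using koszul_low_degree[of I V e f W s h "{i}"] f L(1)[OF i] L(2) by metis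
qed

text \<open>\<open>L \<and> M\<close> is a Koszul cycle of degree two, so it is a boundary.\<close>
lemma low_syzygies_parallel:
  fixes f :: "nat \<Rightarrow> nat mpoly"
  assumes I: "finite I" "\<And>j. j < N \<Longrightarrow> var j ^ k \<in> gen_ideal f I" "card I \<le> Suc N"
    and f: "\<And>i. i \<in> I \<Longrightarrow> homogeneous V e (f i)"
    and L: "\<And>i. i \<in> I \<Longrightarrow> homogeneous W s (L i)" "(\<Sum>i\<in>I. L i * f i) = 0"
    and M: "\<And>i. i \<in> I \<Longrightarrow> homogeneous W t (M i)" "(\<Sum>i\<in>I. M i * f i) = 0"
    and "s + t < e" and ij: "i \<in> I" "j \<in> I"
  shows "L i * M j = L j * M i"
proof -
  \<comment> \<open>\<open>Min\<close> and \<open>Max\<close> recover the ordered pair from a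
    two-element set; \<open>w\<close> holds the 2 by 2 minors of \<open>L\<close> and
    \<open>M\<close>.\<close>
  define w where "w J = L (Min J) * M (Max J) - L (Max J) * M (Min J)" for J
  have w: "koszul f I w {a} = 0" if a: "a \<in> I" for a
  proof -
    have "ksign i {a} * f i * w {i, a} = f i * (L i * M a - L a * M i)" if "i \<in> I - {a}" for i
    proof (cases "i < a")
      case True
      then have e: "{j \<in> {a}. j < i} = {}" by auto
      have "ksign i {a} = (1 :: nat mpoly)" unfolding ksign_def e by simp
      then show ?thesis using True by (simp add: w_def)
    next
      case False
      then have "a < i" using that by auto
      then have e: "{j \<in> {a}. j < i} = {a}" by auto
      have "ksign i {a} = (- 1 :: nat mpoly)" unfolding ksign_def e by simp
      then show ?thesis using \<open>a < i\<close> by (simp add: w_def algebra_simps)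
    qed
    then have "koszul f I w {a} = (\<Sum>i\<in>I - {a}. f i * (L i * M a - L a * M i))"
      unfolding koszul_def by (intro sum.cong) auto
    also have "\<dots> = (\<Sum>i\<in>I. f i * (L i * M a - L a * M i))"
      using I a by (subst sum.remove[of I a]) auto
    also have "\<dots> = M a * (\<Sum>i\<in>I. L i * f i) - L a * (\<Sum>i\<in>I. M i * f i)"
      by (simp add: algebra_simps sum_subtractf sum_distrib_left)
    finally show ?thesis using L M by simp
  qed
  have w0: "koszul f I w J = 0" if "J \<subseteq> I" "card J = 2 - 1" for J
  proof -
    have "card J = 1" using that by simp
    then obtain a where "J = {a}" by (auto simp: card_1_singleton_iff)
    then show ?thesis using w that by simp
  qed
  \<comment> \<open>Exactness in degree two tolerates one generator more than there are variables,
    since \<open>card I < 2 + N\<close>.\<close>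
  obtain h where h: "\<And>J. J \<subseteq> I \<Longrightarrow> card J = 2 \<Longrightarrow> w J = koszul f I h J"
    using koszul_exact_var_power[of I N k f 2 w, OF I(1,2) _ _ w0] I(3) by auto
  have *: "L i * M j = L j * M i" if "i \<in> I" "j \<in> I" "i < j" for i j
  proof -
    have w2: "w {i, j} = L i * M j - L j * M i" using that by (simp add: w_def)
    have "w {i, j} = koszul f I h {i, j}" using h[of "{i, j}"] that by simp
    moreover have "homogeneous W (s + t) (w {i, j})"
      unfolding w2 using that L M by (intro homogeneous_diff homogeneous_mult) auto
    ultimately have "w {i, j} = 0"
      using koszul_low_degree[of I V e f W "s + t" h "{i, j}"] f \<open>s + t < e\<close> by metis
    then show ?thesis by (simp add: w2)
  qed
  consider "i < j" | "i = j" | "j < i" by linarith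
  then show ?thesis using *[of i j] *[of j i] ij by cases (auto simp: mult_ac)
qed

section \<open>The Nullstellensatz\<close>

text \<open>An increasing exhaustion of the monomials by finite sets, so that the support of a
  polynomial is measured by one natural number.\<close>

definition mon_box :: "nat \<Rightarrow> (nat \<Rightarrow>\<^sub>0 nat) set" where
  "mon_box D = {m. keys m \<subseteq> {..<D} \<and> (\<forall>i. lookup m i < D)}"

lemma finite_bounded_monomials:
  assumes "finite V"
  shows "finite {m. keys m \<subseteq> V \<and> (\<forall>i\<in>V. lookup m i < D)}" (is "finite ?M")
    and "card {m. keys m \<subseteq> V \<and> (\<forall>i\<in>V. lookup m i < D)} \<le> D ^ card V"
proof -
  let ?r = "\<lambda>m. restrict (lookup m) V"
  have sub: "?r ` ?M \<subseteq> PiE V (\<lambda>_. {..<D})" by auto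
  have fin: "finite (PiE V (\<lambda>_. {..<D}))" using assms by (intro finite_PiE) auto
  have inj: "inj_on ?r ?M"
  proof (rule inj_onI)
    fix m m' assume m: "m \<in> ?M" "m' \<in> ?M" "?r m = ?r m'"
    show "m = m'"
    proof (rule poly_mapping_eqI)
      fix i
      show "lookup m i = lookup m' i"
      proof (cases "i \<in> V")
        case True
        then show ?thesis using fun_cong[OF m(3), of i] by simp
      next
        case False
        then have "i \<notin> keys m" "i \<notin> keys m'" using m by auto
        then show ?thesis by (simp add: in_keys_iff)
      qed
    qed
  qed
  show "finite ?M" using finite_imageD[OF finite_subset[OF sub fin] inj] .
  have "card ?M = card (?r ` ?M)" using inj by (simp add: card_image)
  also have "\<dots> \<le> card (PiE V (\<lambda>_. {..<D}))" by (rule card_mono[OF fin sub])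
  also have "\<dots> = D ^ card V" using assms by (simp add: card_PiE)
  finally show "card ?M \<le> D ^ card V" .
qed

lemma finite_mon_box: "finite (mon_box D)"
proof (rule finite_subset)
  show "mon_box D \<subseteq> {m. keys m \<subseteq> {..<D} \<and> (\<forall>i\<in>{..<D}. lookup m i < D)}"
    by (auto simp: mon_box_def)
qed (rule finite_bounded_monomials, simp)

lemma mon_box_mono: "D \<le> D' \<Longrightarrow> mon_box D \<subseteq> mon_box D'"
  unfolding mon_box_def by (auto intro: less_le_trans)

lemma ex_mon_box:
  fixes M :: "(nat \<Rightarrow>\<^sub>0 nat) set"
  assumes "finite M"
  shows "\<exists>D. M \<subseteq> mon_box D"
  using assms
proof (induction M rule: finite_induct)
  case (insert m M)
  then obtain D where D: "M \<subseteq> mon_box D" by blast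
  define D' where "D' = Suc (Max (insert 0 (keys m)) + (\<Sum>i\<in>keys m. lookup m i))"
  have "lookup m i < D'" for i
  proof (cases "i \<in> keys m")
    case True
    then have "lookup m i \<le> (\<Sum>i\<in>keys m. lookup m i)" by (intro member_le_sum) auto
    then show ?thesis by (simp add: D'_def)
  qed (simp add: D'_def in_keys_iff)
  moreover have "i < D'" if "i \<in> keys m" for i
  proof -
    have "i \<le> Max (insert 0 (keys m))" by (rule Max_ge) (use that in auto)
    then show ?thesis unfolding D'_def by linarith
  qed
  ultimately have "m \<in> mon_box D'" by (auto simp: mon_box_def)
  then have "insert m M \<subseteq> mon_box (max D D')"
    using D mon_box_mono[of D "max D D'"] mon_box_mono[of D' "max D D'"] by auto
  then show ?case by blast
qed simp

definition poly_at :: "nat \<Rightarrow> complex poly \<Rightarrow> nat mpoly" where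
  "poly_at i Q = poly (map_poly const Q) (var i)"

lemma poly_at_0 [simp]: "poly_at i 0 = 0"
  by (simp add: poly_at_def)

lemma poly_at_pCons [simp]: "poly_at i (pCons a Q) = const a + var i * poly_at i Q"
  by (simp add: poly_at_def Polynomial.map_poly_pCons)

lemma poly_at_add: "poly_at i (P + Q) = poly_at i P + poly_at i Q"
  by (induction P Q rule: poly_induct2) (simp_all add: const_add algebra_simps)

lemma poly_at_smult: "poly_at i (smult a Q) = const a * poly_at i Q"
  by (induction Q) (simp_all add: const_mult algebra_simps)

lemma poly_at_mult: "poly_at i (P * Q) = poly_at i P * poly_at i Q"
  by (induction P) (simp_all add: poly_at_add poly_at_smult algebra_simps)

lemma poly_at_1: "poly_at i 1 = 1"
  by (simp add: one_pCons)

lemma poly_at_sum: "poly_at i (\<Sum>c\<in>T. P c) = (\<Sum>c\<in>T. poly_at i (P c))"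
  by (induction T rule: infinite_finite_induct) (simp_all add: poly_at_add)

lemma poly_at_prod: "poly_at i (\<Prod>c\<in>T. P c) = (\<Prod>c\<in>T. poly_at i (P c))"
  by (induction T rule: infinite_finite_induct) (simp_all add: poly_at_mult poly_at_1)

text \<open>An ideal maximal among those avoiding the powers of a variable is prime.  Every residue
  \<open>x\<^sub>i - c\<close> that it misses would be invertible up to such a power; uncountably many \<open>c\<close> against
  countably many monomials then force a relation that puts some \<open>x\<^sub>i - c\<close> into the ideal after
  all, so the ideal is the one of a point.\<close>
lemma nullstellensatz:
  fixes f :: "nat \<Rightarrow> nat mpoly"
  assumes I: "finite I" and zero: "\<And>x. (\<And>i. i \<in> I \<Longrightarrow> eval_at x (f i) = 0) \<Longrightarrow> x j = 0"
  shows "\<exists>k. var j ^ k \<in> gen_ideal f I"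
proof (rule ccontr)
  assume contra: "\<nexists>k. var j ^ k \<in> gen_ideal f I"
  define A where "A = {P :: nat mpoly set. (\<forall>p\<in>P. \<forall>q\<in>P. p + q \<in> P) \<and> (\<forall>p\<in>P. \<forall>r. r * p \<in> P) \<and>
    gen_ideal f I \<subseteq> P \<and> (\<forall>k. var j ^ k \<notin> P)}"
  have "gen_ideal f I \<in> A" using contra gen_ideal_add gen_ideal_mult by (auto simp: A_def)
  moreover have "\<Union>C \<in> A" if C: "C \<noteq> {}" "subset.chain A C" for C
  proof -
    have CA: "P \<in> A" if "P \<in> C" for P using C that by (auto simp: subset.chain_def)
    have "p + q \<in> \<Union>C" if "p \<in> \<Union>C" "q \<in> \<Union>C" for p q
    proof -
      obtain P Q where PQ: "P \<in> C" "p \<in> P" "Q \<in> C" "q \<in> Q" using \<open>p \<in> \<Union>C\<close> \<open>q \<in> \<Union>C\<close> by blast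
      then have "P \<subseteq> Q \<or> Q \<subseteq> P" using C by (auto simp: subset.chain_def)
      then have "\<exists>R\<in>C. p \<in> R \<and> q \<in> R" using PQ by blast
      then obtain R where R: "R \<in> C" "p \<in> R" "q \<in> R" by blast
      then have "p + q \<in> R" using CA[of R] by (simp add: A_def)
      then show ?thesis using R(1) by blast
    qed
    moreover have "r * p \<in> \<Union>C" if p: "p \<in> \<Union>C" for p r
    proof -
      obtain R where R: "R \<in> C" "p \<in> R" using p by blast
      then have "r * p \<in> R" using CA[of R] by (simp add: A_def)
      then show ?thesis using R(1) by blast
    qed
    moreover have "gen_ideal f I \<subseteq> \<Union>C" using C CA by (auto simp: A_def)
    moreover have "var j ^ k \<notin> \<Union>C" for k using CA by (auto simp: A_def)
    ultimately show ?thesis by (auto simp: A_def)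
  qed
  ultimately obtain P where PA: "P \<in> A" and max: "\<And>X. X \<in> A \<Longrightarrow> P \<subseteq> X \<Longrightarrow> X = P"
    using subset_Zorn_nonempty[of A] by blast
  have addP: "p + q \<in> P" if "p \<in> P" "q \<in> P" for p q using PA that by (auto simp: A_def)
  have multP: "r * p \<in> P" if "p \<in> P" for p r using PA that by (auto simp: A_def)
  have IP: "gen_ideal f I \<subseteq> P" and varP: "var j ^ k \<notin> P" for k using PA by (auto simp: A_def)
  have zP: "0 \<in> P" using IP gen_ideal_0 by blast
  have diff: "p - q \<in> P" if "p \<in> P" "q \<in> P" for p q
    using addP[OF that(1) multP[OF that(2), of "-1"]] by simp
  have sumP: "(\<Sum>i\<in>S. p i) \<in> P" if "\<And>i. i \<in> S \<Longrightarrow> p i \<in> P" for p and S :: "complex set"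
    using that by (induction S rule: infinite_finite_induct) (simp_all add: zP addP)
  have constP: "c = 0" if "const c \<in> P" for c
  proof (rule ccontr)
    assume "c \<noteq> 0"
    then have "const (1 / c) * const c = (1 :: nat mpoly)" by (simp flip: const_mult)
    then have "1 \<in> P" using multP[OF that, of "const (1 / c)"] by simp
    then show False using varP[of 0] by simp
  qed
  \<comment> \<open>By maximality the ideal generated by \<open>P\<close> and \<open>a\<close>
    contains a power of \<open>var j\<close>.\<close>
  have inv: "\<exists>k u. var j ^ k - u * a \<in> P" if "a \<notin> P" for a
  proof (rule ccontr)
    assume no: "\<nexists>k u. var j ^ k - u * a \<in> P"
    define P' where "P' = {p. \<exists>u. p - u * a \<in> P}"
    have sub: "P \<subseteq> P'" unfolding P'_def by (auto intro!: exI[of _ 0])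
    have "P' \<in> A"
      unfolding A_def
    proof (intro CollectI conjI ballI allI)
      fix p q assume "p \<in> P'" "q \<in> P'"
      then obtain u v where "p - u * a \<in> P" "q - v * a \<in> P" by (auto simp: P'_def)
      then have "p + q - (u + v) * a \<in> P" using addP by (fastforce simp: algebra_simps)
      then show "p + q \<in> P'" by (auto simp: P'_def)
    next
      fix p r assume "p \<in> P'"
      then obtain u where "p - u * a \<in> P" by (auto simp: P'_def)
      then have "r * (p - u * a) \<in> P" by (rule multP)
      then have "r * p - (r * u) * a \<in> P" by (simp add: algebra_simps)
      then show "r * p \<in> P'" by (auto simp: P'_def)
    next
      show "gen_ideal f I \<subseteq> P'" using IP sub by blast
    next
      fix k show "var j ^ k \<notin> P'" using no by (auto simp: P'_def)
    qed
    then have "P' = P" using max sub by blast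
    moreover have "a \<in> P'" unfolding P'_def using zP by (auto intro!: exI[of _ 1])
    ultimately show False using that by simp
  qed
  have prime: "a \<in> P \<or> b \<in> P" if "a * b \<in> P" for a b
  proof (rule ccontr)
    assume "\<not> (a \<in> P \<or> b \<in> P)"
    then obtain k l u v where kl: "var j ^ k - u * a \<in> P" "var j ^ l - v * b \<in> P"
      using inv[of a] inv[of b] by blast
    have "var j ^ (k + l) =
        var j ^ k * (var j ^ l - v * b) + (v * b) * (var j ^ k - u * a) + (u * v) * (a * b)"
      by (simp add: algebra_simps power_add)
    then have "var j ^ (k + l) \<in> P" using addP multP kl that by metis
    then show False using varP by blast
  qed
  have root: "\<exists>c. var i - const c \<in> P" if "poly_at i Q \<in> P" "Q \<noteq> 0" for i Q
    using that
  proof (induction "degree Q" arbitrary: Q)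
    case 0
    then obtain a where "Q = [:a:]" by (metis degree_eq_zeroE)
    then show ?case using constP[of a] 0 by simp
  next
    case (Suc d)
    then have "\<not> constant (poly Q)" by (simp add: constant_degree)
    then obtain z where "poly Q z = 0" using fundamental_theorem_of_algebra by blast
    then obtain R where R: "Q = [:- z, 1:] * R" by (metis dvdE poly_eq_0_iff_dvd)
    have "poly_at i [:- z, 1:] = var i - const z" by (simp add: const_uminus)
    then have "(var i - const z) * poly_at i R \<in> P"
      using Suc.prems(1) unfolding R poly_at_mult by simp
    then consider "var i - const z \<in> P" | "poly_at i R \<in> P" using prime by blast
    then show ?case
    proof cases
      case 2
      have "R \<noteq> 0" using R Suc.prems by auto
      then have "degree Q = Suc (degree R)" unfolding R by (subst degree_mult_eq) auto
      then show ?thesis using Suc.hyps 2 \<open>R \<noteq> 0\<close> by simp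
    qed blast
  qed
  have pt: "\<exists>c. var i - const c \<in> P" for i
  proof (rule ccontr)
    assume no: "\<nexists>c. var i - const c \<in> P"
    then have "\<forall>c. \<exists>k u. var j ^ k - u * (var i - const c) \<in> P" using inv by blast
    then obtain k u where ku: "\<And>c. var j ^ k c - u c * (var i - const c) \<in> P" by metis
    have "\<forall>c. \<exists>D. keys (u c) \<subseteq> mon_box D" using ex_mon_box by simp
    then obtain D where D: "\<And>c. keys (u c) \<subseteq> mon_box (D c)" by metis
    \<comment> \<open>Pigeonhole over countably many pairs. An infinite class provides more
      multipliers \<open>u c\<close> than there are monomials in a box containing all their
      supports, hence a linear relation between them.\<close>
    have "\<exists>K E. infinite {c. k c = K \<and> D c = E}"
    proof (rule ccontr)
      assume fin: "\<nexists>K E. infinite {c. k c = K \<and> D c = E}"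
      have "countable (\<Union>z :: nat \<times> nat. {c. k c = fst z \<and> D c = snd z})"
        by (rule countable_UN) (use fin countable_finite in auto)
      moreover have "(\<Union>z :: nat \<times> nat. {c. k c = fst z \<and> D c = snd z}) = UNIV" by auto
      ultimately show False using uncountable_UNIV_complex by simp
    qed
    then obtain K E where KE: "infinite {c. k c = K \<and> D c = E}" by blast
    obtain T where T: "finite T" "card T = Suc (card (mon_box E))" "T \<subseteq> {c. k c = K \<and> D c = E}"
      using infinite_arbitrarily_large[OF KE] by blast
    obtain l c0 where l: "c0 \<in> T" "l c0 \<noteq> 0" "\<And>m. m \<in> mon_box E \<Longrightarrow> (\<Sum>c\<in>T. l c * lookup (u c) m) = 0"
      using linear_dependence[OF finite_mon_box[of E] T(1), of "\<lambda>c. lookup (u c)"] T(2) by auto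
    have rel: "(\<Sum>c\<in>T. const (l c) * u c) = 0"
    proof (rule poly_mapping_eqI)
      fix m
      have eq: "lookup (\<Sum>c\<in>T. const (l c) * u c) m = (\<Sum>c\<in>T. l c * lookup (u c) m)"
        by (simp add: lookup_sum lookup_const_mult)
      show "lookup (\<Sum>c\<in>T. const (l c) * u c) m = lookup 0 m"
      proof (cases "m \<in> mon_box E")
        case False
        then have "lookup (u c) m = 0" if "c \<in> T" for c
          using D[of c] T(3) that by (auto simp: in_keys_iff)
        then show ?thesis unfolding eq by simp
      qed (simp add: eq l)
    qed
    \<comment> \<open>Modulo \<open>P\<close>, each \<open>u c\<close> behaves like
      \<open>x_j^K / (x_i - c)\<close>. Clearing denominators in the relation between the
      \<open>u c\<close> gives \<open>x_j^K Q(x_i) \<in> P\<close>, and \<open>Q\<close> is nonzero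
      because its value at \<open>c0\<close> is.\<close>
    define Q where "Q = (\<Sum>c\<in>T. smult (l c) (\<Prod>c'\<in>T - {c}. [:- c', 1:]))"
    define q where "q c = (\<Prod>c'\<in>T - {c}. (var i - const c' :: nat mpoly))" for c
    have Qat: "poly_at i Q = (\<Sum>c\<in>T. const (l c) * q c)"
      by (simp add: Q_def q_def poly_at_sum poly_at_smult poly_at_prod const_uminus)
    have "poly Q c0 = (\<Sum>c\<in>T. if c = c0 then l c0 * (\<Prod>c'\<in>T - {c0}. c0 - c') else 0)"
      unfolding Q_def poly_sum
    proof (rule sum.cong)
      fix c assume "c \<in> T"
      show "poly (smult (l c) (\<Prod>c'\<in>T - {c}. [:- c', 1:])) c0 =
          (if c = c0 then l c0 * (\<Prod>c'\<in>T - {c0}. c0 - c') else 0)"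
        using T(1) l(1) by (auto simp: poly_prod intro!: prod_zero)
    qed simp
    also have "\<dots> = l c0 * (\<Prod>c'\<in>T - {c0}. c0 - c')" using T(1) l(1) by simp
    also have "\<dots> \<noteq> 0" using l(2) T(1) by (simp add: prod_zero_iff)
    finally have "Q \<noteq> 0" by auto
    have "(\<Sum>c\<in>T. const (l c) * q c * (var j ^ k c - u c * (var i - const c))) \<in> P"
      by (intro sumP multP ku)
    moreover have "(\<Sum>c\<in>T. const (l c) * q c * (var j ^ k c - u c * (var i - const c))) =
        var j ^ K * poly_at i Q"
    proof -
      let ?R = "\<Prod>c\<in>T. (var i - const c :: nat mpoly)"
      have "const (l c) * q c * (var j ^ k c - u c * (var i - const c)) =
          var j ^ K * (const (l c) * q c) - ?R * (const (l c) * u c)" if "c \<in> T" for c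
      proof -
        have R: "?R = (var i - const c) * q c"
          unfolding q_def using T(1) that by (rule prod.remove)
        show ?thesis unfolding R using T(3) that by (auto simp: algebra_simps)
      qed
      then have "(\<Sum>c\<in>T. const (l c) * q c * (var j ^ k c - u c * (var i - const c))) =
          (\<Sum>c\<in>T. var j ^ K * (const (l c) * q c) - ?R * (const (l c) * u c))"
        by (rule sum.cong[OF refl])
      also have "\<dots> = var j ^ K * (\<Sum>c\<in>T. const (l c) * q c) - ?R * (\<Sum>c\<in>T. const (l c) * u c)"
        by (simp only: sum_subtractf sum_distrib_left)
      finally show ?thesis by (simp add: rel Qat)
    qed
    ultimately have "poly_at i Q \<in> P" using prime varP by metis
    then show False using root[OF _ \<open>Q \<noteq> 0\<close>] no by blast
  qed
  then obtain c where c: "\<And>i. var i - const (c i) \<in> P" by metis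
  \<comment> \<open>Modulo \<open>P\<close> a polynomial equals its value at \<open>c\<close>. Since
    \<open>P\<close> contains no nonzero constant, \<open>c\<close> is a common zero of the
    \<open>f i\<close>, and \<open>c j = 0\<close> would put \<open>var j\<close> into
    \<open>P\<close>.\<close>
  have evP: "p - const (eval_at c p) \<in> P" for p
  proof (induction p rule: mpoly_induct)
    case (add p q)
    then have "(p - const (eval_at c p)) + (q - const (eval_at c q)) \<in> P" by (rule addP)
    then show ?case by (simp add: const_add algebra_simps)
  next
    case (mult p q)
    have "q * (p - const (eval_at c p)) + const (eval_at c p) * (q - const (eval_at c q)) \<in> P"
      by (intro addP multP mult)
    then show ?case by (simp add: const_mult algebra_simps)
  qed (simp_all add: zP c)
  have "eval_at c (f i) = 0" if "i \<in> I" for i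
  proof -
    have "f i \<in> P" using gen_ideal_base[OF I that, of f] IP by blast
    then have "const (eval_at c (f i)) \<in> P" using diff[OF _ evP[of "f i"]] by fastforce
    then show ?thesis by (rule constP)
  qed
  then have "c j = 0" by (rule zero)
  then show False using c[of j] varP[of 1] by simp
qed

section \<open>Linear forms\<close>

text \<open>Let \<open>h\<close> be the part of \<open>q\<close> of the expected degree in the
  variables \<open>V\<close>. The product \<open>p * (q - h)\<close> is homogeneous of degree
  \<open>s\<close>, but a monomial in it would come from a monomial of \<open>q - h\<close> of
  exactly the degree that has been removed.\<close>

lemma homogeneous_cofactor:
  fixes p q :: "nat mpoly"
  assumes pq: "homogeneous V s (p * q)" and p: "homogeneous V t p" "p \<noteq> 0"
  shows "if t \<le> s then homogeneous V (s - t) q else q = 0"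
proof (cases "t \<le> s")
  case True
  define h where "h = (\<Sum>m\<in>keys q \<inter> monomials V (s - t). single m (lookup q m))"
  have h: "homogeneous V (s - t) h"
    unfolding h_def by (intro homogeneous_sum homogeneous_single) auto
  have lh: "lookup h m = (if m \<in> monomials V (s - t) then lookup q m else 0)" for m
    by (auto simp: h_def lookup_sum lookup_single when_def in_keys_iff sum.delta)
  have "homogeneous V s (p * h)"
    using homogeneous_mult[OF p(1) h] True by simp
  then have hom: "homogeneous V s (p * (q - h))"
    using homogeneous_diff[OF pq] by (simp add: right_diff_distrib)
  have "p * (q - h) = 0"
  proof (rule ccontr)
    assume "p * (q - h) \<noteq> 0"
    then obtain m where m: "m \<in> keys (p * (q - h))" by (metis keys_eq_empty ex_in_conv)
    then obtain k l where kl: "k \<in> keys p" "l \<in> keys (q - h)" "m = k + l"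
      using keys_mult_subset by blast
    have l: "l \<notin> monomials V (s - t)"
      using kl(2) by (auto simp: in_keys_iff lookup_minus lh split: if_splits)
    have k: "mdeg k = t" using p(1) kl(1) by (auto simp: homogeneous_iff)
    have "mdeg m = s" "keys m \<subseteq> V" using hom m by (auto simp: homogeneous_iff)
    moreover have "keys l \<subseteq> keys m" by (auto simp: kl(3) in_keys_iff lookup_add)
    ultimately have "l \<in> monomials V (s - t)"
      using kl(3) k by (auto simp: monomials_iff mdeg_add)
    then show False using l by blast
  qed
  then have "q = h" using p(2) by simp
  then show ?thesis using True h by simp
next
  case False
  have "p * q = 0"
  proof (rule ccontr)
    assume "p * q \<noteq> 0"
    then obtain m where m: "m \<in> keys (p * q)" by (metis keys_eq_empty ex_in_conv)
    then obtain k l where "k \<in> keys p" "l \<in> keys q" "m = k + l"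
      using keys_mult_subset by blast
    then have "t \<le> mdeg m" using p(1) by (auto simp: homogeneous_iff mdeg_add)
    moreover have "mdeg m = s" using pq m by (auto simp: homogeneous_iff)
    ultimately show False using False by simp
  qed
  then show ?thesis using p(2) False by simp
qed

lemma homogeneous_0E:
  assumes "homogeneous V 0 (p :: 'v mpoly)"
  obtains c where "p = const c"
proof -
  have "m = 0" if "m \<in> keys p" for m
  proof -
    have "mdeg m = 0" using assms that by (auto simp: homogeneous_iff)
    then have "lookup m i = 0" for i by (cases "i \<in> keys m") (auto simp: mdeg_def in_keys_iff)
    then show ?thesis by (intro poly_mapping_eqI) simp
  qed
  then have "keys p \<subseteq> {0}" by blast
  then have "p = const (lookup p 0)"
    by (intro poly_mapping_eqI) (auto simp: const_def lookup_single when_def in_keys_iff)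
  then show thesis by (rule that)
qed

lemma dvd_diff_subst:
  fixes p :: "'r::comm_ring_1" and x y :: "'v \<Rightarrow> 'r"
  assumes c: "coeff_hom c" and "\<And>i. p dvd x i - y i"
  shows "p dvd peval c x r - peval c y r"
proof (induction r rule: mpoly_induct)
  case (add r s)
  then have "p dvd (peval c x r - peval c y r) + (peval c x s - peval c y s)" by (rule dvd_add)
  then show ?case by (simp add: peval_simps c algebra_simps)
next
  case (mult r s)
  then have "p dvd (peval c x r - peval c y r) * peval c x s + peval c y r * (peval c x s - peval c y s)"
    by (intro dvd_add dvd_mult dvd_mult2)
  then show ?case by (simp add: peval_simps c algebra_simps)
qed (simp_all add: peval_simps c assms)

lemma linear_form_expand:
  assumes p: "homogeneous V 1 (p :: 'v mpoly)" and V: "finite V"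
  shows "p = (\<Sum>j\<in>V. const (lookup p (single j 1)) * var j)"
proof (rule poly_mapping_eqI)
  fix m
  have eq: "const (lookup p (single j 1)) * var j = single (single j 1) (lookup p (single j 1))" for j
    by (simp add: const_def var_def mult_single)
  have inj: "single i (1 :: nat) = single j 1 \<longleftrightarrow> i = j" for i j :: 'v
  proof
    assume "single i (1 :: nat) = single j 1"
    then have "keys (single i (1 :: nat)) = keys (single j (1 :: nat))" by simp
    then show "i = j" by simp
  qed simp
  have rhs: "lookup (\<Sum>j\<in>V. const (lookup p (single j 1)) * var j) m =
      (\<Sum>j\<in>V. if single j 1 = m then lookup p m else 0)"
    unfolding eq by (simp add: lookup_sum lookup_single when_def) (rule sum.cong, auto)
  show "lookup p m = lookup (\<Sum>j\<in>V. const (lookup p (single j 1)) * var j) m"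
  proof (cases "m \<in> keys p")
    case True
    then have m: "mdeg m = 1" "keys m \<subseteq> V" using p by (auto simp: homogeneous_iff)
    then have "keys m \<noteq> {}" by (auto simp: mdeg_def)
    then obtain i where i: "i \<in> keys m" by blast
    have "(\<Sum>j\<in>keys m. lookup m j) = lookup m i + (\<Sum>j\<in>keys m - {i}. lookup m j)"
      using i by (simp add: sum.remove)
    then have s: "lookup m i + (\<Sum>j\<in>keys m - {i}. lookup m j) = 1" using m by (simp add: mdeg_def)
    moreover have "lookup m i > 0" using i by (simp add: in_keys_iff)
    ultimately have *: "lookup m i = 1" "(\<Sum>j\<in>keys m - {i}. lookup m j) = 0" by linarith+
    have "lookup m j = 0" if "j \<noteq> i" for j
    proof (cases "j \<in> keys m")
      case True
      then show ?thesis using *(2) that by simp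
    qed (simp add: in_keys_iff)
    then have "lookup m j = (if j = i then 1 else 0)" for j using *(1) by simp
    then have mi: "m = single i 1"
      by (intro poly_mapping_eqI) (auto simp: lookup_single when_def)
    have iV: "i \<in> V" using i m by blast
    show ?thesis unfolding rhs unfolding mi inj using iV V by simp
  next
    case False
    then have "lookup p m = 0" by (simp add: in_keys_iff)
    then show ?thesis unfolding rhs by (simp cong: if_cong)
  qed
qed

text \<open>Solving \<open>p = 0\<close> for one of its variables defines an endomorphism
  \<open>\<tau>\<close> whose kernel is the ideal of \<open>p\<close>, with values in a
  domain.\<close>

lemma linear_form_prime:
  fixes p q r :: "nat mpoly"
  assumes p: "homogeneous V 1 p" "finite V" "p \<noteq> 0" and "p dvd q * r"
  shows "p dvd q \<or> p dvd r"
proof -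
  define \<alpha> where "\<alpha> j = lookup p (single j 1)" for j
  have pe: "p = (\<Sum>j\<in>V. const (\<alpha> j) * var j)"
    unfolding \<alpha>_def using p linear_form_expand by blast
  have "\<exists>i\<in>V. \<alpha> i \<noteq> 0"
    using p(3) pe by (metis (no_types, lifting) const_0 mult_zero_left sum.neutral)
  then obtain i where i: "i \<in> V" "\<alpha> i \<noteq> 0" by blast
  define y where "y = (\<lambda>j. if j = i then var i - const (1 / \<alpha> i) * p else var j)"
  define \<tau> where "\<tau> = peval const y"
  have mul: "\<tau> (a * b) = \<tau> a * \<tau> b" for a b by (simp add: \<tau>_def)
  have one: "const (\<alpha> i) * const (1 / \<alpha> i) = (1 :: nat mpoly)"
    using i by (simp flip: const_mult)
  have "\<tau> p = (\<Sum>j\<in>V. const (\<alpha> j) * y j)"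
    unfolding \<tau>_def by (subst (1) pe) simp
  also have "\<dots> = (\<Sum>j\<in>V. const (\<alpha> j) * var j - (if j = i then p else 0))"
  proof (rule sum.cong)
    fix j assume "j \<in> V"
    have "const (\<alpha> i) * (const (1 / \<alpha> i) * p) = p" using one by (simp flip: mult.assoc)
    then show "const (\<alpha> j) * y j = const (\<alpha> j) * var j - (if j = i then p else 0)"
      by (auto simp: y_def right_diff_distrib)
  qed simp
  also have "\<dots> = 0" using i p(2) pe by (simp add: sum_subtractf)
  finally have \<tau>p: "\<tau> p = 0" .
  have iff: "p dvd s \<longleftrightarrow> \<tau> s = 0" for s
  proof
    assume "p dvd s" then show "\<tau> s = 0" using \<tau>p mul by (auto elim!: dvdE)
  next
    assume "\<tau> s = 0"
    have "p dvd peval const var s - peval const y s"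
      by (rule dvd_diff_subst) (auto simp: y_def)
    then show "p dvd s" using \<open>\<tau> s = 0\<close> by (simp add: \<tau>_def)
  qed
  show ?thesis using assms(4) unfolding iff mul by simp
qed

lemma var_neq_0 [simp]: "var i \<noteq> 0"
proof
  assume "var i = 0"
  then have "eval_at (\<lambda>_. 1) (var i) = 0" by simp
  then show False by simp
qed

lemma var_not_dvd_var:
  assumes "i \<noteq> j" shows "\<not> var i dvd (var j :: 'v mpoly)"
proof
  assume "var i dvd (var j :: 'v mpoly)"
  then obtain q where q: "var j = var i * (q :: 'v mpoly)" by (elim dvdE)
  have "eval_at (\<lambda>k. if k = j then 1 else 0) (var j) = (1 :: complex)" by simp
  then show False unfolding q using assms by simp
qed

lemma var_const_indep:
  assumes "var i * const a = var j * (const b :: 'v mpoly)" "i \<noteq> j"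
  shows "a = 0" "b = 0"
proof -
  have "eval_at (\<lambda>k. if k = i then 1 else 0) (var i * const a) =
      eval_at (\<lambda>k. if k = i then 1 else 0) (var j * (const b :: 'v mpoly))"
    by (simp only: assms(1))
  then show "a = 0" using assms(2) by simp
  have "eval_at (\<lambda>k. if k = j then 1 else 0) (var i * const a) =
      eval_at (\<lambda>k. if k = j then 1 else 0) (var j * (const b :: 'v mpoly))"
    by (simp only: assms(1))
  then show "b = 0" using assms(2) by simp
qed

lemma finite_monomials: "finite V \<Longrightarrow> finite (monomials V d)"
proof -
  assume V: "finite V"
  have "lookup m i < Suc d" if "m \<in> monomials V d" "i \<in> V" for m i
  proof -
    have "lookup m i \<le> (\<Sum>i\<in>V. lookup m i)" using V that by (intro member_le_sum) auto
    then show ?thesis using that mdeg_superset[OF V, of m] by (simp add: monomials_iff)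
  qed
  then have "monomials V d \<subseteq> {m. keys m \<subseteq> V \<and> (\<forall>i\<in>V. lookup m i < Suc d)}"
    by (auto simp: monomials_iff)
  then show ?thesis using finite_bounded_monomials[OF V] finite_subset by blast
qed

lemma eval_homogeneous:
  assumes "homogeneous V d p" "finite V"
  shows "eval_at x p = (\<Sum>m\<in>monomials V d. lookup p m * mon_eval x m)"
  using assms by (intro peval_superset finite_monomials) (auto simp: homogeneous_def)

lemma eval_line_derivative:
  "\<exists>D. ((\<lambda>t. eval_at (\<lambda>i. x i + t * v i) p) has_field_derivative D) (at (0 :: complex))"
proof -
  obtain q where "eval_at (\<lambda>i. x i + t * v i) p = poly q t" for t
    using eval_along_line[of x v p] by blast
  then have "(\<lambda>t. eval_at (\<lambda>i. x i + t * v i) p) = poly q" by auto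
  then show ?thesis using poly_DERIV[of q 0] by metis
qed

section \<open>Syzygies of the partial derivatives on a generic hyperplane\<close>

text \<open>The hyperplane \<open>x\<^sub>n = a\<^sub>0 x\<^sub>0 + \<dots> + a\<^bsub>n-1\<^esub> x\<^bsub>n-1\<^esub>\<close>.\<close>
definition hyp_form :: "nat \<Rightarrow> (nat \<Rightarrow> complex) \<Rightarrow> nat mpoly" where
  "hyp_form n a = (\<Sum>j<n. const (a j) * var j) - var n"

text \<open>Restriction stays inside the same ring by eliminating \<open>var n\<close>; the forms on
  the hyperplane are the forms in the first \<open>n\<close> variables.\<close>

definition hyp_restrict :: "nat \<Rightarrow> (nat \<Rightarrow> complex) \<Rightarrow> nat mpoly \<Rightarrow> nat mpoly" where
  "hyp_restrict n a = peval const (\<lambda>i. if i = n then \<Sum>j<n. const (a j) * var j else var i)"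

lemma hyp_restrict_simps [simp]:
  "hyp_restrict n a (p + q) = hyp_restrict n a p + hyp_restrict n a q"
  "hyp_restrict n a (p - q) = hyp_restrict n a p - hyp_restrict n a q"
  "hyp_restrict n a (- p) = - hyp_restrict n a p"
  "hyp_restrict n a (p * q) = hyp_restrict n a p * hyp_restrict n a q"
  "hyp_restrict n a (p ^ k) = hyp_restrict n a p ^ k"
  "hyp_restrict n a (const c) = const c"
  "hyp_restrict n a 0 = 0"
  "hyp_restrict n a 1 = 1"
  "hyp_restrict n a (\<Sum>i\<in>A. r i) = (\<Sum>i\<in>A. hyp_restrict n a (r i))"
  "j < n \<Longrightarrow> hyp_restrict n a (var j) = var j"
  "hyp_restrict n a (hyp_form n a) = 0"
  by (simp_all add: hyp_restrict_def hyp_form_def)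

lemma hyp_restrict_of_nat [simp]: "hyp_restrict n a (of_nat k) = of_nat k"
  by (induction k) simp_all

lemma homogeneous_hyp_restrict:
  assumes "homogeneous {..<Suc n} d p"
  shows "homogeneous {..<n} d (hyp_restrict n a p)"
  unfolding hyp_restrict_def
proof (rule homogeneous_subst[OF assms])
  fix i assume "i \<in> {..<Suc n}"
  then show "homogeneous {..<n} 1 (if i = n then \<Sum>j<n. const (a j) * var j else var i)"
    by (auto intro!: homogeneous_sum homogeneous_const_mult homogeneous_var simp del: One_nat_def)
qed

lemma homogeneous_hyp_form: "homogeneous {..<Suc n} 1 (hyp_form n a)"
  unfolding hyp_form_def
  by (intro homogeneous_diff homogeneous_sum homogeneous_const_mult homogeneous_var) auto

lemma hyp_form_nonzero [simp]: "hyp_form n a \<noteq> 0"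
proof
  assume "hyp_form n a = 0"
  then have "eval_at (\<lambda>i. if i = n then 1 else 0) (hyp_form n a) = (0 :: complex)" by simp
  then show False by (simp add: hyp_form_def)
qed

lemma hyp_form_dvd_iff: "hyp_form n a dvd p \<longleftrightarrow> hyp_restrict n a p = 0"
proof
  assume "hyp_form n a dvd p"
  then show "hyp_restrict n a p = 0" by (auto elim!: dvdE)
next
  assume "hyp_restrict n a p = 0"
  moreover have "hyp_form n a dvd peval const var p - hyp_restrict n a p"
    unfolding hyp_restrict_def
  proof (rule dvd_diff_subst)
    fix i
    have "var n - (\<Sum>j<n. const (a j) * var j) = - hyp_form n a" by (simp add: hyp_form_def)
    then show "hyp_form n a dvd var i - (if i = n then \<Sum>j<n. const (a j) * var j else var i)"
      by simp
  qed simp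
  ultimately show "hyp_form n a dvd p" by simp
qed

lemma hyp_restrict_low:
  assumes "homogeneous {..<n} d p"
  shows "hyp_restrict n a p = p"
proof -
  have "hyp_restrict n a p = peval const var p"
    unfolding hyp_restrict_def by (rule eval_cong[OF assms]) auto
  then show ?thesis by simp
qed

lemma eval_hyp_form:
  "eval_at x (hyp_form n a) = (\<Sum>j<n. a j * x j) - x n"
  by (simp add: hyp_form_def)

lemma homogeneous_mono: "homogeneous V d p \<Longrightarrow> V \<subseteq> W \<Longrightarrow> homogeneous W d p"
  by (auto simp: homogeneous_iff)

declare sum.lessThan_Suc [simp del]

text \<open>The form has degree \<open>Suc e\<close>, so that its partial derivatives have degree
  \<open>e\<close> without subtraction. The bound \<open>e \<ge> 4\<close> allows relations of
  degrees one and two to be compared.\<close>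

locale smooth_form =
  fixes f :: "nat mpoly" and n e :: nat
  assumes n: "n \<ge> 3" and e: "e \<ge> 4"
    and hom_f: "homogeneous {..<Suc n} (Suc e) f"
    and smooth_f: "smooth_hypersurface (Suc n) f"
begin

definition df :: "nat \<Rightarrow> nat mpoly" where
  "df i = partial i f"

lemma hom_df: "homogeneous {..<Suc n} e (df i)"
  using homogeneous_partial[OF hom_f, of i] by (simp add: df_def)

text \<open>By the Euler identity in characteristic zero, a common zero of the partial derivatives
  also lies on the hypersurface and would be a singular point.\<close>

lemma df_common_zero:
  assumes "\<And>i. i < Suc n \<Longrightarrow> eval_at x (df i) = 0" "j < Suc n"
  shows "x j = 0"
proof (rule ccontr)
  assume j: "x j \<noteq> 0"
  define v where "v = vec (Suc n) x"
  have ev: "eval_at (($) v) p = eval_at x p" if "homogeneous {..<Suc n} d p" for p d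
    by (rule eval_cong[OF that]) (simp add: v_def)
  have "v \<noteq> 0\<^sub>v (Suc n)" using j assms(2) by (auto simp: v_def vec_eq_iff)
  moreover have "v \<in> carrier_vec (Suc n)" by (simp add: v_def)
  moreover have "of_nat (Suc e) * eval_at x f = 0"
    using euler_identity[OF hom_f, of x] assms(1) by (simp add: df_def)
  then have "eval_at (($) v) f = 0" using ev[OF hom_f] by (simp del: of_nat_Suc)
  ultimately obtain i where "i < Suc n" "eval_at (($) v) (partial i f) \<noteq> 0"
    using smooth_f unfolding smooth_hypersurface_def by blast
  then show False using assms(1)[of i] ev[OF hom_df, of i] by (simp add: df_def)
qed

lemma var_power_in_jacobian_ideal:
  obtains k where "\<And>j. j < Suc n \<Longrightarrow> var j ^ k \<in> gen_ideal df {..<Suc n}"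
proof -
  have "\<exists>k. var j ^ k \<in> gen_ideal df {..<Suc n}" if "j < Suc n" for j
    by (rule nullstellensatz) (use df_common_zero that in auto)
  then obtain k where k: "\<And>j. j < Suc n \<Longrightarrow> var j ^ k j \<in> gen_ideal df {..<Suc n}" by metis
  have "var j ^ (\<Sum>j<Suc n. k j) \<in> gen_ideal df {..<Suc n}" if "j < Suc n" for j
  proof -
    have "k j \<le> (\<Sum>j<Suc n. k j)" by (rule member_le_sum) (use that in auto)
    then have "var j ^ (\<Sum>j<Suc n. k j) = var j ^ ((\<Sum>j<Suc n. k j) - k j) * var j ^ k j"
      by (metis le_add_diff_inverse2 power_add)
    then show ?thesis using gen_ideal_mult[OF k[OF that]] by simp
  qed
  then show thesis by (rule that)
qed

lemma syzygy_zero: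
  assumes "\<And>i. i < Suc n \<Longrightarrow> homogeneous {..<Suc n} s (L i)" "s < e"
    and "(\<Sum>i<Suc n. L i * df i) = 0" "i < Suc n"
  shows "L i = 0"
proof -
  obtain k where k: "\<And>j. j < Suc n \<Longrightarrow> var j ^ k \<in> gen_ideal df {..<Suc n}"
    using var_power_in_jacobian_ideal by blast
  show ?thesis
    by (rule no_low_syzygy[where I = "{..<Suc n}" and N = "Suc n" and f = df and V = "{..<Suc n}"
          and W = "{..<Suc n}"])
       (use assms hom_df k in auto)
qed

definition syz :: "(nat \<Rightarrow> complex) \<Rightarrow> (nat \<Rightarrow> nat mpoly) \<Rightarrow> bool" where
  "syz a L \<longleftrightarrow> hyp_restrict n a (\<Sum>i<Suc n. L i * df i) = 0"

text \<open>On the hyperplane there are \<open>n + 1\<close> derivatives in \<open>n\<close>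
  variables. This excess of one is why low-degree relations are proportional instead of zero; the
  powers of the variables remain in the restricted ideal.\<close>

lemma restricted_syzygies_parallel:
  assumes L: "\<And>i. i < Suc n \<Longrightarrow> homogeneous {..<Suc n} s (L i)" "syz a L"
    and M: "\<And>i. i < Suc n \<Longrightarrow> homogeneous {..<Suc n} t (M i)" "syz a M"
    and "s + t < e" "i < Suc n" "j < Suc n"
  shows "hyp_restrict n a (L i) * hyp_restrict n a (M j) = hyp_restrict n a (L j) * hyp_restrict n a (M i)"
proof -
  let ?r = "hyp_restrict n a"
  obtain k where k: "\<And>j. j < Suc n \<Longrightarrow> var j ^ k \<in> gen_ideal df {..<Suc n}"
    using var_power_in_jacobian_ideal by blast
  have k': "var j ^ k \<in> gen_ideal (\<lambda>i. ?r (df i)) {..<Suc n}" if j: "j < n" for j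
  proof -
    obtain c where "var j ^ k = (\<Sum>i<Suc n. c i * df i)"
      using k[of j] j by (auto simp: gen_ideal_def)
    then have "?r (var j ^ k) = (\<Sum>i<Suc n. ?r (c i) * ?r (df i))"
      by (simp only: hyp_restrict_simps)
    then show ?thesis using j by (intro gen_idealI) simp
  qed
  show ?thesis
  proof (rule low_syzygies_parallel[of "{..<Suc n}" n k "\<lambda>i. ?r (df i)" "{..<n}" e "{..<n}" s
        "\<lambda>i. ?r (L i)" t "\<lambda>i. ?r (M i)"])
    show "(\<Sum>i<Suc n. ?r (L i) * ?r (df i)) = 0" "(\<Sum>i<Suc n. ?r (M i) * ?r (df i)) = 0"
      using L(2) M(2) unfolding syz_def by (simp_all only: hyp_restrict_simps)
  qed (use assms k' hom_df in \<open>auto intro: homogeneous_hyp_restrict\<close>)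
qed

text \<open>The first-order condition for a relation \<open>L \<cdot> df = \<ell>\<^sup>k g\<close> to deform when the hyperplane moves:
  \<open>L'\<close> and \<open>g'\<close> are the derivatives of \<open>L\<close> and \<open>g\<close> with respect to \<open>a\<^sub>j\<close>.\<close>
definition liftable :: "nat \<Rightarrow> nat \<Rightarrow> (nat \<Rightarrow> complex) \<Rightarrow> bool" where
  "liftable m k a \<longleftrightarrow> (\<forall>L g. (\<forall>i<Suc n. homogeneous {..<Suc n} m (L i)) \<longrightarrow>
     (\<Sum>i<Suc n. L i * df i) = hyp_form n a ^ k * g \<longrightarrow>
     (\<forall>j<n. \<exists>L' g'. (\<forall>i<Suc n. homogeneous {..<Suc n} m (L' i)) \<and>
       (\<Sum>i<Suc n. L' i * df i) = hyp_form n a ^ (k - 1) * (of_nat k * var j * g + hyp_form n a * g')))"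

text \<open>For fixed \<open>a\<close> the relation is a linear system for the coefficients of
  \<open>L\<close> and \<open>g\<close>, with one equation for each point \<open>x\<close> and
  entries polynomial in \<open>a\<close>. For generic \<open>a\<close> a solution extends to a
  polynomial family, and the identity is differentiated along \<open>a_j\<close>.\<close>

lemma generic_liftable:
  assumes k: "0 < k" "k \<le> m + e"
  shows "\<exists>q. q \<noteq> 0 \<and> (\<forall>a. eval_at a q \<noteq> 0 \<longrightarrow> liftable m k a)"
proof -
  \<comment> \<open>The degree that the cofactor \<open>g\<close> must have.\<close>
  define s where "s = m + e - k"
  let ?V = "{..<Suc n}"
  define I1 where "I1 = ?V \<times> monomials ?V m"
  define I2 where "I2 = monomials ?V s"
  have fin: "finite I1" "finite I2" by (simp_all add: I1_def I2_def finite_monomials)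
  \<comment> \<open>The value of \<open>hyp_form n a\<close> at \<open>x\<close>, read as a
    polynomial in \<open>a\<close> for fixed \<open>x\<close>.\<close>
  define form :: "(nat \<Rightarrow> complex) \<Rightarrow> nat mpoly" where
    "form x = (\<Sum>j<n. var j * const (x j)) - const (x n)" for x
  have form: "eval_at a (form x) = eval_at x (hyp_form n a)" for a x
    by (simp add: form_def eval_hyp_form)
  define p :: "(nat \<times> (nat \<Rightarrow>\<^sub>0 nat)) + (nat \<Rightarrow>\<^sub>0 nat) \<Rightarrow> (nat \<Rightarrow> complex) \<Rightarrow> nat mpoly" where
    "p z x = (case z of Inl (i, m) \<Rightarrow> const (mon_eval x m * eval_at x (df i))
       | Inr m \<Rightarrow> - (form x ^ k * const (mon_eval x m)))" for z x
  have sumI: "(\<Sum>z\<in>I1 <+> I2. h z) = (\<Sum>i<Suc n. \<Sum>m\<in>monomials ?V m. h (Inl (i, m))) + (\<Sum>m\<in>I2. h (Inr m))"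
    for h :: "_ \<Rightarrow> complex"
    by (subst sum.Plus[OF fin]) (simp add: I1_def sum.cartesian_product)
  obtain q where q: "q \<noteq> 0" "\<And>a c. eval_at a q \<noteq> 0 \<Longrightarrow> (\<forall>x. (\<Sum>z\<in>I1 <+> I2. c z * eval_at a (p z x)) = 0) \<Longrightarrow>
     (\<exists>C. (\<forall>x. (\<Sum>z\<in>I1 <+> I2. C z * p z x) = 0) \<and> (\<forall>z\<in>I1 <+> I2. eval_at a (C z) = c z))"
    using generic_relation_lift[of "I1 <+> I2" p] fin by auto
  have "liftable m k a" if a: "eval_at a q \<noteq> 0" for a
    unfolding liftable_def
  proof (intro allI impI)
    fix L g j
    assume L: "\<forall>i<Suc n. homogeneous ?V m (L i)"
      and rel: "(\<Sum>i<Suc n. L i * df i) = hyp_form n a ^ k * g" and j: "j < n"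
    have "homogeneous ?V (m + e) (hyp_form n a ^ k * g)"
      unfolding rel [symmetric] using L hom_df by (intro homogeneous_sum homogeneous_mult) auto
    then have g: "homogeneous ?V s g"
      using homogeneous_cofactor[of ?V "m + e" "hyp_form n a ^ k" g k] k
        homogeneous_power[OF homogeneous_hyp_form[of n a], of k] by (simp add: s_def)
    define c where "c z = (case z of Inl (i, m) \<Rightarrow> lookup (L i) m | Inr m \<Rightarrow> lookup g m)" for z
    have "(\<Sum>z\<in>I1 <+> I2. c z * eval_at a (p z x)) = 0" for x
    proof -
      have "(\<Sum>z\<in>I1 <+> I2. c z * eval_at a (p z x)) =
          (\<Sum>i<Suc n. (\<Sum>m\<in>monomials ?V m. lookup (L i) m * mon_eval x m) * eval_at x (df i))
            - eval_at x (hyp_form n a) ^ k * (\<Sum>m\<in>I2. lookup g m * mon_eval x m)"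
        unfolding sumI
        by (simp add: c_def p_def form sum_distrib_left sum_distrib_right sum_negf mult_ac)
      also have "\<dots> = eval_at x (\<Sum>i<Suc n. L i * df i) - eval_at x (hyp_form n a ^ k * g)"
      proof -
        have "(\<Sum>m\<in>monomials ?V m. lookup (L i) m * mon_eval x m) = eval_at x (L i)" if "i < Suc n" for i
          using eval_homogeneous[of ?V m "L i" x] L that by simp
        moreover have "(\<Sum>m\<in>I2. lookup g m * mon_eval x m) = eval_at x g"
          using eval_homogeneous[OF g, of x] by (simp add: I2_def)
        ultimately show ?thesis by simp
      qed
      finally show ?thesis unfolding rel by simp
    qed
    then obtain C where C: "\<And>x. (\<Sum>z\<in>I1 <+> I2. C z * p z x) = 0"
      "\<And>z. z \<in> I1 <+> I2 \<Longrightarrow> eval_at a (C z) = c z"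
      using q(2)[OF a, of c] by blast
    define line where "line t = (\<lambda>i. a i + t * (if i = j then 1 else 0 :: complex))" for t
    have line0: "line 0 = a" by (simp add: line_def)
    have "\<forall>z. \<exists>D. ((\<lambda>t. eval_at (line t) (C z)) has_field_derivative D) (at 0)"
      unfolding line_def by (intro allI eval_line_derivative)
    then obtain D where D: "\<And>z. ((\<lambda>t. eval_at (line t) (C z)) has_field_derivative D z) (at 0)"
      by metis
    \<comment> \<open>The derivatives at \<open>a\<close>, in direction \<open>j\<close>, of the
      coefficients of the extended family are assembled into polynomials again.\<close>
    define L' where "L' i = (\<Sum>\<mu>\<in>monomials ?V m. single \<mu> (D (Inl (i, \<mu>))))" for i
    define g' where "g' = (\<Sum>\<mu>\<in>I2. single \<mu> (D (Inr \<mu>)))"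
    have evL': "eval_at x (L' i) = (\<Sum>\<mu>\<in>monomials ?V m. D (Inl (i, \<mu>)) * mon_eval x \<mu>)" for i x
      by (simp add: L'_def peval_single)
    have evg': "eval_at x g' = (\<Sum>\<mu>\<in>I2. D (Inr \<mu>) * mon_eval x \<mu>)" for x
      by (simp add: g'_def peval_single)
    have "(\<Sum>i<Suc n. L' i * df i) = hyp_form n a ^ (k - 1) * (of_nat k * var j * g) + hyp_form n a ^ k * g'"
    proof (rule mpoly_eqI)
      fix x
      have fl: "eval_at (line t) (form x) = eval_at x (hyp_form n a) + t * x j" for t
      proof -
        have "(\<Sum>i<n. line t i * x i) = (\<Sum>i<n. a i * x i + (if i = j then t * x j else 0))"
          by (rule sum.cong) (auto simp: line_def algebra_simps)
        then show ?thesis unfolding form eval_hyp_form using j by (simp add: sum.distrib line_def)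
      qed
      \<comment> \<open>Of the known entries of the system, only those coming from the power of the
        hyperplane form depend on \<open>a\<close>.\<close>
      define dp where "dp z = (case z of Inl (i, m) \<Rightarrow> 0
        | Inr \<mu> \<Rightarrow> - (of_nat k * eval_at x (hyp_form n a) ^ (k - 1) * x j * mon_eval x \<mu>))"
        for z :: "(nat \<times> (nat \<Rightarrow>\<^sub>0 nat)) + (nat \<Rightarrow>\<^sub>0 nat)"
      have dp: "((\<lambda>t. eval_at (line t) (p z x)) has_field_derivative dp z) (at 0)" for z
      proof (cases z)
        case (Inl y)
        then show ?thesis by (cases y) (simp add: p_def dp_def)
      next
        case (Inr \<mu>)
        then show ?thesis unfolding p_def dp_def
          by (auto simp: fl intro!: derivative_eq_intros)
      qed
      have "((\<lambda>t. \<Sum>z\<in>I1 <+> I2. eval_at (line t) (C z) * eval_at (line t) (p z x)) has_field_derivative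
          (\<Sum>z\<in>I1 <+> I2. D z * eval_at (line 0) (p z x) + dp z * eval_at (line 0) (C z))) (at 0)"
        by (intro DERIV_sum DERIV_mult D dp)
      moreover have "(\<Sum>z\<in>I1 <+> I2. eval_at (line t) (C z) * eval_at (line t) (p z x)) = 0" for t
        using arg_cong[OF C(1)[of x], of "eval_at (line t)"] by simp
      ultimately have "((\<lambda>t. 0) has_field_derivative
          (\<Sum>z\<in>I1 <+> I2. D z * eval_at a (p z x) + dp z * eval_at a (C z))) (at 0)"
        by (simp add: line0)
      then have "(\<Sum>z\<in>I1 <+> I2. D z * eval_at a (p z x) + dp z * eval_at a (C z)) = 0"
        by (rule DERIV_unique) (rule DERIV_const)
      moreover have "(\<Sum>z\<in>I1 <+> I2. D z * eval_at a (p z x) + dp z * eval_at a (C z)) =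
         (\<Sum>z\<in>I1 <+> I2. D z * eval_at a (p z x) + dp z * c z)"
        by (rule sum.cong) (simp_all add: C(2))
      ultimately have "(\<Sum>z\<in>I1 <+> I2. D z * eval_at a (p z x) + dp z * c z) = 0" by simp
      moreover have "(\<Sum>z\<in>I1 <+> I2. D z * eval_at a (p z x) + dp z * c z) =
          (\<Sum>i<Suc n. eval_at x (L' i) * eval_at x (df i))
          - eval_at x (hyp_form n a) ^ k * eval_at x g'
          - of_nat k * eval_at x (hyp_form n a) ^ (k - 1) * x j * eval_at x g"
        unfolding sumI eval_homogeneous[OF g finite_lessThan] evL' evg'
        by (simp add: p_def dp_def c_def form sum_distrib_left sum_distrib_right sum_negf
            sum.distrib sum_subtractf I2_def mult_ac)
      ultimately have "(\<Sum>i<Suc n. eval_at x (L' i) * eval_at x (df i)) =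
          of_nat k * eval_at x (hyp_form n a) ^ (k - 1) * x j * eval_at x g
          + eval_at x (hyp_form n a) ^ k * eval_at x g'"
        by (simp add: algebra_simps)
      moreover have "eval_at x (of_nat k) = of_nat k" by (induction k) simp_all
      ultimately show "eval_at x (\<Sum>i<Suc n. L' i * df i) =
          eval_at x (hyp_form n a ^ (k - 1) * (of_nat k * var j * g) + hyp_form n a ^ k * g')"
        by (simp add: mult_ac)
    qed
    moreover have "homogeneous ?V m (L' i)" for i
      unfolding L'_def by (intro homogeneous_sum homogeneous_single)
    moreover have "hyp_form n a ^ k = hyp_form n a ^ (k - 1) * hyp_form n a"
      using k(1) by (metis Suc_diff_1 power_Suc2)
    then have "hyp_form n a ^ (k - 1) * (of_nat k * var j * g) + hyp_form n a ^ k * g' =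
        hyp_form n a ^ (k - 1) * (of_nat k * var j * g + hyp_form n a * g')"
      by (simp add: algebra_simps)
    ultimately show "\<exists>L' g'. (\<forall>i<Suc n. homogeneous ?V m (L' i)) \<and>
       (\<Sum>i<Suc n. L' i * df i) = hyp_form n a ^ (k - 1) * (of_nat k * var j * g + hyp_form n a * g')"
      by (intro exI[of _ L'] exI[of _ g']) simp
  qed
  then show ?thesis using q(1) by blast
qed

end

section \<open>Raising the order of divisibility along a generic hyperplane\<close>

context smooth_form
begin

declare One_nat_def [simp del]

definition no_const_syzygy :: "(nat \<Rightarrow> complex) \<Rightarrow> bool" where
  "no_const_syzygy a \<longleftrightarrow> (\<forall>u. (\<forall>i<Suc n. homogeneous {..<Suc n} 0 (u i)) \<longrightarrow> syz a u \<longrightarrow>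
     (\<forall>i<Suc n. u i = 0))"

lemma liftableD:
  assumes "liftable m k a" "\<forall>i<Suc n. homogeneous {..<Suc n} m (L i)"
    and "(\<Sum>i<Suc n. L i * df i) = hyp_form n a ^ k * g"
  shows "\<exists>L' g'. (\<forall>j<n. \<forall>i<Suc n. homogeneous {..<Suc n} m (L' j i)) \<and>
    (\<forall>j<n. (\<Sum>i<Suc n. L' j i * df i) =
       hyp_form n a ^ (k - 1) * (of_nat k * var j * g + hyp_form n a * g' j))"
proof -
  have "\<forall>j. \<exists>L' g'. j < n \<longrightarrow> (\<forall>i<Suc n. homogeneous {..<Suc n} m (L' i)) \<and>
       (\<Sum>i<Suc n. L' i * df i) = hyp_form n a ^ (k - 1) * (of_nat k * var j * g + hyp_form n a * g')"
    using assms unfolding liftable_def by blast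
  then obtain L' g' where "\<forall>j. j < n \<longrightarrow> (\<forall>i<Suc n. homogeneous {..<Suc n} m (L' j i)) \<and>
       (\<Sum>i<Suc n. L' j i * df i) = hyp_form n a ^ (k - 1) * (of_nat k * var j * g + hyp_form n a * g' j)"
    by (simp only: choice_iff) blast
  then show ?thesis by (intro exI[of _ L'] exI[of _ g']) auto
qed

lemma sum_linear:
  "(\<Sum>i<Suc n. (p * A i - q * B i) * df i) = p * (\<Sum>i<Suc n. A i * df i) - q * (\<Sum>i<Suc n. B i * df i)"
  by (simp add: algebra_simps sum_subtractf sum_distrib_left)

text \<open>The derivatives of \<open>u\<close> are multiples of \<open>u\<close>, since two such relations are proportional.
  Comparing the two expressions for \<open>u' \<cdot> df\<close> shows that every power of \<open>\<ell>\<close> dividing \<open>u \<cdot> df\<close> can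
  be raised by one.\<close>
lemma const_syzygy_zero:
  assumes lift: "\<And>k. 0 < k \<Longrightarrow> k \<le> e \<Longrightarrow> liftable 0 k a"
    and u: "\<And>i. i < Suc n \<Longrightarrow> homogeneous {..<Suc n} 0 (u i)" "syz a u" and i0: "i0 < Suc n"
  shows "u i0 = 0"
proof (rule ccontr)
  assume nz: "u i0 \<noteq> 0"
  let ?l = "hyp_form n a" and ?r = "hyp_restrict n a"
  have "\<forall>i. \<exists>c. i < Suc n \<longrightarrow> u i = const c" using u(1) homogeneous_0E by metis
  then obtain U where U: "\<And>i. i < Suc n \<Longrightarrow> u i = const (U i)" by metis
  have Unz: "U i0 \<noteq> 0" using U[OF i0] nz by auto
  have "\<exists>g. (\<Sum>i<Suc n. u i * df i) = ?l ^ Suc k * g" if "k \<le> e" for k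
    using that
  proof (induction k)
    case 0
    have "?l dvd (\<Sum>i<Suc n. u i * df i)" using u(2) by (simp add: syz_def hyp_form_dvd_iff)
    then show ?case by (auto elim!: dvdE)
  next
    case (Suc k)
    then obtain g where g: "(\<Sum>i<Suc n. u i * df i) = ?l ^ Suc k * g" by auto
    have "liftable 0 (Suc k) a" using lift Suc.prems by simp
    have "\<forall>i<Suc n. homogeneous {..<Suc n} 0 (u i)" using u(1) by blast
    from liftableD[OF \<open>liftable 0 (Suc k) a\<close> this g, unfolded diff_Suc_1] obtain u' g'
      where "\<forall>j<n. \<forall>i<Suc n. homogeneous {..<Suc n} 0 (u' j i)"
        "\<forall>j<n. (\<Sum>i<Suc n. u' j i * df i) =
         ?l ^ k * (of_nat (Suc k) * var j * g + ?l * g' j)" by (elim exE conjE)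
    then have hu': "\<And>j i. j < n \<Longrightarrow> i < Suc n \<Longrightarrow> homogeneous {..<Suc n} 0 (u' j i)"
      and u': "\<And>j. j < n \<Longrightarrow> (\<Sum>i<Suc n. u' j i * df i) =
         ?l ^ k * (of_nat (Suc k) * var j * g + ?l * g' j)"
      by blast+
    have "\<forall>j. \<forall>i. \<exists>c. j < n \<longrightarrow> i < Suc n \<longrightarrow> u' j i = const c"
      using hu' homogeneous_0E by metis
    then obtain U' where U': "\<And>j i. j < n \<Longrightarrow> i < Suc n \<Longrightarrow> u' j i = const (U' j i)" by metis
    have 01: "0 < n" "1 < n" using n by auto
    have par: "U i0 * U' 0 q = U q * U' 0 i0" if q: "q < Suc n" for q
    \<comment> \<open>For \<open>k = 0\<close> the derivatives satisfy
      \<open>u' j \<cdot> df = x_j g\<close> on the hyperplane, so the combination \<open>M\<close>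
      of two of them is used, in which \<open>g\<close> cancels. For larger \<open>k\<close> the
      factor \<open>?l ^ k\<close> makes \<open>u' 0\<close> itself a relation.\<close>
    proof (cases k)
      case 0
      define M where "M i = var 1 * u' 0 i - var 0 * u' 1 i" for i
      have M: "homogeneous {..<Suc n} (1 + 0) (M i)" if "i < Suc n" for i
        unfolding M_def using that 01 hu'
        by (intro homogeneous_diff homogeneous_mult homogeneous_var) auto
      have "(\<Sum>i<Suc n. M i * df i) = ?l * (var 1 * g' 0 - var 0 * g' 1)"
        unfolding M_def sum_linear u'[OF 01(1)] u'[OF 01(2)] 0 by (simp add: algebra_simps)
      then have "syz a M" by (simp add: syz_def)
      then have "?r (u i0) * ?r (M q) = ?r (u q) * ?r (M i0)"
        using restricted_syzygies_parallel[OF u M] q i0 e by auto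
      then have "var 1 * const (U i0 * U' 0 q - U q * U' 0 i0) =
          (var 0 * const (U i0 * U' 1 q - U q * U' 1 i0) :: nat mpoly)"
        using q i0 01 by (simp add: M_def U U' const_diff const_mult algebra_simps)
      then have "U i0 * U' 0 q - U q * U' 0 i0 = 0" by (rule var_const_indep) simp
      then show ?thesis by simp
    next
      case (Suc k')
      have "syz a (u' 0)" unfolding syz_def u'[OF 01(1)] Suc by simp
      then have "?r (u i0) * ?r (u' 0 q) = ?r (u q) * ?r (u' 0 i0)"
        using restricted_syzygies_parallel[OF u hu'[OF 01(1)]] q i0 e by auto
      then have "const (U i0 * U' 0 q) = (const (U q * U' 0 i0) :: nat mpoly)"
        using q i0 01 by (simp add: U U' const_mult)
      then show ?thesis by simp
    qed
    define c where "c = U' 0 i0 / U i0"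
    have "u' 0 q = const c * u q" if "q < Suc n" for q
      using par[OF that] Unz by (simp add: U U' that 01 c_def field_simps flip: const_mult)
    then have "(\<Sum>i<Suc n. u' 0 i * df i) = const c * (\<Sum>i<Suc n. u i * df i)"
      by (simp add: sum_distrib_left mult.assoc)
    \<comment> \<open>Two expressions for one polynomial: after cancelling \<open>?l ^ k\<close>,
      restriction to the hyperplane leaves \<open>(k + 1) x_0 g = 0\<close>.\<close>
    then have "?l ^ k * (of_nat (Suc k) * var 0 * g + ?l * g' 0) = ?l ^ k * (const c * ?l * g)"
      unfolding u'[OF 01(1)] g by (simp add: mult_ac)
    then have "of_nat (Suc k) * var 0 * g + ?l * g' 0 = const c * ?l * g" by simp
    then have "?r (of_nat (Suc k) * var 0 * g + ?l * g' 0) = ?r (const c * ?l * g)" by simp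
    then have "of_nat (Suc k) * var 0 * ?r g = 0"
      using 01 by (simp del: of_nat_Suc)
    then have "?l dvd g" unfolding hyp_form_dvd_iff by (simp del: of_nat_Suc)
    then show ?case unfolding g by (auto elim!: dvdE simp: mult_ac)
  qed
  from this[of e] obtain g where g: "(\<Sum>i<Suc n. u i * df i) = ?l ^ Suc e * g" by auto
  have "homogeneous {..<Suc n} (0 + e) (?l ^ Suc e * g)"
    unfolding g [symmetric] using u hom_df by (intro homogeneous_sum homogeneous_mult) auto
  \<comment> \<open>The power \<open>?l ^ Suc e\<close> exceeds the degree \<open>e\<close> of the
    left-hand side.\<close>
  then have "g = 0"
    using homogeneous_cofactor[of "{..<Suc n}" e "?l ^ Suc e" g "Suc e"]
      homogeneous_power[OF homogeneous_hyp_form[of n a], of "Suc e"] by simp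
  then have "u i0 = 0" by (intro syzygy_zero[of 0 u]) (use u g i0 e in auto)
  then show False using nz by simp
qed

text \<open>The restricted \<open>L i0\<close> is a linear form \<open>p\<close>, hence prime. If it
  divided every entry of \<open>L\<close>, the quotients would be a constant relation; so some entry
  is not divisible, and proportionality forces \<open>p\<close> to divide the restricted
  \<open>M i0\<close>.\<close>

lemma restricted_multiple:
  assumes c0: "no_const_syzygy a"
    and L: "\<And>i. i < Suc n \<Longrightarrow> homogeneous {..<Suc n} 1 (L i)" "syz a L"
    and i0: "i0 < Suc n" "hyp_restrict n a (L i0) \<noteq> 0"
    and M: "\<And>i. i < Suc n \<Longrightarrow> homogeneous {..<Suc n} t (M i)" "syz a M"
    and t: "0 < t" "1 + t < e"
  obtains q where "homogeneous {..<n} (t - 1) q"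
    "\<And>i. i < Suc n \<Longrightarrow> hyp_restrict n a (M i) = q * hyp_restrict n a (L i)"
proof -
  let ?r = "hyp_restrict n a"
  define p where "p = ?r (L i0)"
  have p: "homogeneous {..<n} 1 p" "p \<noteq> 0"
    using i0 L by (auto simp: p_def intro: homogeneous_hyp_restrict)
  have "\<exists>j<Suc n. \<not> p dvd ?r (L j)"
  proof (rule ccontr)
    assume "\<not> (\<exists>j<Suc n. \<not> p dvd ?r (L j))"
    then have "\<forall>j. \<exists>v. j < Suc n \<longrightarrow> ?r (L j) = p * v" by (metis dvdE)
    then obtain v where v: "\<And>j. j < Suc n \<Longrightarrow> ?r (L j) = p * v j" by metis
    have hv: "homogeneous {..<n} 0 (v j)" if "j < Suc n" for j
      using homogeneous_cofactor[of "{..<n}" 1 p "v j" 1] p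
        homogeneous_hyp_restrict[OF L(1)[OF that], of a] v[OF that] by simp
    have "(\<Sum>j<Suc n. ?r (L j) * ?r (df j)) = 0" using L(2) by (simp add: syz_def)
    then have "(\<Sum>j<Suc n. p * v j * ?r (df j)) = 0" using v by simp
    then have "p * (\<Sum>j<Suc n. v j * ?r (df j)) = 0" by (simp only: sum_distrib_left mult.assoc)
    then have "(\<Sum>j<Suc n. v j * ?r (df j)) = 0" using p by simp
    moreover have "?r (v j) = v j" if "j < Suc n" for j using hyp_restrict_low[OF hv[OF that]] .
    ultimately have "syz a v" by (simp add: syz_def)
    moreover have "homogeneous {..<Suc n} 0 (v j)" if "j < Suc n" for j
      using hv[OF that] by (rule homogeneous_mono) auto
    ultimately have "v i0 = 0" using c0 i0 unfolding no_const_syzygy_def by blast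
    then show False using v[OF i0(1)] i0 by simp
  qed
  then obtain j0 where j0: "j0 < Suc n" "\<not> p dvd ?r (L j0)" by blast
  have par: "p * ?r (M j) = ?r (L j) * ?r (M i0)" if "j < Suc n" for j
    unfolding p_def using restricted_syzygies_parallel[OF L M] t i0 that by blast
  have "p dvd ?r (L j0) * ?r (M i0)" using par[OF j0(1)] by (metis dvd_triv_left)
  then have "p dvd ?r (M i0)" using linear_form_prime[OF p(1) _ p(2)] j0 by blast
  then obtain q where q: "?r (M i0) = p * q" by (elim dvdE)
  have "homogeneous {..<n} t (p * q)"
    using homogeneous_hyp_restrict[OF M(1)[OF i0(1)], of a] q by simp
  then have "homogeneous {..<n} (t - 1) q"
    using homogeneous_cofactor[of "{..<n}" t p q 1] p t by simp
  moreover have "?r (M j) = q * ?r (L j)" if "j < Suc n" for j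
  proof -
    have "p * ?r (M j) = p * (q * ?r (L j))" using par[OF that] q by (simp add: mult_ac)
    then show ?thesis using p by simp
  qed
  ultimately show thesis by (rule that)
qed

text \<open>If \<open>L \<cdot> df = \<ell> g\<close>, then \<open>L'\<^sub>j \<cdot> df = x\<^sub>j g\<close> on the hyperplane, so the \<open>x\<^sub>i L'\<^sub>j - x\<^sub>j L'\<^sub>i\<close> are
  relations again, hence multiples \<open>q\<^sub>i\<^sub>j L\<close>. The cyclic identity among three of the \<open>q\<^sub>i\<^sub>j\<close> gives
  \<open>L'\<^sub>0 = c L + x\<^sub>0 u\<close> with constant \<open>u\<close>, so that \<open>\<ell>\<close> divides \<open>g - u \<cdot> df\<close>, and
  \<open>L - \<ell> u\<close> is the required relation.\<close>
lemma linear_syzygy_square: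
  assumes c0: "no_const_syzygy a"
    and lift: "liftable 1 1 a"
    and L: "\<And>i. i < Suc n \<Longrightarrow> homogeneous {..<Suc n} 1 (L i)" "syz a L"
    and i0: "i0 < Suc n" "hyp_restrict n a (L i0) \<noteq> 0"
  obtains L2 g where "\<And>i. i < Suc n \<Longrightarrow> homogeneous {..<Suc n} 1 (L2 i)"
    "(\<Sum>i<Suc n. L2 i * df i) = hyp_form n a ^ 2 * g" "hyp_restrict n a (L2 i0) \<noteq> 0"
proof -
  let ?l = "hyp_form n a" and ?r = "hyp_restrict n a"
  have n3: "0 < n" "1 < n" "2 < n" using n by auto
  have "?l dvd (\<Sum>i<Suc n. L i * df i)" using L(2) by (simp add: syz_def hyp_form_dvd_iff)
  then obtain g where g: "(\<Sum>i<Suc n. L i * df i) = ?l ^ 1 * g" by (auto elim!: dvdE)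
  have "\<forall>i<Suc n. homogeneous {..<Suc n} 1 (L i)" using L(1) by blast
    from liftableD[OF lift this g] obtain L' g'
      where "\<forall>j<n. \<forall>i<Suc n. homogeneous {..<Suc n} 1 (L' j i)"
        "\<forall>j<n. (\<Sum>i<Suc n. L' j i * df i) =
       ?l ^ (1 - 1) * (of_nat 1 * var j * g + ?l * g' j)" by (elim exE conjE)
    then have hL': "\<And>j i. j < n \<Longrightarrow> i < Suc n \<Longrightarrow> homogeneous {..<Suc n} 1 (L' j i)"
      and L': "\<And>j. j < n \<Longrightarrow> (\<Sum>i<Suc n. L' j i * df i) =
       ?l ^ (1 - 1) * (of_nat 1 * var j * g + ?l * g' j)"
      by blast+
  define M where "M i j p = var i * L' j p - var j * L' i p" for i j p
  have "\<exists>q. homogeneous {..<n} 1 q \<and> (\<forall>p<Suc n. ?r (M i j p) = q * ?r (L p))"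
    if ij: "i < n" "j < n" for i j
  proof -
    have hM: "homogeneous {..<Suc n} 2 (M i j p)" if "p < Suc n" for p
    proof -
      have "homogeneous {..<Suc n} (1 + 1) (M i j p)"
        unfolding M_def using that ij hL'
        by (intro homogeneous_diff homogeneous_mult homogeneous_var) auto
      then show ?thesis by (simp add: numeral_2_eq_2)
    qed
    have "(\<Sum>p<Suc n. M i j p * df p) = ?l * (var i * g' j - var j * g' i)"
      unfolding M_def sum_linear L'[OF ij(1)] L'[OF ij(2)] by (simp add: algebra_simps)
    then have "syz a (M i j)" by (simp add: syz_def)
    from restricted_multiple[OF c0 L i0 hM this] obtain q where
      "homogeneous {..<n} (2 - 1) q" "\<And>p. p < Suc n \<Longrightarrow> ?r (M i j p) = q * ?r (L p)"
      using e by auto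
    then show ?thesis by (intro exI[of _ q]) (simp add: One_nat_def)
  qed
  then obtain q where hq: "\<And>i j. i < n \<Longrightarrow> j < n \<Longrightarrow> homogeneous {..<n} 1 (q i j)"
    and q: "\<And>i j p. i < n \<Longrightarrow> j < n \<Longrightarrow> p < Suc n \<Longrightarrow> ?r (M i j p) = q i j * ?r (L p)"
    by metis
  \<comment> \<open>The terms with \<open>L' 0\<close> cancel, and \<open>x_0\<close> comes out of
    the rest.\<close>
  have "(var 2 * q 1 0 - var 1 * q 2 0) * ?r (L i0) = var 2 * ?r (M 1 0 i0) - var 1 * ?r (M 2 0 i0)"
    using q n3 i0 by (simp add: algebra_simps)
  also have "\<dots> = var 0 * ?r (M 1 2 i0)" using n3 by (simp add: M_def algebra_simps)
  also have "\<dots> = var 0 * q 1 2 * ?r (L i0)" using q n3 i0 by simp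
  finally have cyc: "var 2 * q 1 0 - var 1 * q 2 0 = var 0 * q 1 2" using i0 by simp
  \<comment> \<open>Setting \<open>x_0 = 0\<close> in the cyclic identity leaves
    \<open>x_2 q_10 = x_1 q_20\<close>, so \<open>q_10\<close> is a multiple of \<open>x_1\<close>
    modulo \<open>x_0\<close>.\<close>
  define y :: "nat \<Rightarrow> nat mpoly" where "y = (\<lambda>i. if i = 0 then 0 else var i)"
  let ?z = "peval const y"
  have "?z (var 2 * q 1 0 - var 1 * q 2 0) = ?z (var 0 * q 1 2)" using cyc by simp
  then have z: "var 2 * ?z (q 1 0) = var 1 * ?z (q 2 0)" by (simp add: y_def)
  have hv1: "homogeneous {..<n} 1 (var 1 :: nat mpoly)" "homogeneous {..<n} 1 (var 0 :: nat mpoly)"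
    using n3 by (auto intro!: homogeneous_var simp del: One_nat_def)
  have "var 1 dvd var 2 * ?z (q 1 0)" unfolding z by simp
  then have "var 1 dvd ?z (q 1 0)"
    using linear_form_prime[OF hv1(1)] var_not_dvd_var[of "1 :: nat" 2] by auto
  then obtain c where c: "?z (q 1 0) = var 1 * c" by (elim dvdE)
  have "homogeneous {..<n} 1 (?z (q 1 0))"
    using hq[OF n3(2,1)] by (rule homogeneous_subst)
      (auto simp: y_def intro!: homogeneous_var simp del: One_nat_def)
  then have "homogeneous {..<n} 0 c"
    using homogeneous_cofactor[of "{..<n}" 1 "var 1" c 1] hv1 c by simp
  then obtain \<gamma> where \<gamma>: "c = const \<gamma>" by (rule homogeneous_0E)
  have "var 0 dvd peval const var (q 1 0) - ?z (q 1 0)"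
    by (rule dvd_diff_subst) (auto simp: y_def)
  then obtain c' where "q 1 0 - var 1 * c = var 0 * c'" by (auto simp: c elim!: dvdE)
  then have q10: "q 1 0 = c * var 1 + var 0 * c'" by (simp add: algebra_simps)
  \<comment> \<open>With \<open>q_10 = c x_1 + x_0 c'\<close> inserted, the relation for
    \<open>M 1 0\<close> says that \<open>x_0\<close> divides
    \<open>x_1 (L'_0 - c L)\<close>.\<close>
  have "\<exists>u. homogeneous {..<n} 0 u \<and> ?r (L' 0 p) = c * ?r (L p) + var 0 * u" if p: "p < Suc n" for p
  proof -
    have "var 1 * ?r (L' 0 p) - var 0 * ?r (L' 1 p) = (c * var 1 + var 0 * c') * ?r (L p)"
      using q[OF n3(2,1) p] n3 unfolding q10 by (simp add: M_def)
    then have "var 1 * (?r (L' 0 p) - c * ?r (L p)) = var 0 * (?r (L' 1 p) + c' * ?r (L p))"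
      by (simp add: algebra_simps)
    then have "var 0 dvd var 1 * (?r (L' 0 p) - c * ?r (L p))" by simp
    then have "var 0 dvd ?r (L' 0 p) - c * ?r (L p)"
      using linear_form_prime[OF hv1(2)] var_not_dvd_var[of "0 :: nat" 1] by auto
    then obtain u where u: "?r (L' 0 p) - c * ?r (L p) = var 0 * u" by (elim dvdE)
    have "homogeneous {..<n} 1 (var 0 * u)"
      unfolding u [symmetric] \<gamma>
      by (intro homogeneous_diff homogeneous_const_mult homogeneous_hyp_restrict L hL' n3 p)
    then have "homogeneous {..<n} 0 u"
      using homogeneous_cofactor[of "{..<n}" 1 "var 0" u 1] hv1 by simp
    then show ?thesis using u by (intro exI[of _ u]) (simp add: algebra_simps)
  qed
  then obtain u where hu: "\<And>p. p < Suc n \<Longrightarrow> homogeneous {..<n} 0 (u p)"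
    and u: "\<And>p. p < Suc n \<Longrightarrow> ?r (L' 0 p) = c * ?r (L p) + var 0 * u p" by metis
  have hu': "homogeneous {..<Suc n} 0 (u p)" if "p < Suc n" for p
    using hu[OF that] by (rule homogeneous_mono) auto
  have "(\<Sum>i<Suc n. ?r (L i) * ?r (df i)) = 0" using L(2) by (simp add: syz_def)
  moreover have "(\<Sum>i<Suc n. ?r (L' 0 i) * ?r (df i)) =
      c * (\<Sum>i<Suc n. ?r (L i) * ?r (df i)) + var 0 * (\<Sum>i<Suc n. u i * ?r (df i))"
    using u by (simp add: distrib_right sum.distrib sum_distrib_left mult.assoc)
  moreover have "(\<Sum>i<Suc n. ?r (L' 0 i) * ?r (df i)) = var 0 * ?r g"
    using arg_cong[OF L'[OF n3(1)], of ?r] n3 by simp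
  ultimately have "var 0 * ?r g = var 0 * (\<Sum>i<Suc n. u i * ?r (df i))" by simp
  then have "?r g = (\<Sum>i<Suc n. u i * ?r (df i))" by simp
  moreover have "?r (u j) = u j" if "j < Suc n" for j using hyp_restrict_low[OF hu[OF that]] .
  ultimately have "?r (g - (\<Sum>i<Suc n. u i * df i)) = 0" by simp
  then have "?l dvd g - (\<Sum>i<Suc n. u i * df i)" by (simp only: hyp_form_dvd_iff)
  then obtain g2 where g2: "g - (\<Sum>i<Suc n. u i * df i) = ?l * g2" by (elim dvdE)
  show thesis
  \<comment> \<open>The factor \<open>1\<close> brings the corrected relation into the shape of
    \<open>sum_linear\<close>.\<close>
  proof (rule that[of "\<lambda>i. 1 * L i - ?l * u i" g2])
    fix i assume i: "i < Suc n"
    have "homogeneous {..<Suc n} (1 + 0) (?l * u i)"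
      by (intro homogeneous_mult homogeneous_hyp_form hu' i)
    then show "homogeneous {..<Suc n} 1 (1 * L i - ?l * u i)"
      using L(1)[OF i] by (simp add: homogeneous_diff)
  next
    have "(\<Sum>i<Suc n. (1 * L i - ?l * u i) * df i) = ?l * (g - (\<Sum>i<Suc n. u i * df i))"
      unfolding sum_linear g by (simp add: algebra_simps)
    also have "\<dots> = ?l ^ 2 * g2" unfolding g2 by (simp add: power2_eq_square mult_ac)
    finally show "(\<Sum>i<Suc n. (1 * L i - ?l * u i) * df i) = ?l ^ 2 * g2" .
  next
    show "?r (1 * L i0 - ?l * u i0) \<noteq> 0" using i0 by simp
  qed
qed

text \<open>As for constant relations, starting from \<open>\<ell>\<^sup>2\<close>: now \<open>L'\<^sub>j = c\<^sub>j L + \<ell> w\<^sub>j\<close> with constant \<open>w\<^sub>j\<close>, and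
  the cyclic identity for the \<open>x\<^sub>i w\<^sub>j - x\<^sub>j w\<^sub>i\<close> forces \<open>w\<^sub>0 = 0\<close>.\<close>
lemma linear_syzygy_zero:
  assumes lift0: "\<And>k. 0 < k \<Longrightarrow> k \<le> e \<Longrightarrow> liftable 0 k a"
    and lift1: "\<And>k. 0 < k \<Longrightarrow> k \<le> Suc e \<Longrightarrow> liftable 1 k a"
    and L0: "\<And>i. i < Suc n \<Longrightarrow> homogeneous {..<Suc n} 1 (L0 i)" "syz a L0" and i0: "i0 < Suc n"
  shows "hyp_restrict n a (L0 i0) = 0"
proof (rule ccontr)
  let ?l = "hyp_form n a" and ?r = "hyp_restrict n a"
  assume nz: "?r (L0 i0) \<noteq> 0"
  have n3: "0 < n" "1 < n" "2 < n" using n by auto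
  have c0: "no_const_syzygy a"
    using const_syzygy_zero[of a] lift0 unfolding no_const_syzygy_def by blast
  obtain L g where hL: "\<And>i. i < Suc n \<Longrightarrow> homogeneous {..<Suc n} 1 (L i)"
    and L2: "(\<Sum>i<Suc n. L i * df i) = ?l ^ 2 * g" and Lnz: "?r (L i0) \<noteq> 0"
    using linear_syzygy_square[OF c0 lift1[of 1] L0 i0 nz] by auto
  have sL: "syz a L" unfolding syz_def L2 by simp
  have "\<exists>g. (\<Sum>i<Suc n. L i * df i) = ?l ^ (k + 2) * g" if "k \<le> e" for k
    using that
  proof (induction k)
    case 0
    then show ?case using L2 by (intro exI[of _ g]) (simp add: power2_eq_square)
  next
    case (Suc k)
    then obtain g where g: "(\<Sum>i<Suc n. L i * df i) = ?l ^ (k + 2) * g" by auto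
    have "liftable 1 (k + 2) a" using lift1[of "k + 2"] Suc.prems by simp
    have "\<forall>i<Suc n. homogeneous {..<Suc n} 1 (L i)" using hL by blast
    from liftableD[OF \<open>liftable 1 (k + 2) a\<close> this g] obtain L' g'
      where "\<forall>j<n. \<forall>i<Suc n. homogeneous {..<Suc n} 1 (L' j i)"
        "\<forall>j<n. (\<Sum>i<Suc n. L' j i * df i) =
         ?l ^ (k + 2 - 1) * (of_nat (k + 2) * var j * g + ?l * g' j)" by (elim exE conjE)
    then have hL': "\<And>j i. j < n \<Longrightarrow> i < Suc n \<Longrightarrow> homogeneous {..<Suc n} 1 (L' j i)"
      and L': "\<And>j. j < n \<Longrightarrow> (\<Sum>i<Suc n. L' j i * df i) =
         ?l ^ (k + 2 - 1) * (of_nat (k + 2) * var j * g + ?l * g' j)"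
      by blast+
    \<comment> \<open>Starting from \<open>?l ^ 2\<close> leaves a factor \<open>?l\<close> after
      differentiation, so each \<open>L' j\<close> is itself a relation on the hyperplane.\<close>
    have L': "(\<Sum>i<Suc n. L' j i * df i) = ?l * (?l ^ k * (of_nat (k + 2) * var j * g + ?l * g' j))"
      if "j < n" for j
      using L'[OF that] by (simp add: mult_ac)
    have "\<exists>c w. (\<forall>p<Suc n. homogeneous {..<Suc n} 0 (w p)) \<and>
        (\<Sum>p<Suc n. w p * df p) = ?l ^ k * (of_nat (k + 2) * var j * g + ?l * (g' j - const c * g))"
      if j: "j < n" for j
    proof -
      have "syz a (L' j)" unfolding syz_def L'[OF j] by simp
      from restricted_multiple[OF c0 hL sL i0 Lnz hL'[OF j] this] obtain q
        where "homogeneous {..<n} 0 q" "\<And>p. p < Suc n \<Longrightarrow> ?r (L' j p) = q * ?r (L p)"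
        using e by auto
      then obtain c where c: "\<And>p. p < Suc n \<Longrightarrow> ?r (L' j p) = const c * ?r (L p)"
        by (metis homogeneous_0E)
      have "\<exists>w. homogeneous {..<Suc n} 0 w \<and> L' j p = const c * L p + ?l * w" if p: "p < Suc n" for p
      proof -
        have "?r (L' j p - const c * L p) = 0" using c[OF p] by simp
        then have "?l dvd L' j p - const c * L p" by (simp only: hyp_form_dvd_iff)
        then obtain w where w: "L' j p - const c * L p = ?l * w" by (elim dvdE)
        have "homogeneous {..<Suc n} 1 (?l * w)"
          unfolding w [symmetric] by (intro homogeneous_diff homogeneous_const_mult hL hL' j p)
        then have "homogeneous {..<Suc n} 0 w"
          using homogeneous_cofactor[of "{..<Suc n}" 1 ?l w 1] homogeneous_hyp_form by simp
        then show ?thesis using w by (intro exI[of _ w]) (simp add: algebra_simps)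
      qed
      then obtain w where hw: "\<And>p. p < Suc n \<Longrightarrow> homogeneous {..<Suc n} 0 (w p)"
        and w: "\<And>p. p < Suc n \<Longrightarrow> L' j p = const c * L p + ?l * w p" by metis
      have "(\<Sum>p<Suc n. L' j p * df p) =
          const c * (\<Sum>p<Suc n. L p * df p) + ?l * (\<Sum>p<Suc n. w p * df p)"
        using w by (simp add: distrib_right sum.distrib sum_distrib_left mult.assoc)
      then have "?l * (\<Sum>p<Suc n. w p * df p) =
          ?l * (?l ^ k * (of_nat (k + 2) * var j * g + ?l * (g' j - const c * g)))"
        unfolding g L'[OF j] by (simp add: algebra_simps power2_eq_square)
      then have "(\<Sum>p<Suc n. w p * df p) =
          ?l ^ k * (of_nat (k + 2) * var j * g + ?l * (g' j - const c * g))" by simp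
      then show ?thesis using hw by (intro exI[of _ c] exI[of _ w]) blast
    qed
    then have "\<forall>j. \<exists>c w. j < n \<longrightarrow> (\<forall>p<Suc n. homogeneous {..<Suc n} 0 (w p)) \<and>
        (\<Sum>p<Suc n. w p * df p) = ?l ^ k * (of_nat (k + 2) * var j * g + ?l * (g' j - const c * g))"
      by blast
    then obtain c w where cw: "\<forall>j. j < n \<longrightarrow> (\<forall>p<Suc n. homogeneous {..<Suc n} 0 (w j p)) \<and>
        (\<Sum>p<Suc n. w j p * df p) =
          ?l ^ k * (of_nat (k + 2) * var j * g + ?l * (g' j - const (c j) * g))"
      by (simp only: choice_iff) blast
    have hw: "homogeneous {..<Suc n} 0 (w j p)" if "j < n" "p < Suc n" for j p
      using cw that by blast
    have w: "(\<Sum>p<Suc n. w j p * df p) =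
        ?l ^ k * (of_nat (k + 2) * var j * g + ?l * (g' j - const (c j) * g))" if "j < n" for j
      using cw that by blast
    have "\<forall>j p. \<exists>b. j < n \<longrightarrow> p < Suc n \<longrightarrow> w j p = const b" using hw homogeneous_0E by metis
    then obtain W where W: "\<And>j p. j < n \<Longrightarrow> p < Suc n \<Longrightarrow> w j p = const (W j p)" by metis
    define M where "M i j p = var i * w j p - var j * w i p" for i j p
    have "\<exists>q. \<forall>p<Suc n. ?r (M i j p) = const q * ?r (L p)" if ij: "i < n" "j < n" for i j
    proof -
      have hM: "homogeneous {..<Suc n} 1 (M i j p)" if "p < Suc n" for p
      proof -
        have "homogeneous {..<Suc n} (1 + 0) (M i j p)"
          unfolding M_def using that ij hw
          by (intro homogeneous_diff homogeneous_mult homogeneous_var) auto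
        then show ?thesis by simp
      qed
      have "(\<Sum>p<Suc n. M i j p * df p) = ?l * (?l ^ k *
          (var i * (g' j - const (c j) * g) - var j * (g' i - const (c i) * g)))"
        unfolding M_def sum_linear w[OF ij(1)] w[OF ij(2)] by (simp add: algebra_simps)
      then have "syz a (M i j)" by (simp add: syz_def)
      from restricted_multiple[OF c0 hL sL i0 Lnz hM this] obtain q where
        "homogeneous {..<n} 0 q" "\<And>p. p < Suc n \<Longrightarrow> ?r (M i j p) = q * ?r (L p)"
        using e by auto
      then show ?thesis by (metis homogeneous_0E)
    qed
    then obtain q where q: "\<And>i j p. i < n \<Longrightarrow> j < n \<Longrightarrow> p < Suc n \<Longrightarrow>
        ?r (M i j p) = const (q i j) * ?r (L p)" by metis
    have "(var 2 * const (q 1 0) - var 1 * const (q 2 0)) * ?r (L i0) =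
        var 2 * ?r (M 1 0 i0) - var 1 * ?r (M 2 0 i0)"
      using q n3 i0 by (simp add: algebra_simps)
    also have "\<dots> = var 0 * ?r (M 1 2 i0)" using n3 by (simp add: M_def algebra_simps)
    also have "\<dots> = var 0 * const (q 1 2) * ?r (L i0)" using q n3 i0 by simp
    finally have cyc: "var 2 * const (q 1 0) - var 1 * const (q 2 0) = (var 0 * const (q 1 2) :: nat mpoly)"
      using Lnz by simp
    \<comment> \<open>At the coordinate point of \<open>x_2\<close> the cyclic identity reduces to
      \<open>q 1 0 = 0\<close>.\<close>
    have "eval_at (\<lambda>i :: nat. if i = 2 then 1 else 0) (var 2 * const (q 1 0) - var 1 * const (q 2 0)) =
       eval_at (\<lambda>i :: nat. if i = 2 then 1 else 0) (var 0 * const (q 1 2))"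
      by (simp only: cyc)
    then have q10: "q 1 0 = 0" by simp
    have "w 0 p = 0" if p: "p < Suc n" for p
    proof -
      have "?r (M 1 0 p) = 0" using q[OF n3(2,1) p] q10 by simp
      then have "var 1 * const (W 0 p) = var 0 * (const (W 1 p) :: nat mpoly)"
        using n3 p by (simp add: M_def W)
      then have "W 0 p = 0" by (rule var_const_indep) simp
      then show ?thesis using W[OF n3(1) p] by simp
    qed
    then have "(\<Sum>p<Suc n. w 0 p * df p) = 0" by simp
    then have "of_nat (k + 2) * var 0 * g + ?l * (g' 0 - const (c 0) * g) = 0"
      unfolding w[OF n3(1)] by (simp del: of_nat_add)
    then have "?r (of_nat (k + 2) * var 0 * g + ?l * (g' 0 - const (c 0) * g)) = 0"
      by (simp only: hyp_restrict_simps)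
    then have "of_nat (k + 2) * var 0 * ?r g = 0"
      by (simp only: hyp_restrict_simps hyp_restrict_of_nat n3 mult_zero_left add_0_right)
    moreover have "(of_nat (k + 2) :: nat mpoly) \<noteq> 0" by (simp only: of_nat_eq_0_iff)
    ultimately have "?l dvd g" unfolding hyp_form_dvd_iff by (simp del: of_nat_add)
    then show ?case unfolding g by (auto elim!: dvdE simp: mult_ac)
  qed
  from this[of e] obtain g where g: "(\<Sum>i<Suc n. L i * df i) = ?l ^ (e + 2) * g" by auto
  have "homogeneous {..<Suc n} (1 + e) (?l ^ (e + 2) * g)"
    unfolding g [symmetric] using hL hom_df by (intro homogeneous_sum homogeneous_mult) auto
  then have "g = 0"
    using homogeneous_cofactor[of "{..<Suc n}" "1 + e" "?l ^ (e + 2)" g "e + 2"]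
      homogeneous_power[OF homogeneous_hyp_form[of n a], of "e + 2"] by simp
  then have "L i0 = 0" by (intro syzygy_zero[of 1 L]) (use hL g i0 e in auto)
  then show False using Lnz by simp
qed

text \<open>Finitely many pairs \<open>(m, k)\<close> with \<open>m \<le> 1\<close> and
  \<open>k \<le> m + e\<close> occur, so one \<open>a\<close> avoids the zeros of all their
  exceptional polynomials.\<close>

lemma generic_no_linear_syzygy:
  obtains a where "\<And>L i. (\<And>i. i < Suc n \<Longrightarrow> homogeneous {..<n} 1 (L i)) \<Longrightarrow>
    (\<Sum>i<Suc n. L i * hyp_restrict n a (df i)) = 0 \<Longrightarrow> i < Suc n \<Longrightarrow> L i = 0"
proof -
  have "\<forall>m k. \<exists>q. 0 < k \<and> k \<le> m + e \<longrightarrow> q \<noteq> 0 \<and> (\<forall>a. eval_at a q \<noteq> 0 \<longrightarrow> liftable m k a)"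
    using generic_liftable by blast
  then obtain q where q: "\<And>m k. 0 < k \<Longrightarrow> k \<le> m + e \<Longrightarrow> q m k \<noteq> 0"
    "\<And>m k a. 0 < k \<Longrightarrow> k \<le> m + e \<Longrightarrow> eval_at a (q m k) \<noteq> 0 \<Longrightarrow> liftable m k a" by metis
  define Q where "Q = (\<Prod>m\<in>{0, 1}. \<Prod>k\<in>{0<..m + e}. q m k)"
  have "Q \<noteq> 0" unfolding Q_def using q(1) by (auto simp: prod_zero_iff)
  then obtain a where a: "eval_at a Q \<noteq> 0" by (rule eval_nonzeroE)
  have lift: "liftable m k a" if "m \<in> {0, 1}" "0 < k" "k \<le> m + e" for m k
  proof (rule q(2)[OF that(2,3)])
    have "(\<Prod>m\<in>{0, 1}. \<Prod>k\<in>{0<..m + e}. eval_at a (q m k)) \<noteq> 0" using a by (simp add: Q_def)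
    then have "\<forall>m\<in>{0, 1}. \<forall>k\<in>{0<..m + e}. eval_at a (q m k) \<noteq> 0" by (auto simp: prod_zero_iff)
    then show "eval_at a (q m k) \<noteq> 0" using that by auto
  qed
  show thesis
  proof (rule that[of a])
    fix L i
    assume L: "\<And>i. i < Suc n \<Longrightarrow> homogeneous {..<n} 1 (L i)"
      and s: "(\<Sum>i<Suc n. L i * hyp_restrict n a (df i)) = 0" and i: "i < Suc n"
    have "hyp_restrict n a (L j) = L j" if "j < Suc n" for j using hyp_restrict_low[OF L[OF that]] .
    then have "syz a L" unfolding syz_def using s by simp
    moreover have "homogeneous {..<Suc n} 1 (L i)" if "i < Suc n" for i
      using L[OF that] by (rule homogeneous_mono) auto
    ultimately have "hyp_restrict n a (L i) = 0"
      using linear_syzygy_zero[of a L i] lift[of 0] lift[of 1] i by auto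
    then show "L i = 0" using hyp_restrict_low[OF L[OF i]] by simp
  qed
qed

end

section \<open>Algebraic dependence and independence\<close>

definition vars_in :: "'v set \<Rightarrow> 'v mpoly \<Rightarrow> bool" where
  "vars_in V p \<longleftrightarrow> (\<forall>m\<in>keys p. keys m \<subseteq> V)"

lemma eval_cong_vars:
  assumes "vars_in V p" "\<And>i. i \<in> V \<Longrightarrow> x i = y i"
  shows "peval c x p = peval c y p"
proof -
  have "mon_eval x m = mon_eval y m" if "m \<in> keys p" for m
    unfolding mon_eval_def
    by (rule prod.cong) (use assms that in \<open>auto simp: vars_in_def subset_iff\<close>)
  then show ?thesis by (simp add: peval_alt)
qed

lemma vars_in_0 [simp]: "vars_in V 0" by (simp add: vars_in_def)

lemma vars_in_const [simp]: "vars_in V (const c)" by (simp add: vars_in_def const_def)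

lemma vars_in_1 [simp]: "vars_in V 1" using vars_in_const[of V 1] by simp

lemma vars_in_var: "i \<in> V \<Longrightarrow> vars_in V (var i)" by (simp add: vars_in_def var_def)

lemma vars_in_add: "vars_in V p \<Longrightarrow> vars_in V q \<Longrightarrow> vars_in V (p + q)"
  unfolding vars_in_def using keys_add[of p q] by blast

lemma vars_in_mult:
  assumes "vars_in V p" "vars_in V q" shows "vars_in V (p * q)"
  unfolding vars_in_def
proof
  fix m assume "m \<in> keys (p * q)"
  then obtain k l where "k \<in> keys p" "l \<in> keys q" "m = k + l"
    using keys_mult_subset by blast
  then show "keys m \<subseteq> V" using assms keys_add[of k l] unfolding vars_in_def by blast
qed

lemma vars_in_sum: "(\<And>i. i \<in> A \<Longrightarrow> vars_in V (p i)) \<Longrightarrow> vars_in V (\<Sum>i\<in>A. p i)"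
  by (induction A rule: infinite_finite_induct) (simp_all add: vars_in_add)

lemma vars_in_prod: "(\<And>i. i \<in> A \<Longrightarrow> vars_in V (p i)) \<Longrightarrow> vars_in V (\<Prod>i\<in>A. p i)"
  by (induction A rule: infinite_finite_induct) (simp_all add: vars_in_mult)

lemma vars_in_power: "vars_in V p \<Longrightarrow> vars_in V (p ^ k)"
  by (induction k) (simp_all add: vars_in_mult)

lemma vars_in_subst:
  assumes "vars_in W p" "\<And>i. i \<in> W \<Longrightarrow> vars_in V (y i)"
  shows "vars_in V (peval const y p)"
  unfolding peval_alt mon_eval_def
proof (intro vars_in_sum vars_in_mult vars_in_prod vars_in_power vars_in_const)
  fix m i assume "m \<in> keys p" "i \<in> keys m"
  then have "i \<in> W" using assms(1) unfolding vars_in_def by blast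
  then show "vars_in V (y i)" by (rule assms(2))
qed

lemma homogeneous_vars_in: "homogeneous V d p \<Longrightarrow> vars_in V p"
  by (auto simp: homogeneous_iff vars_in_def)

text \<open>Irreducibility of affine space, seen on the line joining \<open>x\<close> and
  \<open>y\<close>, where both polynomials become nonzero univariate ones.\<close>

lemma eval_common_nonzero:
  assumes "eval_at x p \<noteq> 0" "eval_at y q \<noteq> 0"
  shows "\<exists>z. eval_at z p \<noteq> 0 \<and> eval_at z q \<noteq> 0"
proof -
  obtain P where P: "\<And>t. eval_at (\<lambda>i. x i + t * (y i - x i)) p = poly P t"
    using eval_along_line[of x "\<lambda>i. y i - x i" p] by blast
  obtain Q where Q: "\<And>t. eval_at (\<lambda>i. x i + t * (y i - x i)) q = poly Q t"
    using eval_along_line[of x "\<lambda>i. y i - x i" q] by blast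
  have "poly P 0 \<noteq> 0" using P[of 0] assms by simp
  moreover have "poly Q 1 \<noteq> 0" using Q[of 1] assms by simp
  ultimately have "P * Q \<noteq> 0" by auto
  then obtain t where "poly (P * Q) t \<noteq> 0" using poly_all_0_iff_0 by blast
  then show ?thesis using P[of t] Q[of t] by (intro exI[of _ "\<lambda>i. x i + t * (y i - x i)"]) auto
qed

lemma eval_prod_nonzero:
  assumes "finite A" "\<And>i. i \<in> A \<Longrightarrow> \<exists>x. eval_at x (p i) \<noteq> 0"
  shows "\<exists>x. eval_at x (\<Prod>i\<in>A. p i) \<noteq> 0"
  using assms
proof (induction A rule: finite_induct)
  case (insert i A)
  then obtain x y where "eval_at x (p i) \<noteq> 0" "eval_at y (\<Prod>i\<in>A. p i) \<noteq> 0" by blast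
  then obtain z where "eval_at z (p i) \<noteq> 0" "eval_at z (\<Prod>i\<in>A. p i) \<noteq> 0"
    using eval_common_nonzero by blast
  then show ?case using insert.hyps by (intro exI[of _ z]) simp
qed simp

lemma card_bounded_monomials:
  assumes "finite V"
  shows "card {m. keys m \<subseteq> V \<and> (\<forall>i\<in>V. lookup m i < D)} = D ^ card V" (is "card ?M = _")
proof (rule antisym[OF finite_bounded_monomials(2)[OF assms]])
  let ?r = "\<lambda>m. restrict (lookup m) V"
  have "PiE V (\<lambda>_. {..<D}) \<subseteq> ?r ` ?M"
  proof
    fix g assume g: "g \<in> PiE V (\<lambda>_. {..<D})"
    define m where "m = (\<Sum>i\<in>V. single i (g i))"
    have l: "lookup m i = (if i \<in> V then g i else 0)" for i
      using assms by (simp add: m_def lookup_sum lookup_single when_def)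
    then have "m \<in> ?M" using g by (auto simp: in_keys_iff PiE_def split: if_splits)
    moreover have "?r m = g" using g l by (auto simp: PiE_def extensional_def restrict_def)
    ultimately show "g \<in> ?r ` ?M" by blast
  qed
  then have "card (PiE V (\<lambda>_. {..<D})) \<le> card ?M"
    using surj_card_le[OF finite_bounded_monomials(1)[OF assms]] by blast
  then show "D ^ card V \<le> card ?M" using assms by (simp add: card_PiE)
qed

text \<open>Each exponent is bounded separately, so the admissible monomials form a box, which is
  easy to count.\<close>

definition exp_bound :: "nat \<Rightarrow> 'v mpoly \<Rightarrow> bool" where
  "exp_bound D p \<longleftrightarrow> (\<forall>m\<in>keys p. \<forall>i. lookup m i \<le> D)"

lemma exp_bound_mult:
  assumes "exp_bound D p" "exp_bound D' q" shows "exp_bound (D + D') (p * q)"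
  unfolding exp_bound_def
proof
  fix m assume "m \<in> keys (p * q)"
  then obtain k l where "k \<in> keys p" "l \<in> keys q" "m = k + l"
    using keys_mult_subset by blast
  then show "\<forall>i. lookup m i \<le> D + D'"
    using assms by (auto simp: exp_bound_def lookup_add intro: add_mono)
qed

lemma exp_bound_1: "exp_bound D 1"
  by (simp add: exp_bound_def)

lemma exp_bound_power: "exp_bound D p \<Longrightarrow> exp_bound (k * D) (p ^ k)"
  by (induction k) (simp_all add: exp_bound_1 exp_bound_mult)

lemma exp_bound_prod:
  "(\<And>i. i \<in> A \<Longrightarrow> exp_bound (D i) (p i)) \<Longrightarrow> exp_bound (\<Sum>i\<in>A. D i) (\<Prod>i\<in>A. p i)"
  by (induction A rule: infinite_finite_induct) (simp_all add: exp_bound_1 exp_bound_mult)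

lemma ex_exp_bound: "\<exists>D. exp_bound D (p :: 'v mpoly)"
proof -
  have "\<exists>D. \<forall>m\<in>M. \<forall>i. lookup m i \<le> D" if "finite M" for M :: "('v \<Rightarrow>\<^sub>0 nat) set"
    using that
  proof (induction M rule: finite_induct)
    case (insert m M)
    then obtain D where D: "\<forall>m\<in>M. \<forall>i. lookup m i \<le> D" by blast
    have "lookup m i \<le> mdeg m" for i
    proof (cases "i \<in> keys m")
      case True
      then show ?thesis unfolding mdeg_def by (intro member_le_sum) auto
    qed (simp add: in_keys_iff)
    then have "\<forall>m'\<in>insert m M. \<forall>i. lookup m' i \<le> max D (mdeg m)"
      using D by (auto intro: le_max_iff_disj[THEN iffD2])
    then show ?case by blast
  qed simp
  then show ?thesis by (simp add: exp_bound_def)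
qed

text \<open>The \<open>T\<^bsup>|W|\<^esup>\<close> monomials in the \<open>p w\<close> with exponents below \<open>T\<close> lie in a space of dimension
  \<open>O(T\<^bsup>|V|\<^esup>)\<close>.\<close>
lemma algebraic_dependence:
  fixes p :: "'w \<Rightarrow> 'v mpoly"
  assumes V: "finite V" and W: "finite W" "card W = Suc (card V)"
    and p: "\<And>w. w \<in> W \<Longrightarrow> vars_in V (p w)"
  obtains R :: "'w mpoly" where "R \<noteq> 0" "vars_in W R" "peval const p R = 0"
proof -
  let ?N = "card V"
  have "\<forall>w. \<exists>d. exp_bound d (p w)" using ex_exp_bound by blast
  then obtain \<delta> where "\<And>w. exp_bound (\<delta> w) (p w)" by metis
  then have \<delta>: "exp_bound (\<Sum>w\<in>W. \<delta> w) (p w)" if "w \<in> W" for w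
    using member_le_sum[of w W \<delta>] W that unfolding exp_bound_def by (meson le_trans zero_le)
  define D where "D = (\<Sum>w\<in>W. \<delta> w)"
  \<comment> \<open>A monomial in the \<open>p w\<close> with exponents below \<open>T\<close> has
    exponents at most \<open>Suc ?N * T * D\<close>, which is less than \<open>c * T\<close>. The
    choice \<open>T > c ^ ?N\<close> gives \<open>(c * T) ^ ?N < T ^ Suc ?N\<close>, so there are
    more products than available monomials.\<close>
  define c where "c = Suc ?N * D + 1"
  define T where "T = c ^ ?N + 1"
  define A where "A = {m :: 'w \<Rightarrow>\<^sub>0 nat. keys m \<subseteq> W \<and> (\<forall>i\<in>W. lookup m i < T)}"
  define B where "B = {m :: 'v \<Rightarrow>\<^sub>0 nat. keys m \<subseteq> V \<and> (\<forall>i\<in>V. lookup m i < c * T)}"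
  have finA: "finite A" "card A = T ^ Suc ?N"
    unfolding A_def using finite_bounded_monomials(1)[OF W(1)] card_bounded_monomials[OF W(1)] W(2)
    by simp_all
  have finB: "finite B" "card B = (c * T) ^ ?N"
    unfolding B_def using finite_bounded_monomials(1)[OF V] card_bounded_monomials[OF V] by simp_all
  have "(c * T) ^ ?N = c ^ ?N * T ^ ?N" by (simp add: power_mult_distrib)
  also have "\<dots> < T * T ^ ?N" by (rule mult_strict_right_mono) (auto simp: T_def)
  finally have "card B < card A" by (simp add: finA finB)
  from linear_dependence[OF finB(1) finA(1) this, of "\<lambda>m. lookup (mon_eval p m)"]
  obtain l m0 where l: "m0 \<in> A" "l m0 \<noteq> 0"
    "\<And>b. b \<in> B \<Longrightarrow> (\<Sum>m\<in>A. l m * lookup (mon_eval p m) b) = 0" by blast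
  have inB: "b \<in> B" if m: "m \<in> A" and b: "b \<in> keys (mon_eval p m)" for m b
  proof -
    have mW: "keys m \<subseteq> W" "\<And>i. i \<in> W \<Longrightarrow> lookup m i < T" using m by (auto simp: A_def)
    have me: "mon_eval p m = (\<Prod>w\<in>W. p w ^ lookup m w)"
      using mW W by (intro mon_eval_superset)
    have "vars_in V (mon_eval p m)"
      unfolding me by (intro vars_in_prod vars_in_power p)
    then have bV: "keys b \<subseteq> V" using b by (auto simp: vars_in_def)
    have "exp_bound (\<Sum>w\<in>W. lookup m w * D) (mon_eval p m)"
      unfolding me D_def by (intro exp_bound_prod exp_bound_power \<delta>)
    then have b1: "lookup b i \<le> (\<Sum>w\<in>W. lookup m w * D)" for i
      using b by (auto simp: exp_bound_def)
    have b2: "(\<Sum>w\<in>W. lookup m w * D) \<le> (\<Sum>w\<in>W. T * D)"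
      using mW by (intro sum_mono mult_right_mono) (auto intro: less_imp_le)
    have "(\<Sum>w\<in>W. T * D) < c * T"
      by (simp add: W c_def T_def algebra_simps)
    then have "lookup b i < c * T" for i using b1[of i] b2 by linarith
    then show ?thesis unfolding B_def using bV by simp
  qed
  define R where "R = (\<Sum>m\<in>A. single m (l m))"
  have lR: "lookup R m = (if m \<in> A then l m else 0)" for m
    using finA by (simp add: R_def lookup_sum lookup_single when_def)
  show thesis
  proof
    show "R \<noteq> 0" using lR[of m0] l by auto
    show "vars_in W R"
      unfolding vars_in_def
    proof
      fix m assume "m \<in> keys R"
      then have "m \<in> A" using lR[of m] by (auto simp: in_keys_iff split: if_splits)
      then show "keys m \<subseteq> W" by (simp add: A_def)
    qed
    have "peval const p R = (\<Sum>m\<in>A. const (l m) * mon_eval p m)"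
      by (simp add: R_def peval_single)
    also have "\<dots> = 0"
    proof (rule poly_mapping_eqI)
      fix b
      have "lookup (\<Sum>m\<in>A. const (l m) * mon_eval p m) b = (\<Sum>m\<in>A. l m * lookup (mon_eval p m) b)"
        by (simp add: lookup_sum lookup_const_mult)
      also have "\<dots> = 0"
      proof (cases "b \<in> B")
        case False
        then have "lookup (mon_eval p m) b = 0" if "m \<in> A" for m
          using inB[OF that] by (auto simp: in_keys_iff)
        then show ?thesis by simp
      qed (rule l)
      finally show "lookup (\<Sum>m\<in>A. const (l m) * mon_eval p m) b = lookup 0 b" by simp
    qed
    finally show "peval const p R = 0" .
  qed
qed

text \<open>If the differential of \<open>\<mu>\<close> at \<open>b\<close> is onto, the lowest homogeneous part of a relation
  expanded at \<open>\<mu> b\<close> vanishes identically.\<close>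
lemma algebraic_independence:
  fixes \<mu> :: "'w \<Rightarrow> 'v mpoly"
  assumes R: "vars_in W R" and rel: "\<And>z. eval_at (\<lambda>w. eval_at z (\<mu> w)) R = 0"
    and onto: "\<And>v. \<exists>u. \<forall>w\<in>W. ((\<lambda>t. eval_at (\<lambda>i. b i + t * u i) (\<mu> w)) has_field_derivative v w) (at 0)"
  shows "R = 0"
proof (rule ccontr)
  assume "R \<noteq> 0"
  define M where "M w = eval_at b (\<mu> w)" for w
  define R' where "R' = peval const (\<lambda>w. var w + const (M w)) R"
  have "peval const (\<lambda>w. var w - const (M w)) R' = R"
    unfolding R'_def by (simp add: peval_peval)
  then have "R' \<noteq> 0" using \<open>R \<noteq> 0\<close> by auto
  define k where "k = Min (mdeg ` keys R')"
  have ne: "keys R' \<noteq> {}" using \<open>R' \<noteq> 0\<close> by simp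
  have k: "k \<le> mdeg m" if "m \<in> keys R'" for m unfolding k_def using that by simp
  have "k \<in> mdeg ` keys R'" unfolding k_def using ne by (intro Min_in) auto
  then obtain m0 where m0: "m0 \<in> keys R'" "mdeg m0 = k" by auto
  have "(\<Sum>m\<in>{m \<in> keys R'. mdeg m = k}. lookup R' m * mon_eval v m) = 0" for v
  proof -
    obtain u where u: "\<And>w. w \<in> W \<Longrightarrow>
        ((\<lambda>t. eval_at (\<lambda>i. b i + t * u i) (\<mu> w)) has_field_derivative v w) (at 0)"
      using onto by blast
    \<comment> \<open>\<open>H\<close> is the difference quotient of \<open>\<mu> w\<close> along
      the line. Outside \<open>W\<close> it is the constant \<open>v w\<close>, so that setting
      \<open>t = 0\<close> gives \<open>v\<close> in every coordinate.\<close>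
    have "\<exists>H. poly H 0 = v w \<and> (w \<in> W \<longrightarrow> (\<forall>t. eval_at (\<lambda>i. b i + t * u i) (\<mu> w) = M w + t * poly H t))" for w
    proof (cases "w \<in> W")
      case True
      obtain q where q: "\<And>t. eval_at (\<lambda>i. b i + t * u i) (\<mu> w) = poly q t"
        using eval_along_line[of b u "\<mu> w"] by blast
      obtain c H where cH: "q = pCons c H" by (cases q)
      have "c = M w" using q[of 0] by (simp add: cH M_def)
      moreover have "(poly q has_field_derivative v w) (at 0)" using u[OF True] by (simp add: q)
      then have "poly (pderiv q) 0 = v w" using poly_DERIV DERIV_unique by blast
      then have "poly H 0 = v w" by (simp add: cH pderiv_pCons)
      ultimately show ?thesis using q cH by (intro exI[of _ H]) simp
    next
      case False
      then show ?thesis by (intro exI[of _ "[:v w:]"]) simp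
    qed
    then obtain H where H: "\<And>w. poly (H w) 0 = v w"
      "\<And>w t. w \<in> W \<Longrightarrow> eval_at (\<lambda>i. b i + t * u i) (\<mu> w) = M w + t * poly (H w) t" by metis
    \<comment> \<open>The quotient of \<open>R'(t H(t))\<close> by \<open>t^k\<close>; its value at
      0 is the lowest homogeneous part at \<open>v\<close>.\<close>
    define Z where "Z = (\<Sum>m\<in>keys R'. smult (lookup R' m) ([:0, 1:] ^ (mdeg m - k) * mon_eval H m))"
    have pm: "poly (mon_eval H m) t = mon_eval (\<lambda>w. poly (H w) t) m" for m t
      by (simp add: mon_eval_def poly_prod)
    have "poly ([:0, 1:] ^ k * Z) t = 0" for t
    proof -
      have "poly ([:0, 1:] ^ k * Z) t =
          (\<Sum>m\<in>keys R'. t ^ k * (lookup R' m * (t ^ (mdeg m - k) * mon_eval (\<lambda>w. poly (H w) t) m)))"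
        by (simp add: Z_def poly_sum pm sum_distrib_left mult.left_commute)
      also have "\<dots> = (\<Sum>m\<in>keys R'. lookup R' m * mon_eval (\<lambda>w. t * poly (H w) t) m)"
      proof (rule sum.cong)
        fix m assume "m \<in> keys R'"
        then have "t ^ mdeg m = t ^ k * t ^ (mdeg m - k)" using k by (simp flip: power_add)
        then show "t ^ k * (lookup R' m * (t ^ (mdeg m - k) * mon_eval (\<lambda>w. poly (H w) t) m)) =
            lookup R' m * mon_eval (\<lambda>w. t * poly (H w) t) m"
          by (simp add: mon_eval_scale mult_ac)
      qed simp
      also have "\<dots> = eval_at (\<lambda>w. t * poly (H w) t) R'" by (simp add: peval_alt)
      also have "\<dots> = eval_at (\<lambda>w. t * poly (H w) t + M w) R"
        by (simp add: R'_def peval_peval)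
      also have "\<dots> = eval_at (\<lambda>w. eval_at (\<lambda>i. b i + t * u i) (\<mu> w)) R"
        by (rule eval_cong_vars[OF R]) (simp add: H)
      finally show ?thesis using rel by simp
    qed
    then have "[:0, 1:] ^ k * Z = 0" using poly_all_0_iff_0 by blast
    then have "Z = 0" by simp
    then have "0 = poly Z 0" by simp
    also have "\<dots> = (\<Sum>m\<in>keys R'. lookup R' m * (0 ^ (mdeg m - k) * mon_eval v m))"
      by (simp add: Z_def poly_sum pm H)
    also have "\<dots> = (\<Sum>m\<in>{m \<in> keys R'. mdeg m = k}. lookup R' m * mon_eval v m)"
      by (rule sum.mono_neutral_cong_right) (use k in \<open>auto simp: power_0_left le_antisym\<close>)
    finally show ?thesis by simp
  qed
  then have "lookup R' m0 = 0"
    using monomials_independent[of "{m \<in> keys R'. mdeg m = k}" "lookup R'" m0] m0 by simp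
  then show False using m0 by (simp add: in_keys_iff)
qed

section \<open>Forms with finitely many linear preimages\<close>

text \<open>Polynomiality of a function of forms, asked for on forms of degree \<open>d\<close>. The
  functions in question are built from values at points, and the polynomial in the coefficients is
  found afterwards.\<close>

definition form_poly :: "nat \<Rightarrow> nat \<Rightarrow> (nat mpoly \<Rightarrow> complex) \<Rightarrow> bool" where
  "form_poly n d Q \<longleftrightarrow> (\<exists>P. vars_in (monomials {..<n} d) P \<and>
     (\<forall>F. homogeneous {..<n} d F \<longrightarrow> Q F = eval_at (lookup F) P))"

lemma form_poly_const: "form_poly n d (\<lambda>F. c)"
  unfolding form_poly_def by (rule exI[of _ "const c"]) simp

lemma form_poly_mult:
  assumes "form_poly n d Q" "form_poly n d Q'" shows "form_poly n d (\<lambda>F. Q F * Q' F)"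
proof -
  obtain P P' where "vars_in (monomials {..<n} d) P" "vars_in (monomials {..<n} d) P'"
    "\<forall>F. homogeneous {..<n} d F \<longrightarrow> Q F = eval_at (lookup F) P"
    "\<forall>F. homogeneous {..<n} d F \<longrightarrow> Q' F = eval_at (lookup F) P'"
    using assms unfolding form_poly_def by blast
  then show ?thesis unfolding form_poly_def by (intro exI[of _ "P * P'"]) (simp add: vars_in_mult)
qed

lemma form_poly_subst:
  assumes "\<And>w. form_poly n d (q w)"
  shows "form_poly n d (\<lambda>F. eval_at (\<lambda>w. q w F) R)"
proof -
  obtain P where P: "\<And>w. vars_in (monomials {..<n} d) (P w)"
    "\<And>w F. homogeneous {..<n} d F \<Longrightarrow> q w F = eval_at (lookup F) (P w)"
    using assms unfolding form_poly_def by metis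
  have "vars_in (monomials {..<n} d) (peval const P R)"
    by (rule vars_in_subst[where W = UNIV]) (simp_all add: P vars_in_def[of UNIV])
  then show ?thesis
    unfolding form_poly_def using P(2) by (intro exI[of _ "peval const P R"]) (simp add: peval_peval)
qed

lemma form_poly_prod:
  "(\<And>i. i \<in> A \<Longrightarrow> form_poly n d (Q i)) \<Longrightarrow> form_poly n d (\<lambda>F. \<Prod>i\<in>A. Q i F)"
  by (induction A rule: infinite_finite_induct) (simp_all add: form_poly_const form_poly_mult)

lemma form_poly_functional:
  assumes "fin_functional L"
  shows "form_poly n d (\<lambda>F. L (\<lambda>y. eval_at y F))"
proof -
  obtain X w where L: "finite X" "\<And>F. L F = (\<Sum>x\<in>X. w x * F x)"
    using assms by (auto simp: fin_functional_def)
  define P where "P = (\<Sum>x\<in>X. const (w x) * (\<Sum>m\<in>monomials {..<n} d. var m * const (mon_eval x m)))"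
  have "vars_in (monomials {..<n} d) P"
    unfolding P_def by (intro vars_in_sum vars_in_mult vars_in_const vars_in_var)
  moreover have "L (\<lambda>y. eval_at y F) = eval_at (lookup F) P" if "homogeneous {..<n} d F" for F
    by (simp add: L P_def eval_homogeneous[OF that finite_lessThan])
  ultimately show ?thesis unfolding form_poly_def by blast
qed

lemma fin_functional_derivative:
  assumes L: "fin_functional L"
    and G: "\<And>y. ((\<lambda>t. G y t) has_field_derivative D y) (at t0)"
  shows "((\<lambda>t. L (\<lambda>y. G y t)) has_field_derivative L D) (at t0)"
proof -
  obtain X w where L: "finite X" "\<And>F. L F = (\<Sum>x\<in>X. w x * F x)"
    using L by (auto simp: fin_functional_def)
  show ?thesis unfolding L by (intro DERIV_sum DERIV_cmult G)
qed

text \<open>Here the point \<open>y\<close> is fixed and the matrix entries \<open>z (i, j)\<close>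
  are the unknowns.\<close>

definition section_at :: "nat \<Rightarrow> nat mpoly \<Rightarrow> (nat \<Rightarrow> complex) \<Rightarrow> (nat \<times> nat) mpoly" where
  "section_at n f y = peval const (\<lambda>i. \<Sum>j<n. var (i, j) * const (y j)) f"

lemma eval_section_at: "eval_at z (section_at n f y) = eval_at (\<lambda>i. \<Sum>j<n. z (i, j) * y j) f"
  by (simp add: section_at_def peval_peval)

lemma eval_pullback_mat:
  assumes "homogeneous {..<N} d f"
  shows "eval_at y (pullback (mat N n z) f) = eval_at (\<lambda>i. \<Sum>j<n. z (i, j) * y j) f"
  unfolding eval_pullback by (rule eval_cong[OF assms]) auto

lemma functional_section_at:
  assumes L: "fin_functional L" and f: "homogeneous {..<N} d f"
  shows "\<exists>p. vars_in ({..<N} \<times> {..<n}) p \<and> (\<forall>z. eval_at z p = L (\<lambda>y. eval_at z (section_at n f y)))"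
proof -
  obtain X w where L: "finite X" "\<And>F. L F = (\<Sum>x\<in>X. w x * F x)"
    using L by (auto simp: fin_functional_def)
  have "vars_in ({..<N} \<times> {..<n}) (\<Sum>x\<in>X. const (w x) * section_at n f x)"
    unfolding section_at_def
    by (intro vars_in_sum vars_in_mult vars_in_const vars_in_subst[OF homogeneous_vars_in[OF f]]
        vars_in_var) auto
  then show ?thesis by (intro exI[of _ "\<Sum>x\<in>X. const (w x) * section_at n f x"]) (simp add: L)
qed

text \<open>Polynomials in the variables \<open>None\<close> and \<open>Some w\<close> are regarded as polynomials in \<open>None\<close>.\<close>
definition none_coeff :: "nat \<Rightarrow> 'w option mpoly \<Rightarrow> 'w mpoly" where
  "none_coeff k R = (\<Sum>m\<in>{m \<in> keys R. lookup m None = k}.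
     single (Poly_Mapping.map_key Some m) (lookup R m))"

lemma lookup_map_key_Some: "lookup (Poly_Mapping.map_key Some m) w = lookup m (Some w)"
  by (simp add: map_key.rep_eq)

lemma none_coeff_nonzero:
  assumes "m0 \<in> keys R"
  shows "none_coeff (lookup m0 None) R \<noteq> 0"
proof -
  have inj: "m = m'" if "Poly_Mapping.map_key Some m = Poly_Mapping.map_key Some m'"
      "lookup m None = lookup m' None" for m m' :: "'a option \<Rightarrow>\<^sub>0 nat"
  proof (rule poly_mapping_eqI)
    fix w show "lookup m w = lookup m' w"
    proof (cases w)
      case (Some v)
      then show ?thesis
        using arg_cong[OF that(1), of "\<lambda>p. lookup p v"] by (simp add: lookup_map_key_Some)
    qed (simp add: that)
  qed
  let ?A = "{m \<in> keys R. lookup m None = lookup m0 None}"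
  have "lookup (none_coeff (lookup m0 None) R) (Poly_Mapping.map_key Some m0) =
      (\<Sum>m\<in>?A. if m = m0 then lookup R m else 0)"
    unfolding none_coeff_def lookup_sum
    by (rule sum.cong) (auto simp: lookup_single when_def dest: inj)
  also have "\<dots> = lookup R m0" using assms by simp
  finally show ?thesis using assms by (auto simp: in_keys_iff)
qed

lemma vars_in_none_coeff:
  assumes "vars_in (insert None (Some ` E)) R"
  shows "vars_in E (none_coeff k R)"
  unfolding none_coeff_def
proof (rule vars_in_sum)
  fix m assume "m \<in> {m \<in> keys R. lookup m None = k}"
  then have "keys m \<subseteq> insert None (Some ` E)" using assms by (auto simp: vars_in_def)
  moreover have "w \<in> keys (Poly_Mapping.map_key Some m) \<Longrightarrow> Some w \<in> keys m" for w
    by (simp add: in_keys_iff lookup_map_key_Some)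
  ultimately have "keys (Poly_Mapping.map_key Some m) \<subseteq> E" by fastforce
  then show "vars_in E (single (Poly_Mapping.map_key Some m) (lookup R m))" by (simp add: vars_in_def)
qed

lemma mon_eval_option:
  "mon_eval (case_option x s) m = x ^ lookup m None * mon_eval s (Poly_Mapping.map_key Some m)"
proof -
  let ?B = "{w. Some w \<in> keys m}"
  have fin: "finite ?B" by (rule finite_vimageI[of "keys m" Some, unfolded vimage_def]) auto
  have "keys m \<subseteq> insert None (Some ` ?B)"
  proof
    fix w assume "w \<in> keys m" then show "w \<in> insert None (Some ` ?B)" by (cases w) auto
  qed
  then have "mon_eval (case_option x s) m =
      (\<Prod>w\<in>insert None (Some ` ?B). case_option x s w ^ lookup m w)"
    using fin by (intro mon_eval_superset) auto
  also have "\<dots> = x ^ lookup m None * (\<Prod>w\<in>?B. s w ^ lookup m (Some w))"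
    using fin by (simp add: prod.reindex)
  also have "(\<Prod>w\<in>?B. s w ^ lookup m (Some w)) = mon_eval s (Poly_Mapping.map_key Some m)"
    using fin by (subst mon_eval_superset[of ?B]) (auto simp: in_keys_iff lookup_map_key_Some)
  finally show ?thesis .
qed

lemma peval_option:
  assumes "coeff_hom c"
  shows "peval c (case_option x s) R =
    (\<Sum>k\<in>(\<lambda>m. lookup m None) ` keys R. x ^ k * peval c s (none_coeff k R))"
proof -
  have "peval c (case_option x s) R = (\<Sum>k\<in>(\<lambda>m. lookup m None) ` keys R.
      \<Sum>m\<in>{m \<in> keys R. lookup m None = k}. c (lookup R m) * mon_eval (case_option x s) m)"
    unfolding peval_alt by (rule sum.group [symmetric]) auto
  also have "\<dots> = (\<Sum>k\<in>(\<lambda>m. lookup m None) ` keys R. x ^ k * peval c s (none_coeff k R))"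
    by (rule sum.cong)
       (auto simp: none_coeff_def peval_sum[OF assms] peval_single[OF assms] mon_eval_option
          sum_distrib_left mult_ac intro!: sum.cong)
  finally show ?thesis .
qed

lemma finite_roots_option:
  fixes R :: "'w option mpoly"
  assumes "R \<noteq> 0" and R: "vars_in (insert None (Some ` E)) R"
  obtains S :: "'w mpoly" where "S \<noteq> 0" "vars_in E S"
    "\<And>s. eval_at s S \<noteq> 0 \<Longrightarrow> finite {x. eval_at (case_option x s) R = 0}"
proof -
  obtain m0 where m0: "m0 \<in> keys R" using assms(1) by (metis keys_eq_empty ex_in_conv)
  define K where "K = lookup m0 None"
  show thesis
  proof
    show "none_coeff K R \<noteq> 0" unfolding K_def using m0 by (rule none_coeff_nonzero)
    show "vars_in E (none_coeff K R)" using R by (rule vars_in_none_coeff)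
    fix s :: "'w \<Rightarrow> complex" assume s: "eval_at s (none_coeff K R) \<noteq> 0"
    define P where "P = (\<Sum>k\<in>(\<lambda>m. lookup m None) ` keys R. monom (eval_at s (none_coeff k R)) k)"
    have "coeff P K = (\<Sum>k\<in>(\<lambda>m. lookup m None) ` keys R. if k = K then eval_at s (none_coeff K R) else 0)"
      unfolding P_def coeff_sum by (rule sum.cong) auto
    also have "\<dots> = eval_at s (none_coeff K R)" using m0 by (simp add: K_def)
    finally have "P \<noteq> 0" using s by auto
    moreover have "eval_at (case_option x s) R = poly P x" for x
      by (simp add: P_def peval_option poly_sum poly_monom mult.commute)
    ultimately show "finite {x. eval_at (case_option x s) R = 0}"
      using poly_roots_finite by simp
  qed
qed

section \<open>Algebraic equations for the entries of a matrix with given section\<close>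

context smooth_form
begin

text \<open>At the matrix \<open>b\<close> of a generic hyperplane the differential of
  \<open>B \<mapsto> f(B y)\<close> is injective. Functionals dual to its columns yield as many
  functions \<open>\<mu>\<close> of the section as there are entries, with the identity as
  differential at \<open>b\<close>. Each entry is then algebraic over the \<open>\<mu>\<close>, and
  \<open>Q\<close> is the product of the coefficients that must not vanish.\<close>

lemma finite_preimages:
  obtains Q where "form_poly n (Suc e) Q" "\<exists>z. Q (pullback (mat (Suc n) n z) f) \<noteq> 0"
    "\<And>F. homogeneous {..<n} (Suc e) F \<Longrightarrow> Q F \<noteq> 0 \<Longrightarrow>
       finite {B \<in> carrier_mat (Suc n) n. pullback B f = F}"
proof -
  obtain a where a: "\<And>L i. (\<And>i. i < Suc n \<Longrightarrow> homogeneous {..<n} 1 (L i)) \<Longrightarrow>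
    (\<Sum>i<Suc n. L i * hyp_restrict n a (df i)) = 0 \<Longrightarrow> i < Suc n \<Longrightarrow> L i = 0"
    using generic_no_linear_syzygy by blast
  define E where "E = {..<Suc n} \<times> {..<n}"
  have finE: "finite E" by (simp add: E_def)
  define b where "b = (\<lambda>(i, j). if i = n then a j else if i = j then 1 else 0 :: complex)"
  define bx where "bx y = (\<lambda>i. \<Sum>j<n. b (i, j) * y j)" for y
  have bx: "bx y i = (if i = n then \<Sum>j<n. a j * y j else y i)" if "i < Suc n" for y i
  proof (cases "i = n")
    case False
    then have "bx y i = (\<Sum>j<n. if j = i then y i else 0)"
      unfolding bx_def b_def by (intro sum.cong) auto
    then show ?thesis using False that by simp
  qed (simp add: bx_def b_def)
  have hyp: "eval_at y (hyp_restrict n a (df i)) = eval_at (bx y) (df i)" for y i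
    unfolding hyp_restrict_def peval_peval[OF coeff_hom_id]
    by (rule eval_cong[OF hom_df]) (simp add: bx)
  \<comment> \<open>The derivative of \<open>f(b y)\<close> with respect to the entry
    \<open>(i, j)\<close>. A linear relation between these functions is a linear syzygy on the
    hyperplane.\<close>
  define T where "T z y = (case z of (i, j) \<Rightarrow> y j * eval_at (bx y) (df i))" for z y
  have sumE: "(\<Sum>z\<in>E. h z) = (\<Sum>i<Suc n. \<Sum>j<n. h (i, j))" for h :: "_ \<Rightarrow> complex"
    by (simp add: E_def sum.cartesian_product)
  have indep: "\<forall>z\<in>E. c z = 0" if c: "\<And>y. (\<Sum>z\<in>E. c z * T z y) = 0" for c
  proof -
    define L where "L i = (\<Sum>j<n. const (c (i, j)) * var j)" for i
    have hL: "homogeneous {..<n} 1 (L i)" for i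
      unfolding L_def by (intro homogeneous_sum homogeneous_const_mult homogeneous_var)
    have "(\<Sum>i<Suc n. L i * hyp_restrict n a (df i)) = 0"
    proof (rule mpoly_eq_0I)
      fix y
      have "eval_at y (\<Sum>i<Suc n. L i * hyp_restrict n a (df i)) = (\<Sum>z\<in>E. c z * T z y)"
        unfolding sumE by (simp add: L_def hyp T_def sum_distrib_right mult.assoc)
      then show "eval_at y (\<Sum>i<Suc n. L i * hyp_restrict n a (df i)) = 0" by (simp add: c)
    qed
    then have L0: "L i = 0" if "i < Suc n" for i using a[of L i] hL that by blast
    have "c (i, j) = 0" if "i < Suc n" "j < n" for i j
    proof -
      have "eval_at (\<lambda>k. if k = j then 1 else 0) (L i) = (\<Sum>k<n. c (i, k) * (if k = j then 1 else 0))"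
        by (simp add: L_def del: mult_cancel_left)
      also have "\<dots> = (\<Sum>k<n. if k = j then c (i, j) else 0)" by (rule sum.cong) auto
      finally show ?thesis using L0 that by simp
    qed
    then show ?thesis by (auto simp: E_def)
  qed
  obtain \<Lambda> where \<Lambda>: "\<And>z. z \<in> E \<Longrightarrow> fin_functional (\<Lambda> z)"
    "\<And>z z'. z \<in> E \<Longrightarrow> z' \<in> E \<Longrightarrow> \<Lambda> z (T z') = (if z = z' then 1 else 0)"
    using dual_functionals[OF finE, of T] indep by blast
  \<comment> \<open>\<open>form_poly_subst\<close> asks for a functional at every index, hence the
    extension by zero outside \<open>E\<close>.\<close>
  define \<Lambda>' where "\<Lambda>' z = (if z \<in> E then \<Lambda> z else (\<lambda>F. 0))" for z
  have \<Lambda>': "fin_functional (\<Lambda>' z)" for z using \<Lambda> by (simp add: \<Lambda>'_def fin_functional_0)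
  have "\<forall>w. \<exists>p. vars_in E p \<and> (\<forall>z. eval_at z p = \<Lambda>' w (\<lambda>y. eval_at z (section_at n f y)))"
    unfolding E_def using functional_section_at[OF \<Lambda>' hom_f] by blast
  then obtain \<mu> where \<mu>: "\<And>w. vars_in E (\<mu> w)"
    "\<And>w z. eval_at z (\<mu> w) = \<Lambda>' w (\<lambda>y. eval_at z (section_at n f y))" by metis
  have deriv: "((\<lambda>t. eval_at (\<lambda>i. b i + t * v i) (\<mu> w)) has_field_derivative v w) (at 0)"
    if w: "w \<in> E" for v w
  proof -
    have ev: "eval_at (\<lambda>i. b i + t * v i) (section_at n f y) =
        eval_at (\<lambda>i. bx y i + t * (\<Sum>j<n. v (i, j) * y j)) f" for t y
      by (simp add: eval_section_at bx_def sum.distrib distrib_right sum_distrib_left mult.assoc)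
    have "((\<lambda>t. eval_at (\<lambda>i. b i + t * v i) (section_at n f y)) has_field_derivative
        (\<Sum>z\<in>E. v z * T z y)) (at 0)" for y
    proof -
      have "((\<lambda>t. eval_at (\<lambda>i. bx y i + t * (\<Sum>j<n. v (i, j) * y j)) f) has_field_derivative
          (\<Sum>i<Suc n. (\<Sum>j<n. v (i, j) * y j) * eval_at (bx y) (partial i f))) (at 0)"
        by (rule eval_partial_derivative) (use homogeneous_keys[OF hom_f] in auto)
      moreover have "(\<Sum>i<Suc n. (\<Sum>j<n. v (i, j) * y j) * eval_at (bx y) (partial i f)) =
          (\<Sum>z\<in>E. v z * T z y)"
        unfolding sumE by (simp add: T_def df_def sum_distrib_right mult.assoc)
      ultimately show ?thesis by (simp add: ev)
    qed
    from fin_functional_derivative[OF \<Lambda>' this]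
    have "((\<lambda>t. eval_at (\<lambda>i. b i + t * v i) (\<mu> w)) has_field_derivative
        \<Lambda>' w (\<lambda>y. \<Sum>z\<in>E. v z * T z y)) (at 0)" by (simp add: \<mu>)
    moreover have "\<Lambda>' w (\<lambda>y. \<Sum>z\<in>E. v z * T z y) = (\<Sum>z\<in>E. v z * \<Lambda>' w (T z))"
      by (rule fin_functional_linear[OF \<Lambda>'])
    moreover have "\<dots> = (\<Sum>z\<in>E. if z = w then v w else 0)"
      by (rule sum.cong) (use w in \<open>auto simp: \<Lambda>'_def \<Lambda>\<close>)
    ultimately show ?thesis using w finE by simp
  qed
  \<comment> \<open>The entry \<open>z t\<close>, placed at \<open>None\<close>, together with the
    functions \<open>\<mu> w\<close> for \<open>w\<close> in \<open>E\<close> is one polynomial more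
    than there are variables.\<close>
  have "\<exists>R. R \<noteq> 0 \<and> vars_in (insert None (Some ` E)) R \<and>
      (\<forall>z. eval_at (case_option (z t) (\<lambda>w. eval_at z (\<mu> w))) R = 0)" if t: "t \<in> E" for t
  proof -
    let ?p = "case_option (var t) \<mu>"
    have "card (insert None (Some ` E)) = Suc (card E)"
      using finE by (simp add: card_image)
    moreover have "vars_in E (?p w)" if "w \<in> insert None (Some ` E)" for w
      using t \<mu>(1) by (cases w) (auto intro: vars_in_var)
    ultimately obtain R where R: "R \<noteq> 0" "vars_in (insert None (Some ` E)) R" "peval const ?p R = 0"
      using algebraic_dependence[of E "insert None (Some ` E)" ?p] finE by auto
    have "eval_at (case_option (z t) (\<lambda>w. eval_at z (\<mu> w))) R = 0" for z
    proof -
      have "(\<lambda>w. eval_at z (?p w)) = case_option (z t) (\<lambda>w. eval_at z (\<mu> w))"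
        by (auto simp: fun_eq_iff split: option.splits)
      then show ?thesis using arg_cong[OF R(3), of "eval_at z"] by (simp add: peval_peval)
    qed
    then show ?thesis using R by blast
  qed
  then obtain R where R: "\<And>t. t \<in> E \<Longrightarrow> R t \<noteq> 0" "\<And>t. t \<in> E \<Longrightarrow> vars_in (insert None (Some ` E)) (R t)"
    "\<And>t z. t \<in> E \<Longrightarrow> eval_at (case_option (z t) (\<lambda>w. eval_at z (\<mu> w))) (R t) = 0" by metis
  have "\<exists>S. S \<noteq> 0 \<and> vars_in E S \<and> (\<forall>s. eval_at s S \<noteq> 0 \<longrightarrow> finite {x. eval_at (case_option x s) (R t) = 0})"
    if t: "t \<in> E" for t
    using finite_roots_option[OF R(1,2)[OF t]] by metis
  then obtain S where S: "\<And>t. t \<in> E \<Longrightarrow> S t \<noteq> 0" "\<And>t. t \<in> E \<Longrightarrow> vars_in E (S t)"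
    "\<And>t s. t \<in> E \<Longrightarrow> eval_at s (S t) \<noteq> 0 \<Longrightarrow> finite {x. eval_at (case_option x s) (R t) = 0}" by metis
  define Q where "Q F = (\<Prod>t\<in>E. eval_at (\<lambda>w. \<Lambda>' w (\<lambda>y. eval_at y F)) (S t))" for F
  have pb: "eval_at y (pullback (mat (Suc n) n z) f) = eval_at z (section_at n f y)" for z y
    by (simp add: eval_pullback_mat[OF hom_f] eval_section_at)
  have \<mu>pb: "\<Lambda>' w (\<lambda>y. eval_at y (pullback (mat (Suc n) n z) f)) = eval_at z (\<mu> w)" for w z
    unfolding pb \<mu>(2) ..
  show thesis
  proof
    show "form_poly n (Suc e) Q"
      unfolding Q_def by (intro form_poly_prod form_poly_subst form_poly_functional \<Lambda>')
    \<comment> \<open>The differential of the \<open>\<mu>\<close> at \<open>b\<close> is onto, so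
      they are algebraically independent and the nonzero \<open>S t\<close> cannot vanish on all of
      their values.\<close>
    have "\<exists>z. eval_at z (peval const \<mu> (S t)) \<noteq> 0" if t: "t \<in> E" for t
    proof (rule ccontr)
      assume "\<nexists>z. eval_at z (peval const \<mu> (S t)) \<noteq> 0"
      then have "eval_at (\<lambda>w. eval_at z (\<mu> w)) (S t) = 0" for z by (simp add: peval_peval)
      then have "S t = 0"
        using algebraic_independence[OF S(2)[OF t], of \<mu> b] deriv by blast
      then show False using S(1)[OF t] by simp
    qed
    then obtain z where "eval_at z (\<Prod>t\<in>E. peval const \<mu> (S t)) \<noteq> 0"
      using eval_prod_nonzero[OF finE, of "\<lambda>t. peval const \<mu> (S t)"] by blast
    then have "Q (pullback (mat (Suc n) n z) f) \<noteq> 0"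
      unfolding Q_def \<mu>pb by (simp add: peval_peval)
    then show "\<exists>z. Q (pullback (mat (Suc n) n z) f) \<noteq> 0" by blast
    fix F assume F: "homogeneous {..<n} (Suc e) F" "Q F \<noteq> 0"
    define s where "s w = \<Lambda>' w (\<lambda>y. eval_at y F)" for w
    define rt where "rt t = {x. eval_at (case_option x s) (R t) = 0}" for t
    have "finite (rt t)" if "t \<in> E" for t
    proof -
      have "eval_at s (S t) \<noteq> 0" using F(2) that finE by (auto simp: Q_def s_def [abs_def] prod_zero_iff)
      then show ?thesis unfolding rt_def using S(3)[OF that] by blast
    qed
    then have fin: "finite (PiE E rt)" using finE by (intro finite_PiE) auto
    let ?X = "{B \<in> carrier_mat (Suc n) n. pullback B f = F}"
    let ?g = "\<lambda>B. restrict (($$) B) E"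
    have "?g ` ?X \<subseteq> PiE E rt"
    proof
      fix g assume "g \<in> ?g ` ?X"
      then obtain B where B: "B \<in> carrier_mat (Suc n) n" "pullback B f = F" "g = ?g B" by blast
      have Bm: "B = mat (Suc n) n (($$) B)" using B(1) by (intro eq_matI) auto
      have "B $$ t \<in> rt t" if t: "t \<in> E" for t
      proof -
        have "F = pullback (mat (Suc n) n (($$) B)) f"
          using B(2) arg_cong[OF Bm, of "\<lambda>C. pullback C f"] by simp
        then have "s = (\<lambda>w. eval_at (($$) B) (\<mu> w))"
          unfolding s_def [abs_def] by (simp only: \<mu>pb)
        then show ?thesis using R(3)[OF t, of "($$) B"] by (simp add: rt_def)
      qed
      then show "g \<in> PiE E rt" by (auto simp: B(3))
    qed
    moreover have "inj_on ?g ?X"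
    proof (rule inj_onI)
      fix B C assume BC: "B \<in> ?X" "C \<in> ?X" and eq: "?g B = ?g C"
      show "B = C"
      proof (rule eq_matI)
        fix i j assume "i < dim_row C" "j < dim_col C"
        then have "(i, j) \<in> E" using BC by (auto simp: E_def)
        then show "B $$ (i, j) = C $$ (i, j)" using fun_cong[OF eq, of "(i, j)"] by simp
      qed (use BC in auto)
    qed
    ultimately show "finite ?X" using fin finite_imageD finite_subset by blast
  qed
qed

end

section \<open>Linear changes of coordinates\<close>

lemma pullback_pullback:
  assumes f: "homogeneous {..<dim_row B} d f" and AB: "dim_col B = dim_row A"
  shows "pullback A (pullback B f) = pullback (B * A) f"
proof (rule mpoly_eqI)
  fix y
  show "eval_at y (pullback A (pullback B f)) = eval_at y (pullback (B * A) f)"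
    unfolding eval_pullback
  proof (rule eval_cong[OF f])
    fix i assume i: "i \<in> {..<dim_row B}"
    have "(\<Sum>k<dim_col A. (B * A) $$ (i, k) * y k) =
        (\<Sum>k<dim_col A. \<Sum>j<dim_col B. B $$ (i, j) * (A $$ (j, k) * y k))"
      using i AB
      by (intro sum.cong) (auto simp: scalar_prod_def sum_distrib_right mult.assoc atLeast0LessThan)
    then show "(\<Sum>j<dim_col B. B $$ (i, j) * (\<Sum>k<dim_col A. A $$ (j, k) * y k)) =
        (\<Sum>j<dim_col (B * A). (B * A) $$ (i, j) * y j)"
      by (simp add: sum_distrib_left) (rule sum.swap)
  qed
qed

lemma pullback_const_mult: "pullback B (const c * f) = const c * pullback B f"
  by (simp add: pullback_def)

lemma pullback_smult:
  assumes f: "homogeneous {..<dim_row B} d f"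
  shows "pullback (c \<cdot>\<^sub>m B) f = const (c ^ d) * pullback B f"
proof (rule mpoly_eqI)
  fix y
  have "eval_at y (pullback (c \<cdot>\<^sub>m B) f) = eval_at (\<lambda>i. c * (\<Sum>j<dim_col B. B $$ (i, j) * y j)) f"
    unfolding eval_pullback by (rule eval_cong[OF f]) (simp add: sum_distrib_left mult.assoc)
  then show "eval_at y (pullback (c \<cdot>\<^sub>m B) f) = eval_at y (const (c ^ d) * pullback B f)"
    by (simp add: eval_scale[OF f] eval_pullback)
qed

lemma pullback_one:
  assumes f: "homogeneous {..<n} d f"
  shows "pullback (1\<^sub>m n) f = f"
proof (rule mpoly_eqI)
  fix y
  show "eval_at y (pullback (1\<^sub>m n) f) = eval_at y f"
    unfolding eval_pullback
  proof (rule eval_cong[OF f])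
    fix i assume i: "i \<in> {..<n}"
    have "(\<Sum>j<dim_col (1\<^sub>m n). 1\<^sub>m n $$ (i, j) * y j) = (\<Sum>j<n. if j = i then y i else 0)"
      using i by (intro sum.cong) auto
    then show "(\<Sum>j<dim_col (1\<^sub>m n). 1\<^sub>m n $$ (i, j) * y j) = y i" using i by simp
  qed
qed

lemma index_mult_mat_vec_sum:
  assumes "B \<in> carrier_mat N n" "y \<in> carrier_vec n" "i < N"
  shows "(B *\<^sub>v y) $ i = (\<Sum>j<n. B $$ (i, j) * y $ j)"
  using assms by (simp add: scalar_prod_def atLeast0LessThan)

lemma eval_pullback_vec:
  assumes f: "homogeneous {..<N} d f" and B: "B \<in> carrier_mat N n" and y: "y \<in> carrier_vec n"
  shows "eval_at (($) y) (pullback B f) = eval_at (($) (B *\<^sub>v y)) f"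
  unfolding eval_pullback
  by (rule eval_cong[OF f]) (use index_mult_mat_vec_sum[OF B y] B in auto)

lemma eval_partial_pullback_vec:
  assumes f: "homogeneous {..<N} d f" and B: "B \<in> carrier_mat N n" and y: "y \<in> carrier_vec n" and j: "j < n"
  shows "eval_at (($) y) (partial j (pullback B f)) =
    (\<Sum>i<N. B $$ (i, j) * eval_at (($) (B *\<^sub>v y)) (partial i f))"
proof -
  have "eval_at (\<lambda>i. \<Sum>j<dim_col B. B $$ (i, j) * y $ j) (partial i f) =
      eval_at (($) (B *\<^sub>v y)) (partial i f)" for i
    by (rule eval_cong[OF homogeneous_partial[OF f]]) (use index_mult_mat_vec_sum[OF B y] B in auto)
  then show ?thesis using eval_partial_pullback[OF f, of j B "($) y"] j B by simp
qed

lemma invertible_matE: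
  assumes "A \<in> carrier_mat n n" "invertible_mat A"
  obtains A' where "A' \<in> carrier_mat n n" "A * A' = 1\<^sub>m n" "A' * A = 1\<^sub>m n" "invertible_mat A'"
proof -
  obtain A' where A': "A * A' = 1\<^sub>m (dim_row A)" "A' * A = 1\<^sub>m (dim_row A')"
    using assms by (auto simp: invertible_mat_def inverts_mat_def)
  have "dim_col A' = n" using arg_cong[OF A'(1), of dim_col] assms by simp
  moreover have "dim_row A' = n" using arg_cong[OF A'(2), of dim_col] assms by simp
  ultimately have c: "A' \<in> carrier_mat n n" by blast
  moreover have "invertible_mat A'"
    unfolding invertible_mat_def inverts_mat_def using A' c assms by (auto simp: square_mat.simps)
  ultimately show thesis using A' assms c by (intro that[of A']) auto
qed

lemma invertible_matI:
  fixes A :: "'k::field mat"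
  assumes A: "A \<in> carrier_mat n n"
    and inj: "\<And>v. v \<in> carrier_vec n \<Longrightarrow> A *\<^sub>v v = 0\<^sub>v n \<Longrightarrow> v = 0\<^sub>v n"
  shows "invertible_mat A"
proof -
  have "det A \<noteq> 0" using det_0_iff_vec_prod_zero_field[OF A] inj by blast
  from det_non_zero_imp_unit[OF A this, of "()"]
  obtain B where "B \<in> carrier_mat n n" "B * A = 1\<^sub>m n" "A * B = 1\<^sub>m n"
    unfolding Units_def ring_mat_def by auto
  then show ?thesis using A
    unfolding invertible_mat_def inverts_mat_def by (auto simp: square_mat.simps)
qed

lemma invertible_mat_mult:
  assumes A: "A \<in> carrier_mat n n" "invertible_mat A" and B: "B \<in> carrier_mat n n" "invertible_mat B"
  shows "invertible_mat (A * B :: 'k::field mat)"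
proof (rule invertible_matI)
  show "A * B \<in> carrier_mat n n" using A B by simp
  fix v :: "'k vec" assume v: "v \<in> carrier_vec n" "(A * B) *\<^sub>v v = 0\<^sub>v n"
  obtain A' where A': "A' \<in> carrier_mat n n" "A' * A = 1\<^sub>m n" using invertible_matE[OF A] by blast
  obtain B' where B': "B' \<in> carrier_mat n n" "B' * B = 1\<^sub>m n" using invertible_matE[OF B] by blast
  have "A *\<^sub>v (B *\<^sub>v v) = 0\<^sub>v n" using v assoc_mult_mat_vec[OF A(1) B(1) v(1)] by simp
  then have "A' *\<^sub>v (A *\<^sub>v (B *\<^sub>v v)) = 0\<^sub>v n" using A' by (auto intro!: eq_vecI)
  moreover have "A' *\<^sub>v (A *\<^sub>v (B *\<^sub>v v)) = B *\<^sub>v v"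
    using assoc_mult_mat_vec[of A' n n A n "B *\<^sub>v v"] A' A B v by simp
  ultimately have "B' *\<^sub>v (B *\<^sub>v v) = 0\<^sub>v n" using B' by (auto intro!: eq_vecI)
  moreover have "B' *\<^sub>v (B *\<^sub>v v) = v"
    using assoc_mult_mat_vec[of B' n n B n v] B' B v by simp
  ultimately show "v = 0\<^sub>v n" by simp
qed

text \<open>A singular shift makes \<open>- t\<close> an eigenvalue, that is, a root of the
  characteristic polynomial.\<close>

lemma finite_singular_shift:
  fixes A :: "complex mat"
  assumes A: "A \<in> carrier_mat n n"
  shows "finite {t. \<not> invertible_mat (A + t \<cdot>\<^sub>m 1\<^sub>m n)}"
proof (rule finite_subset)
  have "char_poly A \<noteq> 0" using degree_monic_char_poly[OF A] by auto
  then show "finite (uminus ` {k. poly (char_poly A) k = 0})" using poly_roots_finite by blast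
  show "{t. \<not> invertible_mat (A + t \<cdot>\<^sub>m 1\<^sub>m n)} \<subseteq> uminus ` {k. poly (char_poly A) k = 0}"
  proof
    fix t assume "t \<in> {t. \<not> invertible_mat (A + t \<cdot>\<^sub>m 1\<^sub>m n)}"
    then have "\<not> invertible_mat (A + t \<cdot>\<^sub>m 1\<^sub>m n)" by simp
    moreover have c: "A + t \<cdot>\<^sub>m 1\<^sub>m n \<in> carrier_mat n n" using A by simp
    ultimately obtain v where v: "v \<in> carrier_vec n" "(A + t \<cdot>\<^sub>m 1\<^sub>m n) *\<^sub>v v = 0\<^sub>v n" "v \<noteq> 0\<^sub>v n"
      using invertible_matI[OF c] by blast
    have "(t \<cdot>\<^sub>m 1\<^sub>m n) *\<^sub>v v = t \<cdot>\<^sub>v v"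
      using v(1) by (intro eq_vecI) auto
    then have s: "A *\<^sub>v v + t \<cdot>\<^sub>v v = 0\<^sub>v n"
      using v add_mult_distrib_mat_vec[OF A, of "t \<cdot>\<^sub>m 1\<^sub>m n" v] by simp
    have "A *\<^sub>v v = (- t) \<cdot>\<^sub>v v"
    proof (rule eq_vecI)
      fix i assume "i < dim_vec ((- t) \<cdot>\<^sub>v v)"
      then have i: "i < n" using v by simp
      have "(A *\<^sub>v v + t \<cdot>\<^sub>v v) $ i = 0" unfolding s using i by simp
      then show "(A *\<^sub>v v) $ i = ((- t) \<cdot>\<^sub>v v) $ i"
        using i v A by (simp add: eq_neg_iff_add_eq_0)
    qed (use A v in simp)
    then have "eigenvalue A (- t)"
      unfolding eigenvalue_def eigenvector_def using v A by auto
    then have "poly (char_poly A) (- t) = 0" using eigenvalue_root_char_poly[OF A] by blast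
    then show "t \<in> uminus ` {k. poly (char_poly A) k = 0}" by (intro image_eqI[of _ _ "- t"]) auto
  qed
qed

text \<open>The gradient of the pullback at \<open>y\<close> is the transpose of \<open>A\<close>
  applied to the gradient at \<open>A y\<close>. Pairing it with column \<open>k\<close> of the
  inverse recovers the nonzero entry \<open>k\<close>.\<close>

lemma smooth_pullback:
  assumes A: "A \<in> carrier_mat n n" "invertible_mat A" and F: "homogeneous {..<n} d F"
    and smooth: "smooth_hypersurface n F"
  shows "smooth_hypersurface n (pullback A F)"
  unfolding smooth_hypersurface_def
proof (intro ballI impI, elim conjE)
  fix y assume y: "y \<in> carrier_vec n" "y \<noteq> 0\<^sub>v n" and "eval_at (($) y) (pullback A F) = 0"
  obtain A' where A': "A' \<in> carrier_mat n n" "A * A' = 1\<^sub>m n" "A' * A = 1\<^sub>m n"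
    using invertible_matE[OF A] by blast
  have Ay: "A *\<^sub>v y \<in> carrier_vec n" using A y by simp
  have "A *\<^sub>v y \<noteq> 0\<^sub>v n"
  proof
    assume "A *\<^sub>v y = 0\<^sub>v n"
    then have "A' *\<^sub>v (A *\<^sub>v y) = 0\<^sub>v n" using A' by (auto intro!: eq_vecI)
    then show False using assoc_mult_mat_vec[of A' n n A n y] A A' y by simp
  qed
  moreover have "eval_at (($) (A *\<^sub>v y)) F = 0"
    using eval_pullback_vec[OF F A(1) y(1)] \<open>eval_at (($) y) (pullback A F) = 0\<close> by simp
  ultimately obtain k where k: "k < n" "eval_at (($) (A *\<^sub>v y)) (partial k F) \<noteq> 0"
    using smooth Ay unfolding smooth_hypersurface_def by blast
  define g where "g i = eval_at (($) (A *\<^sub>v y)) (partial i F)" for i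
  show "\<exists>j<n. eval_at (($) y) (partial j (pullback A F)) \<noteq> 0"
  proof (rule ccontr)
    assume "\<not> (\<exists>j<n. eval_at (($) y) (partial j (pullback A F)) \<noteq> 0)"
    then have z: "(\<Sum>i<n. A $$ (i, j) * g i) = 0" if "j < n" for j
      using eval_partial_pullback_vec[OF F A(1) y(1) that] that by (simp add: g_def)
    have AA: "(\<Sum>j<n. A $$ (i, j) * A' $$ (j, k)) = (if i = k then 1 else 0)" if "i < n" for i
    proof -
      have "(A * A') $$ (i, k) = (\<Sum>j<n. A $$ (i, j) * A' $$ (j, k))"
        using A(1) A'(1) that k(1) by (simp add: scalar_prod_def atLeast0LessThan)
      moreover have "1\<^sub>m n $$ (i, k) = (if i = k then 1 else 0 :: complex)" using that k by simp
      ultimately show ?thesis unfolding A'(2) by metis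
    qed
    have "0 = (\<Sum>j<n. (\<Sum>i<n. A $$ (i, j) * g i) * A' $$ (j, k))" using z by simp
    also have "\<dots> = (\<Sum>i<n. (\<Sum>j<n. A $$ (i, j) * A' $$ (j, k)) * g i)"
      unfolding sum_distrib_right by (subst sum.swap) (simp add: mult_ac)
    also have "\<dots> = (\<Sum>i<n. if i = k then g k else 0)"
      by (rule sum.cong) (auto simp: AA)
    also have "\<dots> = g k" using k by simp
    finally show False using k by (simp add: g_def)
  qed
qed

section \<open>Generic hyperplane sections are smooth\<close>

definition hyp_mat :: "nat \<Rightarrow> (nat \<Rightarrow> complex) \<Rightarrow> complex mat" where
  "hyp_mat n a = mat (Suc n) n (\<lambda>(i, j). if i = n then a j else if i = j then 1 else 0)"

lemma hyp_mat_carrier [simp]: "hyp_mat n a \<in> carrier_mat (Suc n) n"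
  by (simp add: hyp_mat_def)

lemma hyp_mat_mult_vec:
  assumes "y \<in> carrier_vec n" "i < Suc n"
  shows "(hyp_mat n a *\<^sub>v y) $ i = (if i = n then \<Sum>j<n. a j * y $ j else y $ i)"
proof (cases "i = n")
  case False
  have "(hyp_mat n a *\<^sub>v y) $ i = (\<Sum>j<n. if j = i then y $ i else 0)"
    unfolding index_mult_mat_vec_sum[OF hyp_mat_carrier assms]
    by (rule sum.cong) (use assms False in \<open>auto simp: hyp_mat_def\<close>)
  then show ?thesis using False assms by simp
next
  case True
  then show ?thesis
    unfolding index_mult_mat_vec_sum[OF hyp_mat_carrier assms] by (simp add: hyp_mat_def)
qed

lemma hyp_mat_bij:
  "bij_betw (\<lambda>y. hyp_mat n a *\<^sub>v y) (carrier_vec n)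
     {x \<in> carrier_vec (Suc n). vec (Suc n) (\<lambda>i. if i = n then -1 else a i) \<bullet> x = 0}"
  (is "bij_betw ?f _ ?H")
proof -
  have sp: "vec (Suc n) (\<lambda>i. if i = n then -1 else a i) \<bullet> x = (\<Sum>j<n. a j * x $ j) - x $ n"
    if "x \<in> carrier_vec (Suc n)" for x
    using that by (simp add: scalar_prod_def atLeast0LessThan sum.lessThan_Suc)
  have fc: "?f y \<in> carrier_vec (Suc n)" if "y \<in> carrier_vec n" for y
    by (rule mult_mat_vec_carrier[OF hyp_mat_carrier that])
  show ?thesis
  proof (rule bij_betw_byWitness[where f' = "\<lambda>x. vec n (($) x)"])
    show "\<forall>y\<in>carrier_vec n. vec n (($) (?f y)) = y"
      by (auto intro!: eq_vecI simp: hyp_mat_mult_vec simp del: index_mult_mat_vec)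
    show "\<forall>x\<in>?H. ?f (vec n (($) x)) = x"
    proof
      fix x assume x: "x \<in> ?H"
      show "?f (vec n (($) x)) = x"
      proof (rule eq_vecI)
        fix i assume "i < dim_vec x"
        then have i: "i < Suc n" using x by auto
        have "(\<Sum>j<n. a j * vec n (($) x) $ j) = x $ n" using sp[of x] x by simp
        then show "?f (vec n (($) x)) $ i = x $ i"
          using hyp_mat_mult_vec[of "vec n (($) x)" n i a] i by (auto simp del: index_mult_mat_vec)
      qed (use x in \<open>auto simp: hyp_mat_def\<close>)
    qed
    show "?f ` carrier_vec n \<subseteq> ?H"
    proof
      fix x assume "x \<in> ?f ` carrier_vec n"
      then obtain y where y: "y \<in> carrier_vec n" "x = ?f y" by blast
      then show "x \<in> ?H"
        using fc[OF y(1)] sp[OF fc[OF y(1)]] hyp_mat_mult_vec[OF y(1)]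
        by (simp del: index_mult_mat_vec)
    qed
    show "(\<lambda>x. vec n (($) x)) ` ?H \<subseteq> carrier_vec n" by auto
  qed
qed

section \<open>The dual variety\<close>

context smooth_form
begin

lemma f_nonzero: "f \<noteq> 0"
proof
  assume "f = 0"
  then have "partial i f = 0" for i by (simp add: partial_def)
  then have "df i = 0" for i by (simp add: df_def)
  then show False using df_common_zero[of "\<lambda>_. 1" 0] by simp
qed

text \<open>The equation of the dual variety: from a relation between \<open>f\<close> and its partial
  derivatives, cancel the common power of \<open>f\<close> and then put \<open>f = 0\<close>.\<close>
lemma dual_equation:
  obtains P :: "nat mpoly" where "P \<noteq> 0" "vars_in {..<Suc n} P"
    "\<And>x. eval_at x f = 0 \<Longrightarrow> eval_at (\<lambda>i. eval_at x (df i)) P = 0"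
proof -
  let ?V = "{..<Suc n}"
  let ?p = "case_option f df"
  have "vars_in ?V (?p w)" for w
    using homogeneous_vars_in[OF hom_f] homogeneous_vars_in[OF hom_df] by (cases w) auto
  moreover have "card (insert None (Some ` ?V)) = Suc (card ?V)" by (simp add: card_image)
  ultimately obtain R where R: "R \<noteq> 0" "peval const ?p R = 0" "vars_in (insert None (Some ` ?V)) R"
    using algebraic_dependence[of ?V "insert None (Some ` ?V)" ?p] by auto
  let ?K = "(\<lambda>m. lookup m None) ` keys R"
  define k0 where "k0 = Min ?K"
  have ne: "?K \<noteq> {}" using R(1) by simp
  then have "k0 \<in> ?K" unfolding k0_def by (intro Min_in) auto
  then obtain m0 where m0: "m0 \<in> keys R" "lookup m0 None = k0" by auto
  have k0: "k0 \<le> k" if "k \<in> ?K" for k using that by (simp add: k0_def)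
  define c where "c k = peval const df (none_coeff k R)" for k
  have "0 = (\<Sum>k\<in>?K. f ^ k * c k)" using R(2) by (simp add: peval_option c_def)
  also have "\<dots> = f ^ k0 * (\<Sum>k\<in>?K. f ^ (k - k0) * c k)"
    unfolding sum_distrib_left
  proof (rule sum.cong)
    fix k assume "k \<in> ?K"
    then have "f ^ k = f ^ k0 * f ^ (k - k0)" using k0 by (simp flip: power_add)
    then show "f ^ k * c k = f ^ k0 * (f ^ (k - k0) * c k)" by (simp add: mult.assoc)
  qed simp
  finally have z: "(\<Sum>k\<in>?K. f ^ (k - k0) * c k) = 0" using f_nonzero by simp
  show thesis
  proof
    show "none_coeff k0 R \<noteq> 0" using none_coeff_nonzero[OF m0(1)] m0(2) by simp
    show "vars_in ?V (none_coeff k0 R)" using R(3) by (rule vars_in_none_coeff)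
    fix x assume x: "eval_at x f = 0"
    have "0 = eval_at x (\<Sum>k\<in>?K. f ^ (k - k0) * c k)" using z by simp
    also have "\<dots> = (\<Sum>k\<in>?K. 0 ^ (k - k0) * eval_at x (c k))" by (simp add: x)
    also have "\<dots> = (\<Sum>k\<in>?K. if k = k0 then eval_at x (c k0) else 0)"
      by (rule sum.cong) (use k0 in \<open>auto simp: power_0_left le_antisym\<close>)
    also have "\<dots> = eval_at x (c k0)" using \<open>k0 \<in> ?K\<close> by simp
    finally show "eval_at (\<lambda>i. eval_at x (df i)) (none_coeff k0 R) = 0"
      by (simp add: c_def peval_peval)
  qed
qed

text \<open>At a singular point of the section the gradient of \<open>f\<close> is \<open>c\<close>
  times the normal vector, with \<open>c \<noteq> 0\<close> by smoothness of \<open>f\<close>. As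
  \<open>P\<close> need not be homogeneous, the point is rescaled by a root \<open>l\<close> of
  order \<open>e\<close> of \<open>t / c\<close>, which makes the gradient exactly the vector in the
  hypothesis.\<close>

lemma smooth_hyp_mat_section:
  assumes P: "\<And>x. eval_at x f = 0 \<Longrightarrow> eval_at (\<lambda>i. eval_at x (df i)) P = 0" "vars_in {..<Suc n} P"
    and t: "eval_at (\<lambda>i. t * (if i = n then -1 else a i)) P \<noteq> 0"
  shows "smooth_hypersurface n (pullback (hyp_mat n a) f)"
  unfolding smooth_hypersurface_def
proof (intro ballI impI, elim conjE)
  fix y assume y: "y \<in> carrier_vec n" "y \<noteq> 0\<^sub>v n" and "eval_at (($) y) (pullback (hyp_mat n a) f) = 0"
  let ?x = "($) (hyp_mat n a *\<^sub>v y)"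
  have fx: "eval_at ?x f = 0"
    using eval_pullback_vec[OF hom_f hyp_mat_carrier[of n a] y(1)]
      \<open>eval_at (($) y) (pullback (hyp_mat n a) f) = 0\<close> by simp
  show "\<exists>j<n. eval_at (($) y) (partial j (pullback (hyp_mat n a) f)) \<noteq> 0"
  proof (rule ccontr)
    assume "\<not> (\<exists>j<n. eval_at (($) y) (partial j (pullback (hyp_mat n a) f)) \<noteq> 0)"
    then have "(\<Sum>i<Suc n. hyp_mat n a $$ (i, j) * eval_at ?x (df i)) = 0" if "j < n" for j
      using eval_partial_pullback_vec[OF hom_f hyp_mat_carrier[of n a] y(1) that] that by (simp add: df_def)
    moreover have "(\<Sum>i<Suc n. hyp_mat n a $$ (i, j) * eval_at ?x (df i)) =
        eval_at ?x (df j) + a j * eval_at ?x (df n)" if "j < n" for j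
    proof -
      have "(\<Sum>i<n. hyp_mat n a $$ (i, j) * eval_at ?x (df i)) =
          (\<Sum>i<n. if i = j then eval_at ?x (df j) else 0)"
        by (rule sum.cong) (use that in \<open>auto simp: hyp_mat_def\<close>)
      then show ?thesis using that by (simp add: sum.lessThan_Suc hyp_mat_def)
    qed
    ultimately have g: "eval_at ?x (df j) = - eval_at ?x (df n) * a j" if "j < n" for j
      using that by (simp add: eq_neg_iff_add_eq_0 mult.commute)
    define c where "c = - eval_at ?x (df n)"
    have g: "eval_at ?x (df i) = c * (if i = n then -1 else a i)" if "i < Suc n" for i
      using g[of i] that by (auto simp: c_def less_Suc_eq)
    have "c \<noteq> 0"
    proof
      assume "c = 0"
      then have zero: "?x j = 0" if "j < Suc n" for j
        using df_common_zero[of ?x j] g that by simp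
      have "y = 0\<^sub>v n"
      proof (rule eq_vecI)
        fix j assume "j < dim_vec (0\<^sub>v n :: complex vec)"
        then have j: "j < n" by simp
        then show "y $ j = 0\<^sub>v n $ j"
          using zero[of j] hyp_mat_mult_vec[OF y(1), of j a] by simp
      qed (use y in simp)
      then show False using y by simp
    qed
    have "\<exists>l. l ^ e = t / c"
    proof (cases "t / c = 0")
      case True
      show ?thesis unfolding True using e by (intro exI[of _ 0]) (simp add: power_0_left)
    next
      case False
      then have "card {l. l ^ e = t / c} > 0" using card_nth_roots[of "t / c" e] e by simp
      then show ?thesis by (metis (mono_tags, lifting) Collect_empty_eq card.empty less_irrefl)
    qed
    then obtain l where l: "l ^ e = t / c" by blast
    have "eval_at (\<lambda>i. l * ?x i) f = 0" by (simp add: eval_scale[OF hom_f] fx)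
    then have "eval_at (\<lambda>i. eval_at (\<lambda>i. l * ?x i) (df i)) P = 0" by (rule P)
    moreover have "eval_at (\<lambda>i. eval_at (\<lambda>i. l * ?x i) (df i)) P =
        eval_at (\<lambda>i. t * (if i = n then -1 else a i)) P"
      by (rule eval_cong_vars[OF P(2)])
         (use \<open>c \<noteq> 0\<close> in \<open>auto simp: eval_scale[OF hom_df] g l\<close>)
    ultimately show False using t by simp
  qed
qed

text \<open>Moving \<open>z0\<close> in the direction of the identity makes the upper block
  \<open>A\<close> invertible while \<open>G\<close> stays nonzero. The matrix is then
  \<open>hyp_mat n a * A\<close>, and for fixed \<open>A\<close> both \<open>G\<close> and the dual
  equation are polynomial conditions on \<open>a\<close>, each of which can be met.\<close>

lemma generic_smooth_section:
  fixes G :: "(nat \<times> nat) mpoly"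
  assumes G: "vars_in ({..<Suc n} \<times> {..<n}) G" "eval_at z0 G \<noteq> 0"
  obtains z H where "eval_at z G \<noteq> 0" "smooth_hypersurface n (pullback (mat (Suc n) n z) f)"
    "H \<in> dual_projective_space n" "bij_betw (\<lambda>y. mat (Suc n) n z *\<^sub>v y) (carrier_vec n) H"
proof -
  define dz where "dz = (\<lambda>(i, j). if i = j \<and> i < n then 1 else 0 :: complex)"
  define zt where "zt t = (\<lambda>w. z0 w + t * dz w)" for t
  obtain q where q: "\<And>t. eval_at (zt t) G = poly q t"
    unfolding zt_def using eval_along_line[of z0 dz G] by blast
  have "poly q 0 \<noteq> 0" using q[of 0] G(2) by (simp add: zt_def)
  then have "q \<noteq> 0" by auto
  then have "finite {t. poly q t = 0}" by (rule poly_roots_finite)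
  moreover have shift: "mat n n (zt t) = mat n n z0 + t \<cdot>\<^sub>m 1\<^sub>m n" for t
    by (rule eq_matI) (auto simp: zt_def dz_def)
  then have "finite {t. \<not> invertible_mat (mat n n (zt t))}"
    using finite_singular_shift[of "mat n n z0" n] by simp
  ultimately have "finite ({t. poly q t = 0} \<union> {t. \<not> invertible_mat (mat n n (zt t))})" by blast
  then obtain t where "t \<notin> {t. poly q t = 0} \<union> {t. \<not> invertible_mat (mat n n (zt t))}"
    using ex_new_if_finite[OF infinite_UNIV_char_0] by blast
  then have t: "eval_at (zt t) G \<noteq> 0" "invertible_mat (mat n n (zt t))" by (simp_all add: q)
  define A where "A = mat n n (zt t)"
  have A: "A \<in> carrier_mat n n" "invertible_mat A" using t by (simp_all add: A_def)
  obtain A' where A': "A' \<in> carrier_mat n n" "A' * A = 1\<^sub>m n"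
    using invertible_matE[OF A] by blast
  define zz where "zz a = (\<lambda>(i, j). if i = n then \<Sum>k<n. a k * A $$ (k, j) else A $$ (i, j))" for a
  \<comment> \<open>The last row of \<open>zt t\<close> in terms of the rows of \<open>A\<close>, so
    that \<open>zz a0\<close> agrees with \<open>zt t\<close> on the matrix entries.\<close>
  define a0 where "a0 k = (\<Sum>j<n. zt t (n, j) * A' $$ (j, k))" for k
  have a0: "(\<Sum>k<n. a0 k * A $$ (k, j)) = zt t (n, j)" if "j < n" for j
  proof -
    have "(\<Sum>k<n. a0 k * A $$ (k, j)) = (\<Sum>i<n. zt t (n, i) * (\<Sum>k<n. A' $$ (i, k) * A $$ (k, j)))"
      unfolding a0_def sum_distrib_left sum_distrib_right by (subst sum.swap) (simp add: mult_ac)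
    also have "\<dots> = (\<Sum>i<n. if i = j then zt t (n, j) else 0)"
    proof (rule sum.cong)
      fix i assume i: "i \<in> {..<n}"
      have "(A' * A) $$ (i, j) = (\<Sum>k<n. A' $$ (i, k) * A $$ (k, j))"
        using i that A(1) A'(1) by (simp add: scalar_prod_def atLeast0LessThan)
      moreover have "1\<^sub>m n $$ (i, j) = (if i = j then 1 else 0 :: complex)" using i that by simp
      ultimately have "(\<Sum>k<n. A' $$ (i, k) * A $$ (k, j)) = (if i = j then 1 else 0)"
        unfolding A'(2) by metis
      then show "zt t (n, i) * (\<Sum>k<n. A' $$ (i, k) * A $$ (k, j)) = (if i = j then zt t (n, j) else 0)"
        by simp
    qed simp
    finally show ?thesis using that by simp
  qed
  define G' where "G' = peval const
    (\<lambda>(i, j). if i = n then \<Sum>k<n. var k * const (A $$ (k, j)) else const (A $$ (i, j))) G"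
  have G': "eval_at a G' = eval_at (zz a) G" for a
    unfolding G'_def peval_peval[OF coeff_hom_id] zz_def
    by (rule arg_cong[where f = "\<lambda>x. eval_at x G"]) (auto simp: fun_eq_iff)
  have "eval_at (zz a0) G = eval_at (zt t) G"
  proof (rule eval_cong_vars[OF G(1)])
    fix w assume "w \<in> {..<Suc n} \<times> {..<n}"
    then obtain i j where w: "w = (i, j)" "i < Suc n" "j < n" by auto
    have "A $$ (i, j) = zt t (i, j)" if "i \<noteq> n" using w that by (simp add: A_def)
    then show "zz a0 w = zt t w" using a0[OF w(3)] w(1) by (auto simp: zz_def)
  qed
  then have G'0: "eval_at a0 G' \<noteq> 0" using t(1) by (simp add: G')
  obtain P where P: "P \<noteq> 0" "vars_in {..<Suc n} P"
    "\<And>x. eval_at x f = 0 \<Longrightarrow> eval_at (\<lambda>i. eval_at x (df i)) P = 0"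
    using dual_equation by blast
  have "P * var n \<noteq> 0" using P(1) by simp
  then obtain v where "eval_at v (P * var n) \<noteq> 0" by (rule eval_nonzeroE)
  then have v: "eval_at v P \<noteq> 0" "v n \<noteq> 0" by auto
  \<comment> \<open>Normal vectors are normalised to have last entry -1;
    \<open>v n \<noteq> 0\<close> makes \<open>v\<close> equal to \<open>s\<close> times such a
    vector.\<close>
  define s where "s = - v n"
  define P' where "P' = peval const (\<lambda>i. if i = n then const (- s) else const s * var i) P"
  have P': "eval_at a P' = eval_at (\<lambda>i. s * (if i = n then -1 else a i)) P" for a
    unfolding P'_def peval_peval[OF coeff_hom_id]
    by (rule arg_cong[where f = "\<lambda>x. eval_at x P"]) (auto simp: fun_eq_iff)
  have "(\<lambda>i. s * (if i = n then -1 else v i / s)) = v"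
    using v(2) by (auto simp: s_def fun_eq_iff)
  then have P'1: "eval_at (\<lambda>i. v i / s) P' \<noteq> 0" unfolding P' using v(1) by simp
  obtain a where a: "eval_at a G' \<noteq> 0" "eval_at a P' \<noteq> 0"
    using eval_common_nonzero[OF G'0 P'1] by blast
  have M: "mat (Suc n) n (zz a) = hyp_mat n a * A"
  proof (rule eq_matI)
    fix i j assume "i < dim_row (hyp_mat n a * A)" "j < dim_col (hyp_mat n a * A)"
    then have ij: "i < Suc n" "j < n" using A by (auto simp: hyp_mat_def)
    have e: "(hyp_mat n a * A) $$ (i, j) = (\<Sum>k<n. hyp_mat n a $$ (i, k) * A $$ (k, j))"
      using ij A(1) by (simp add: hyp_mat_def scalar_prod_def atLeast0LessThan)
    show "mat (Suc n) n (zz a) $$ (i, j) = (hyp_mat n a * A) $$ (i, j)"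
    proof (cases "i = n")
      case True
      then show ?thesis unfolding e using ij by (simp add: zz_def hyp_mat_def)
    next
      case False
      have "(\<Sum>k<n. hyp_mat n a $$ (i, k) * A $$ (k, j)) = (\<Sum>k<n. if k = i then A $$ (i, j) else 0)"
        by (rule sum.cong) (use ij False in \<open>auto simp: hyp_mat_def\<close>)
      then show ?thesis unfolding e using ij False by (simp add: zz_def)
    qed
  qed (use A in \<open>auto simp: hyp_mat_def\<close>)
  let ?H = "{x \<in> carrier_vec (Suc n). vec (Suc n) (\<lambda>i. if i = n then -1 else a i) \<bullet> x = 0}"
  show thesis
  proof
    show "eval_at (zz a) G \<noteq> 0" using a(1) by (simp add: G')
    have hs: "homogeneous {..<n} (Suc e) (pullback (hyp_mat n a) f)"
      using homogeneous_pullback[OF hom_f, of "hyp_mat n a"] by (simp add: hyp_mat_def)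
    have "smooth_hypersurface n (pullback (hyp_mat n a) f)"
      using smooth_hyp_mat_section[of P s a] P a(2) by (simp add: P')
    moreover have "pullback A (pullback (hyp_mat n a) f) = pullback (hyp_mat n a * A) f"
      using hom_f A(1) by (intro pullback_pullback) (auto simp: hyp_mat_def)
    ultimately show "smooth_hypersurface n (pullback (mat (Suc n) n (zz a)) f)"
      unfolding M using smooth_pullback[OF A hs] by simp
    have "vec (Suc n) (\<lambda>i. if i = n then -1 else a i) $ n \<noteq> (0\<^sub>v (Suc n) :: complex vec) $ n" by simp
    then have "vec (Suc n) (\<lambda>i. if i = n then -1 else a i) \<noteq> 0\<^sub>v (Suc n)" by metis
    then show "?H \<in> dual_projective_space n"
      unfolding dual_projective_space_def by (intro CollectI exI conjI refl) auto
    have "bij_betw (\<lambda>y. A *\<^sub>v y) (carrier_vec n) (carrier_vec n)"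
    proof -
      obtain A1 where A1: "A1 \<in> carrier_mat n n" "A * A1 = 1\<^sub>m n" "A1 * A = 1\<^sub>m n"
        using invertible_matE[OF A] by blast
      have "A1 *\<^sub>v (A *\<^sub>v y) = y" "A *\<^sub>v (A1 *\<^sub>v y) = y" if "y \<in> carrier_vec n" for y
        using assoc_mult_mat_vec[OF A1(1) A(1) that] assoc_mult_mat_vec[OF A(1) A1(1) that] A1 that
        by simp_all
      then show ?thesis
        using A(1) A1(1) by (intro bij_betw_byWitness[where f' = "\<lambda>y. A1 *\<^sub>v y"]) auto
    qed
    from bij_betw_trans[OF this hyp_mat_bij]
    have b: "bij_betw ((\<lambda>y. hyp_mat n a *\<^sub>v y) \<circ> (\<lambda>y. A *\<^sub>v y)) (carrier_vec n) ?H" .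
    have eq: "((\<lambda>y. hyp_mat n a *\<^sub>v y) \<circ> (\<lambda>y. A *\<^sub>v y)) y = mat (Suc n) n (zz a) *\<^sub>v y"
      if "y \<in> carrier_vec n" for y
      unfolding M using assoc_mult_mat_vec[OF hyp_mat_carrier A(1) that] by simp
    show "bij_betw (\<lambda>y. mat (Suc n) n (zz a) *\<^sub>v y) (carrier_vec n) ?H"
      by (rule iffD1[OF bij_betw_cong b]) (rule eq)
  qed
qed

end

section \<open>Coordinates on hyperplanes\<close>

lemma ex_hyperplane_coords:
  assumes "H \<in> dual_projective_space n"
  shows "\<exists>B. B \<in> carrier_mat (Suc n) n \<and> bij_betw (\<lambda>y. B *\<^sub>v y) (carrier_vec n) H"
proof -
  obtain a where a: "a \<in> carrier_vec (Suc n)" "a \<noteq> 0\<^sub>v (Suc n)"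
    and H: "H = {x \<in> carrier_vec (Suc n). a \<bullet> x = 0}"
    using assms unfolding dual_projective_space_def by blast
  obtain i0 where i0: "i0 < Suc n" "a $ i0 \<noteq> 0"
    using a by (metis carrier_vecD eq_vecI index_zero_vec(1) index_zero_vec(2))
  \<comment> \<open>The equation of \<open>H\<close> is solved for a coordinate \<open>i0\<close>
    with nonzero coefficient; \<open>sk\<close> enumerates the others.\<close>
  define sk where "sk j = (if j < i0 then j else Suc j)" for j
  have sk_inj: "inj_on sk {..<n}" by (auto simp: sk_def inj_on_def split: if_splits)
  have sk_im: "sk ` {..<n} = {..<Suc n} - {i0}"
  proof
    show "sk ` {..<n} \<subseteq> {..<Suc n} - {i0}" using i0 by (auto simp: sk_def)
    show "{..<Suc n} - {i0} \<subseteq> sk ` {..<n}"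
    proof
      fix i assume i: "i \<in> {..<Suc n} - {i0}"
      then have "i = sk (if i < i0 then i else i - 1)" "(if i < i0 then i else i - 1) < n"
        using i0 by (auto simp: sk_def)
      then show "i \<in> sk ` {..<n}" by blast
    qed
  qed
  have skn: "sk j < Suc n" "sk j \<noteq> i0" if "j < n" for j
    using that by (auto simp: sk_def)
  have split: "(\<Sum>i<Suc n. g i) = g i0 + (\<Sum>j<n. g (sk j))" for g :: "nat \<Rightarrow> complex"
  proof -
    have "(\<Sum>i<Suc n. g i) = g i0 + (\<Sum>i\<in>{..<Suc n} - {i0}. g i)"
      using i0 by (simp add: sum.remove)
    also have "(\<Sum>i\<in>{..<Suc n} - {i0}. g i) = (\<Sum>j<n. g (sk j))"
      unfolding sk_im [symmetric] using sk_inj by (simp add: sum.reindex)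
    finally show ?thesis .
  qed
  define B where "B = mat (Suc n) n (\<lambda>(i, j). if i = i0 then - a $ sk j / a $ i0
      else if i = sk j then 1 else 0)"
  have B: "B \<in> carrier_mat (Suc n) n" by (simp add: B_def)
  have B0: "(B *\<^sub>v y) $ i0 = - (\<Sum>j<n. a $ sk j * y $ j) / a $ i0" if "y \<in> carrier_vec n" for y
    unfolding index_mult_mat_vec_sum[OF B that i0(1)]
    using i0 by (simp add: B_def sum_negf sum_divide_distrib)
  have Bs: "(B *\<^sub>v y) $ sk j = y $ j" if "y \<in> carrier_vec n" "j < n" for y j
  proof -
    have "(B *\<^sub>v y) $ sk j = (\<Sum>k<n. if k = j then y $ j else 0)"
      unfolding index_mult_mat_vec_sum[OF B that(1) skn(1)[OF that(2)]]
      by (rule sum.cong) (use that skn[OF that(2)] in \<open>auto simp: B_def sk_def split: if_splits\<close>)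
    then show ?thesis using that by simp
  qed
  have sp: "a \<bullet> x = a $ i0 * x $ i0 + (\<Sum>j<n. a $ sk j * x $ sk j)" if "x \<in> carrier_vec (Suc n)" for x
    using that split[of "\<lambda>i. a $ i * x $ i"] by (simp add: scalar_prod_def atLeast0LessThan)
  have Bc: "B *\<^sub>v y \<in> carrier_vec (Suc n)" if "y \<in> carrier_vec n" for y
    by (rule mult_mat_vec_carrier[OF B that])
  have "bij_betw (\<lambda>y. B *\<^sub>v y) (carrier_vec n) H"
  proof (rule bij_betw_byWitness[where f' = "\<lambda>x. vec n (\<lambda>j. x $ sk j)"])
    show "\<forall>y\<in>carrier_vec n. vec n (\<lambda>j. (B *\<^sub>v y) $ sk j) = y"
      by (auto intro!: eq_vecI simp: Bs simp del: index_mult_mat_vec)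
    show "\<forall>x\<in>H. B *\<^sub>v vec n (\<lambda>j. x $ sk j) = x"
    proof
      fix x assume "x \<in> H"
      then have x: "x \<in> carrier_vec (Suc n)" "a \<bullet> x = 0" by (auto simp: H)
      show "B *\<^sub>v vec n (\<lambda>j. x $ sk j) = x"
      proof (rule eq_vecI)
        fix i assume "i < dim_vec x"
        then have i: "i < Suc n" using x by simp
        show "(B *\<^sub>v vec n (\<lambda>j. x $ sk j)) $ i = x $ i"
        proof (cases "i = i0")
          case True
          have "a $ i0 * x $ i0 = - (\<Sum>j<n. a $ sk j * x $ sk j)"
            using sp[OF x(1)] x(2) by (simp add: eq_neg_iff_add_eq_0)
          then show ?thesis unfolding True using i0 by (simp add: B0 field_simps del: index_mult_mat_vec)
        next
          case False
          then have "i \<in> sk ` {..<n}" using i sk_im by blast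
          then show ?thesis by (auto simp: Bs simp del: index_mult_mat_vec)
        qed
      qed (use x B in simp)
    qed
    show "(\<lambda>y. B *\<^sub>v y) ` carrier_vec n \<subseteq> H"
    proof
      fix x assume "x \<in> (\<lambda>y. B *\<^sub>v y) ` carrier_vec n"
      then obtain y where y: "y \<in> carrier_vec n" "x = B *\<^sub>v y" by blast
      then show "x \<in> H"
        unfolding H using Bc[OF y(1)] sp[OF Bc[OF y(1)]] i0 by (simp add: B0 Bs del: index_mult_mat_vec)
    qed
    show "(\<lambda>x. vec n (\<lambda>j. x $ sk j)) ` H \<subseteq> carrier_vec n" by auto
  qed
  then show ?thesis using B by blast
qed

lemma hyperplane_coords:
  assumes "H \<in> dual_projective_space n"
  shows "hyperplane_coords n H \<in> carrier_mat (Suc n) n"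
    and "bij_betw (\<lambda>y. hyperplane_coords n H *\<^sub>v y) (carrier_vec n) H"
  using someI_ex[OF ex_hyperplane_coords[OF assms]] unfolding hyperplane_coords_def by auto

lemma coords_unique:
  fixes B B' :: "complex mat"
  assumes B: "B \<in> carrier_mat N n" "bij_betw (\<lambda>y. B *\<^sub>v y) (carrier_vec n) H"
    and B': "B' \<in> carrier_mat N n" "bij_betw (\<lambda>y. B' *\<^sub>v y) (carrier_vec n) H"
  obtains A where "A \<in> carrier_mat n n" "invertible_mat A" "B' = B * A"
proof -
  have "\<exists>y. y \<in> carrier_vec n \<and> B *\<^sub>v y = B' *\<^sub>v unit_vec n j" for j
  proof -
    have "B' *\<^sub>v unit_vec n j \<in> H" using bij_betwE[OF B'(2)] unit_vec_carrier by blast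
    then have "B' *\<^sub>v unit_vec n j \<in> (\<lambda>y. B *\<^sub>v y) ` carrier_vec n"
      by (simp only: bij_betw_imp_surj_on[OF B(2)])
    then obtain y where "B' *\<^sub>v unit_vec n j = B *\<^sub>v y" "y \<in> carrier_vec n" by (rule imageE)
    then show ?thesis by (intro exI[of _ y]) simp
  qed
  then have "\<forall>j. \<exists>y. y \<in> carrier_vec n \<and> B *\<^sub>v y = B' *\<^sub>v unit_vec n j" by (rule allI)
  from choice[OF this] obtain c
    where "\<forall>j. c j \<in> carrier_vec n \<and> B *\<^sub>v c j = B' *\<^sub>v unit_vec n j" by (rule exE)
  then have c: "c j \<in> carrier_vec n" "B *\<^sub>v c j = B' *\<^sub>v unit_vec n j" for j by simp_all
  \<comment> \<open>Column \<open>j\<close> of \<open>A\<close> expresses column \<open>j\<close> of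
    \<open>B'\<close> in the coordinates given by \<open>B\<close>.\<close>
  define A where "A = mat n n (\<lambda>(i, j). c j $ i)"
  have A: "A \<in> carrier_mat n n" by (simp add: A_def)
  have BA: "B' = B * A"
  proof (rule eq_matI)
    fix i j assume "i < dim_row (B * A)" "j < dim_col (B * A)"
    then have ij: "i < N" "j < n" using B A by auto
    have "(B * A) $$ (i, j) = (\<Sum>k<n. B $$ (i, k) * c j $ k)"
      using ij B(1) A by (simp add: scalar_prod_def atLeast0LessThan A_def)
    also have "\<dots> = (B *\<^sub>v c j) $ i" using index_mult_mat_vec_sum[OF B(1) c(1) ij(1)] by simp
    also have "\<dots> = (B' *\<^sub>v unit_vec n j) $ i" by (simp only: c)
    also have "\<dots> = (\<Sum>k<n. B' $$ (i, k) * unit_vec n j $ k)"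
      by (rule index_mult_mat_vec_sum[OF B'(1) unit_vec_carrier ij(1)])
    also have "\<dots> = (\<Sum>k<n. if k = j then B' $$ (i, j) else 0)"
      by (rule sum.cong) (use ij in auto)
    finally show "B' $$ (i, j) = (B * A) $$ (i, j)" using ij by simp
  qed (use B B' A in auto)
  have "invertible_mat A"
  proof (rule invertible_matI[OF A])
    fix v assume v: "v \<in> carrier_vec n" "A *\<^sub>v v = 0\<^sub>v n"
    have "B' *\<^sub>v v = B *\<^sub>v (A *\<^sub>v v)" unfolding BA by (rule assoc_mult_mat_vec[OF B(1) A v(1)])
    also have "\<dots> = B' *\<^sub>v 0\<^sub>v n" unfolding v(2) using B(1) B'(1) by (auto intro!: eq_vecI)
    finally show "v = 0\<^sub>v n" using B'(2) v(1) unfolding bij_betw_def inj_on_def by auto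
  qed
  then show thesis using A BA that by blast
qed

section \<open>Orbits and the Zariski topology\<close>

lemma proj_class_pullback: "pullback A ` proj_class F = proj_class (pullback A F)"
proof -
  have "proj_class F = (\<lambda>c. const c * F) ` {c. c \<noteq> 0}" for F
    by (auto simp: proj_class_def)
  then show ?thesis by (simp add: image_image pullback_const_mult)
qed

lemma PGL_orbit_proj_class:
  "PGL_orbit n (proj_class F) =
     {proj_class (pullback A F) | A. A \<in> carrier_mat n n \<and> invertible_mat A}"
  by (simp add: PGL_orbit_def proj_class_pullback)

lemma proj_class_self: "F \<in> proj_class F"
  unfolding proj_class_def by (auto intro!: exI[of _ 1])

lemma proj_class_eqD:
  assumes "proj_class F = proj_class G"
  shows "\<exists>c. c \<noteq> 0 \<and> F = const c * G"
  using proj_class_self[of F] unfolding assms by (auto simp: proj_class_def)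

lemma invertible_one_mat: "invertible_mat (1\<^sub>m n :: complex mat)"
  unfolding invertible_mat_def inverts_mat_def by (auto simp: square_mat.simps intro!: exI[of _ "1\<^sub>m n"])

lemma homogeneous_pullback_square:
  assumes "homogeneous {..<N} d F" "A \<in> carrier_mat N n"
  shows "homogeneous {..<n} d (pullback A F)"
  using homogeneous_pullback[OF assms(1), of A] assms(2) by simp

lemma PGL_orbit_self:
  assumes "homogeneous {..<n} d F"
  shows "proj_class F \<in> PGL_orbit n (proj_class F)"
  unfolding PGL_orbit_proj_class using pullback_one[OF assms] invertible_one_mat[of n]
  by (intro CollectI exI[of _ "1\<^sub>m n"]) auto

lemma PGL_orbit_pullback_subset:
  assumes F: "homogeneous {..<n} d F" and A: "A \<in> carrier_mat n n" "invertible_mat A"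
  shows "PGL_orbit n (proj_class (pullback A F)) \<subseteq> PGL_orbit n (proj_class F)"
proof
  fix p assume "p \<in> PGL_orbit n (proj_class (pullback A F))"
  then obtain B where B: "B \<in> carrier_mat n n" "invertible_mat B"
      "p = proj_class (pullback B (pullback A F))"
    unfolding PGL_orbit_proj_class by blast
  have "pullback B (pullback A F) = pullback (A * B) F"
    using F A B by (intro pullback_pullback) auto
  then show "p \<in> PGL_orbit n (proj_class F)"
    unfolding PGL_orbit_proj_class using B invertible_mat_mult[OF A B(1,2)] A
    by (intro CollectI exI[of _ "A * B"]) auto
qed

lemma PGL_orbit_pullback:
  assumes F: "homogeneous {..<n} d F" and A: "A \<in> carrier_mat n n" "invertible_mat A"
  shows "PGL_orbit n (proj_class (pullback A F)) = PGL_orbit n (proj_class F)"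
proof (rule subset_antisym)
  show "PGL_orbit n (proj_class (pullback A F)) \<subseteq> PGL_orbit n (proj_class F)"
    by (rule PGL_orbit_pullback_subset[OF assms])
  obtain A' where A': "A' \<in> carrier_mat n n" "A * A' = 1\<^sub>m n" "invertible_mat A'"
    using invertible_matE[OF A] by blast
  have "pullback A' (pullback A F) = pullback (A * A') F"
    by (rule pullback_pullback[where d = d]) (use F A(1) A'(1) in auto)
  then have e: "pullback A' (pullback A F) = F" unfolding A'(2) pullback_one[OF F] .
  show "PGL_orbit n (proj_class F) \<subseteq> PGL_orbit n (proj_class (pullback A F))"
    using PGL_orbit_pullback_subset[OF homogeneous_pullback_square[OF F A(1)] A'(1,3)] unfolding e .
qed

lemma PGL_orbit_eqD:
  assumes F: "homogeneous {..<n} d F" and "PGL_orbit n (proj_class F) = PGL_orbit n (proj_class G)"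
  shows "\<exists>A c. A \<in> carrier_mat n n \<and> invertible_mat A \<and> c \<noteq> 0 \<and> F = const c * pullback A G"
proof -
  have "proj_class F \<in> {proj_class (pullback A G) | A. A \<in> carrier_mat n n \<and> invertible_mat A}"
    using PGL_orbit_self[OF F] assms(2) PGL_orbit_proj_class[of n G] by simp
  then obtain A where A: "A \<in> carrier_mat n n" "invertible_mat A" "proj_class F = proj_class (pullback A G)"
    by blast
  obtain c where "c \<noteq> 0" "F = const c * pullback A G" using proj_class_eqD[OF A(3)] by blast
  then show ?thesis using A(1,2) by (intro exI[of _ A] exI[of _ c] conjI)
qed

lemma smooth_nonzero:
  assumes "smooth_hypersurface n F" "0 < n"
  shows "F \<noteq> 0"
proof
  assume "F = 0"
  have "vec n (\<lambda>_. 1) $ 0 \<noteq> (0\<^sub>v n :: complex vec) $ 0" using assms(2) by simp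
  then have "vec n (\<lambda>_. 1) \<noteq> (0\<^sub>v n :: complex vec)" by metis
  moreover have "partial i F = 0" for i using \<open>F = 0\<close> by (simp add: partial_def)
  ultimately show False
    using assms(1) \<open>F = 0\<close> unfolding smooth_hypersurface_def
    by (auto dest!: bspec[of _ _ "vec n (\<lambda>_. 1)"])
qed

text \<open>Independence of monomials provides dual functionals, so coefficients are read off from
  finitely many values. Operations known through evaluation thereby become polynomial in
  coefficients.\<close>

lemma coefficient_functional:
  fixes E :: "('v \<Rightarrow>\<^sub>0 nat) set"
  assumes E: "finite E"
  shows "\<exists>L. \<forall>m\<in>E. fin_functional (L m) \<and>
    (\<forall>F. keys F \<subseteq> E \<longrightarrow> L m (\<lambda>y. eval_at y F) = lookup F m)"
proof -
  have "\<exists>L. (\<forall>m\<in>E. fin_functional (L m)) \<and>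
    (\<forall>m\<in>E. \<forall>m'\<in>E. L m (\<lambda>y. mon_eval y m') = (if m = m' then 1 else 0))"
    by (rule dual_functionals[OF E]) (use monomials_independent[OF E] in blast)
  then obtain L
    where L: "\<And>m. m \<in> E \<Longrightarrow> fin_functional (L m)"
      "\<And>m m'. m \<in> E \<Longrightarrow> m' \<in> E \<Longrightarrow> L m (\<lambda>y. mon_eval y m') = (if m = m' then 1 else 0)"
    by blast
  have "L m (\<lambda>y. eval_at y F) = lookup F m" if m: "m \<in> E" and F: "keys F \<subseteq> E" for m and F :: "'v mpoly"
  proof -
    have "L m (\<lambda>y. eval_at y F) = L m (\<lambda>y. \<Sum>m'\<in>E. lookup F m' * mon_eval y m')"
      using peval_superset[OF coeff_hom_id E F] by simp
    also have "\<dots> = (\<Sum>m'\<in>E. lookup F m' * L m (\<lambda>y. mon_eval y m'))"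
      by (rule fin_functional_linear[OF L(1)[OF m]])
    also have "\<dots> = (\<Sum>m'\<in>E. if m' = m then lookup F m else 0)"
      by (rule sum.cong) (use m L(2) in auto)
    finally show ?thesis using m E by simp
  qed
  then show ?thesis using L(1) by (intro exI[of _ L]) simp
qed

lemma fin_functional_comp:
  assumes "fin_functional L" shows "fin_functional (\<lambda>G. L (\<lambda>x. G (\<phi> x)))"
proof -
  obtain X w where L: "finite X" "\<And>F. L F = (\<Sum>x\<in>X. w x * F x)"
    using assms by (auto simp: fin_functional_def)
  show ?thesis unfolding L by (intro fin_functional_sum fin_functional_cmult fin_functional_eval)
qed

lemma form_poly_cong:
  assumes "form_poly n d Q" "\<And>F. homogeneous {..<n} d F \<Longrightarrow> Q' F = Q F"
  shows "form_poly n d Q'"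
proof -
  obtain P where "vars_in (monomials {..<n} d) P" "\<forall>F. homogeneous {..<n} d F \<longrightarrow> Q F = eval_at (lookup F) P"
    using assms(1) unfolding form_poly_def by blast
  then show ?thesis unfolding form_poly_def using assms(2) by (intro exI[of _ P]) simp
qed

text \<open>Coefficients of the pullback are combinations of its values, and these are values of
  \<open>F\<close> at the points \<open>\<phi> y\<close>.\<close>

lemma form_poly_pullback:
  assumes Q: "form_poly n d Q" and A: "A \<in> carrier_mat n n"
  shows "form_poly n d (\<lambda>F. Q (pullback A F))"
proof -
  let ?E = "monomials {..<n} d"
  obtain P where P: "vars_in ?E P" "\<And>F. homogeneous {..<n} d F \<Longrightarrow> Q F = eval_at (lookup F) P"
    using Q unfolding form_poly_def by blast
  obtain L where L: "\<And>m. m \<in> ?E \<Longrightarrow> fin_functional (L m)"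
    "\<And>m F. m \<in> ?E \<Longrightarrow> keys F \<subseteq> ?E \<Longrightarrow> L m (\<lambda>y. eval_at y F) = lookup F m"
    using coefficient_functional[OF finite_monomials[of "{..<n}" d]] by auto
  define \<phi> where "\<phi> y = (\<lambda>i. \<Sum>j<dim_col A. A $$ (i, j) * y j)" for y :: "nat \<Rightarrow> complex"
  define L' where "L' m G = (if m \<in> ?E then L m (\<lambda>y. G (\<phi> y)) else 0)" for m G
  have "fin_functional (L' m)" for m
    using fin_functional_comp[OF L(1), of m \<phi>] fin_functional_0
    by (cases "m \<in> ?E") (simp_all add: L'_def [abs_def])
  then have "form_poly n d (\<lambda>F. eval_at (\<lambda>m. L' m (\<lambda>y. eval_at y F)) P)"
    by (intro form_poly_subst form_poly_functional)
  then show ?thesis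
  proof (rule form_poly_cong)
    fix F assume F: "homogeneous {..<n} d F"
    have h: "homogeneous {..<n} d (pullback A F)"
      using F A by (rule homogeneous_pullback_square)
    show "Q (pullback A F) = eval_at (\<lambda>m. L' m (\<lambda>y. eval_at y F)) P"
      unfolding P(2)[OF h]
    proof (rule eval_cong_vars[OF P(1)])
      fix m assume m: "m \<in> ?E"
      have "L m (\<lambda>y. eval_at y (pullback A F)) = lookup (pullback A F) m"
        using L(2)[OF m] h unfolding homogeneous_def by blast
      then show "lookup (pullback A F) m = L' m (\<lambda>y. eval_at y F)"
        using m by (simp add: L'_def eval_pullback \<phi>_def)
    qed
  qed
qed

lemma form_poly_section:
  assumes Q: "form_poly n d Q" and f: "homogeneous {..<N} d f"
  shows "\<exists>G. vars_in ({..<N} \<times> {..<n}) G \<and> (\<forall>z. eval_at z G = Q (pullback (mat N n z) f))"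
proof -
  let ?E = "monomials {..<n} d"
  obtain P where P: "vars_in ?E P" "\<And>F. homogeneous {..<n} d F \<Longrightarrow> Q F = eval_at (lookup F) P"
    using Q unfolding form_poly_def by blast
  obtain L where L: "\<And>m. m \<in> ?E \<Longrightarrow> fin_functional (L m)"
    "\<And>m F. m \<in> ?E \<Longrightarrow> keys F \<subseteq> ?E \<Longrightarrow> L m (\<lambda>y. eval_at y F) = lookup F m"
    using coefficient_functional[OF finite_monomials[of "{..<n}" d]] by auto
  have "\<forall>m. \<exists>p. m \<in> ?E \<longrightarrow> vars_in ({..<N} \<times> {..<n}) p \<and>
      (\<forall>z. eval_at z p = L m (\<lambda>y. eval_at z (section_at n f y)))"
    using functional_section_at[OF L(1) f] by blast
  from choice[OF this] obtain p where p: "\<And>m. m \<in> ?E \<Longrightarrow> vars_in ({..<N} \<times> {..<n}) (p m)"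
    "\<And>m z. m \<in> ?E \<Longrightarrow> eval_at z (p m) = L m (\<lambda>y. eval_at z (section_at n f y))" by blast
  have "eval_at z (peval const p P) = Q (pullback (mat N n z) f)" for z
  proof -
    have h: "homogeneous {..<n} d (pullback (mat N n z) f)"
      using f by (rule homogeneous_pullback_square) simp
    show ?thesis
      unfolding P(2)[OF h] peval_peval[OF coeff_hom_id]
    proof (rule eval_cong_vars[OF P(1)])
      fix m assume m: "m \<in> ?E"
      have "L m (\<lambda>y. eval_at y (pullback (mat N n z) f)) = lookup (pullback (mat N n z) f) m"
        using L(2)[OF m] h unfolding homogeneous_def by blast
      then show "eval_at z (p m) = lookup (pullback (mat N n z) f) m"
        using p(2)[OF m] by (simp add: eval_pullback_mat[OF f] eval_section_at)
    qed
  qed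
  moreover have "vars_in ({..<N} \<times> {..<n}) (peval const p P)"
    using P(1) p(1) by (rule vars_in_subst)
  ultimately show ?thesis by blast
qed

text \<open>Principal open sets require homogeneous polynomials; an arbitrary condition on
  coefficients is split into such parts.\<close>

definition hom_part :: "nat \<Rightarrow> 'v mpoly \<Rightarrow> 'v mpoly" where
  "hom_part k P = (\<Sum>m\<in>{m \<in> keys P. mdeg m = k}. single m (lookup P m))"

lemma homogeneous_hom_part:
  assumes "vars_in V P" shows "homogeneous V k (hom_part k P)"
  unfolding hom_part_def
  by (intro homogeneous_sum homogeneous_single) (use assms in \<open>auto simp: vars_in_def monomials_iff\<close>)

lemma eval_hom_parts:
  "eval_at (\<lambda>i. c * x i) P = (\<Sum>k\<in>mdeg ` keys P. c ^ k * eval_at x (hom_part k P))"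
proof -
  have "eval_at (\<lambda>i. c * x i) P =
      (\<Sum>k\<in>mdeg ` keys P. \<Sum>m\<in>{m \<in> keys P. mdeg m = k}. lookup P m * mon_eval (\<lambda>i. c * x i) m)"
    unfolding peval_alt by (rule sum.group [symmetric]) auto
  also have "\<dots> = (\<Sum>k\<in>mdeg ` keys P. c ^ k * eval_at x (hom_part k P))"
    by (rule sum.cong)
       (auto simp: hom_part_def peval_single mon_eval_scale sum_distrib_left mult_ac intro!: sum.cong)
  finally show ?thesis .
qed

text \<open>The scalar \<open>c\<close> makes this a condition on the point of projective space although \<open>Q\<close> need not be
  homogeneous.\<close>
definition orbit_nonzero :: "nat \<Rightarrow> (nat mpoly \<Rightarrow> complex) \<Rightarrow> nat mpoly \<Rightarrow> bool" where
  "orbit_nonzero n Q F \<longleftrightarrow> (\<exists>A c. A \<in> carrier_mat n n \<and> invertible_mat A \<and> c \<noteq> 0 \<and>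
     Q (const c * pullback A F) \<noteq> 0)"

lemma orbit_nonzero_invariant:
  assumes F: "homogeneous {..<n} d F" and A: "A \<in> carrier_mat n n" "invertible_mat A" and "b \<noteq> 0"
    and "orbit_nonzero n Q (const b * pullback A F)"
  shows "orbit_nonzero n Q F"
proof -
  obtain B c where B: "B \<in> carrier_mat n n" "invertible_mat B" "c \<noteq> 0"
    "Q (const c * pullback B (const b * pullback A F)) \<noteq> 0"
    using assms(5) unfolding orbit_nonzero_def by blast
  have "pullback B (pullback A F) = pullback (A * B) F"
    by (rule pullback_pullback[where d = d]) (use F A(1) B(1) in auto)
  then have "const c * pullback B (const b * pullback A F) = const (c * b) * pullback (A * B) F"
    by (simp add: pullback_const_mult const_mult mult.assoc)
  then have "Q (const (c * b) * pullback (A * B) F) \<noteq> 0" using B(4) by simp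
  moreover have "invertible_mat (A * B)" using A B(1,2) by (rule invertible_mat_mult)
  moreover have "A * B \<in> carrier_mat n n" using A B by simp
  ultimately show ?thesis
    unfolding orbit_nonzero_def using B(3) assms(4) by (intro exI[of _ "A * B"] exI[of _ "c * b"]) simp
qed

lemma orbit_nonzeroI:
  assumes F: "homogeneous {..<n} d F" and "Q F \<noteq> 0"
  shows "orbit_nonzero n Q F"
  unfolding orbit_nonzero_def using assms(2) pullback_one[OF F] invertible_one_mat[of n]
  by (intro exI[of _ "1\<^sub>m n"] exI[of _ 1]) simp

lemma openin_principal_open:
  "homogeneous (monomials {..<n} d) k P \<Longrightarrow> openin (zariski_forms d n) (principal_open d n P)"
  unfolding zariski_forms_def by (rule topology_generated_by_Basis) blast

text \<open>For fixed \<open>A\<close> and \<open>F\<close> the value at \<open>c F\<close> is a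
  polynomial in \<open>c\<close> whose coefficients are the homogeneous parts. It is nonzero at some
  \<open>c \<noteq> 0\<close> exactly when one part is nonzero, so the set is a union of principal
  open sets.\<close>

lemma openin_orbit_nonzero:
  assumes Q: "form_poly n d Q"
  shows "openin (zariski_forms d n)
    {proj_class F | F. homogeneous {..<n} d F \<and> F \<noteq> 0 \<and> orbit_nonzero n Q F}" (is "openin _ ?O")
proof -
  let ?E = "monomials {..<n} d"
  let ?GL = "{A :: complex mat. A \<in> carrier_mat n n \<and> invertible_mat A}"
  have "\<forall>A. \<exists>P. A \<in> ?GL \<longrightarrow> vars_in ?E P \<and>
      (\<forall>F. homogeneous {..<n} d F \<longrightarrow> Q (pullback A F) = eval_at (lookup F) P)"
    using form_poly_pullback[OF Q] unfolding form_poly_def by blast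
  from choice[OF this] obtain P where P: "\<And>A. A \<in> ?GL \<Longrightarrow> vars_in ?E (P A)"
    "\<And>A F. A \<in> ?GL \<Longrightarrow> homogeneous {..<n} d F \<Longrightarrow> Q (pullback A F) = eval_at (lookup F) (P A)" by blast
  have ev: "Q (const c * pullback A F) = (\<Sum>k\<in>mdeg ` keys (P A). c ^ k * eval_at (lookup F) (hom_part k (P A)))"
    if A: "A \<in> ?GL" and F: "homogeneous {..<n} d F" for A F c
  proof -
    have "Q (const c * pullback A F) = Q (pullback A (const c * F))" by (simp add: pullback_const_mult)
    also have "\<dots> = eval_at (lookup (const c * F)) (P A)"
      using A F by (intro P homogeneous_const_mult)
    also have "lookup (const c * F) = (\<lambda>m. c * lookup F m)" by (simp add: lookup_const_mult fun_eq_iff)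
    finally show ?thesis by (simp only: eval_hom_parts)
  qed
  have "?O = (\<Union>A\<in>?GL. \<Union>k\<in>mdeg ` keys (P A). principal_open d n (hom_part k (P A)))"
  proof (rule subset_antisym; rule subsetI)
    fix p assume "p \<in> ?O"
    then obtain F A c where F: "p = proj_class F" "homogeneous {..<n} d F" "F \<noteq> 0"
      and A: "A \<in> ?GL" and nz: "Q (const c * pullback A F) \<noteq> 0"
      unfolding orbit_nonzero_def by blast
    obtain k where "k \<in> mdeg ` keys (P A)" "eval_at (lookup F) (hom_part k (P A)) \<noteq> 0"
      using nz unfolding ev[OF A F(2)] by (metis (no_types, lifting) mult_zero_right sum.neutral)
    then show "p \<in> (\<Union>A\<in>?GL. \<Union>k\<in>mdeg ` keys (P A). principal_open d n (hom_part k (P A)))"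
      using A F unfolding principal_open_def by blast
  next
    fix p assume "p \<in> (\<Union>A\<in>?GL. \<Union>k\<in>mdeg ` keys (P A). principal_open d n (hom_part k (P A)))"
    then obtain A k F where A: "A \<in> ?GL" and k: "k \<in> mdeg ` keys (P A)"
      and F: "p = proj_class F" "homogeneous {..<n} d F" "F \<noteq> 0" "eval_at (lookup F) (hom_part k (P A)) \<noteq> 0"
      unfolding principal_open_def by blast
    define q where "q = (\<Sum>k\<in>mdeg ` keys (P A). Polynomial.monom (eval_at (lookup F) (hom_part k (P A))) k)"
    have "Polynomial.coeff q k =
        (\<Sum>j\<in>mdeg ` keys (P A). if j = k then eval_at (lookup F) (hom_part k (P A)) else 0)"
      unfolding q_def coeff_sum by (rule sum.cong) auto
    also have "\<dots> = eval_at (lookup F) (hom_part k (P A))" using k by simp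
    finally have "q \<noteq> 0" using F(4) by auto
    \<comment> \<open>The extra factor forces the scalar found next to be nonzero.\<close>
    then have "[:0, 1:] * q \<noteq> 0" by simp
    then obtain c where "poly ([:0, 1:] * q) c \<noteq> 0" using poly_all_0_iff_0 by blast
    then have c: "c \<noteq> 0" "poly q c \<noteq> 0" by auto
    have "Q (const c * pullback A F) = poly q c"
      unfolding ev[OF A F(2)] by (simp add: q_def poly_sum poly_monom mult.commute)
    then have "orbit_nonzero n Q F"
      using A c unfolding orbit_nonzero_def by (intro exI[of _ A] exI[of _ c]) simp
    then show "p \<in> ?O" using F by blast
  qed
  moreover have "openin (zariski_forms d n)
      (\<Union>A\<in>?GL. \<Union>k\<in>mdeg ` keys (P A). principal_open d n (hom_part k (P A)))"
    by (intro openin_Union) (auto intro!: openin_principal_open homogeneous_hom_part P)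
  ultimately show ?thesis by simp
qed

text \<open>Induction on the generated topology, with products of polynomials for intersections.
  Homogeneity of a basic \<open>P\<close> makes its nonvanishing independent of the
  representative.\<close>

lemma zariski_neighbourhood:
  assumes "openin (zariski_forms d n) T" "homogeneous {..<n} d F0" "proj_class F0 \<in> T"
  shows "\<exists>Q. form_poly n d Q \<and> Q F0 \<noteq> 0 \<and>
    (\<forall>F. homogeneous {..<n} d F \<longrightarrow> F \<noteq> 0 \<longrightarrow> Q F \<noteq> 0 \<longrightarrow> proj_class F \<in> T)"
proof -
  have "generate_topology_on {principal_open d n P | P e. homogeneous (monomials {..<n} d) e P} T"
    using assms(1) unfolding zariski_forms_def openin_topology_generated_by_iff .
  then show ?thesis using assms(3)
  proof induction
    case (Int a b)
    then obtain Q Q' where "form_poly n d Q" "Q F0 \<noteq> 0" "form_poly n d Q'" "Q' F0 \<noteq> 0"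
      "\<forall>F. homogeneous {..<n} d F \<longrightarrow> F \<noteq> 0 \<longrightarrow> Q F \<noteq> 0 \<longrightarrow> proj_class F \<in> a"
      "\<forall>F. homogeneous {..<n} d F \<longrightarrow> F \<noteq> 0 \<longrightarrow> Q' F \<noteq> 0 \<longrightarrow> proj_class F \<in> b" by auto
    then show ?case by (intro exI[of _ "\<lambda>F. Q F * Q' F"]) (simp add: form_poly_mult)
  next
    case (UN K)
    then obtain k where "k \<in> K" "proj_class F0 \<in> k" by blast
    with UN.IH[OF this] show ?case by blast
  next
    case (Basis s)
    then obtain P k where P: "s = principal_open d n P" "homogeneous (monomials {..<n} d) k P" by blast
    then obtain F where F: "proj_class F0 = proj_class F" "eval_at (lookup F) P \<noteq> 0"
      using Basis.prems unfolding principal_open_def by blast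
    obtain c where c: "c \<noteq> 0" "F = const c * F0" using proj_class_eqD[OF F(1)[symmetric]] by blast
    have "lookup F = (\<lambda>m. c * lookup F0 m)" unfolding c by (simp add: lookup_const_mult fun_eq_iff)
    then have "eval_at (lookup F0) P \<noteq> 0" using F(2) eval_scale[OF P(2)] by auto
    moreover have "form_poly n d (\<lambda>F. eval_at (lookup F) P)"
      unfolding form_poly_def using homogeneous_vars_in[OF P(2)] by blast
    ultimately show ?case
      unfolding P(1) principal_open_def by (intro exI[of _ "\<lambda>F. eval_at (lookup F) P"]) blast
  qed simp
qed

lemma topspace_zariski:
  assumes "homogeneous {..<n} d F" "F \<noteq> 0"
  shows "proj_class F \<in> topspace (zariski_forms d n)"
proof -
  have "proj_class F \<in> principal_open d n 1" using assms by (auto simp: principal_open_def)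
  then show ?thesis
    using openin_subset[OF openin_principal_open[OF homogeneous_1, of d n]] by blast
qed

lemma moduli_space_openD:
  assumes "openin (moduli_space d n) V" "0 < n"
  obtains T where "openin (zariski_forms d n) T"
    "\<And>F. homogeneous {..<n} d F \<Longrightarrow> smooth_hypersurface n F \<Longrightarrow>
       proj_class F \<in> T \<longleftrightarrow> PGL_orbit n (proj_class F) \<in> V"
proof -
  let ?X = "subtopology (zariski_forms d n) (smooth_locus d n)"
  have "openin ?X {x \<in> topspace ?X. PGL_orbit n x \<in> V}"
    using assms(1) unfolding moduli_space_def openin_quotient_topology by blast
  then obtain T where T: "openin (zariski_forms d n) T"
    "{x \<in> topspace ?X. PGL_orbit n x \<in> V} = T \<inter> smooth_locus d n"
    unfolding openin_subtopology by blast
  show thesis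
  proof (rule that[OF T(1)])
    fix F assume F: "homogeneous {..<n} d F" "smooth_hypersurface n F"
    then have s: "proj_class F \<in> smooth_locus d n" by (auto simp: smooth_locus_def)
    show "proj_class F \<in> T \<longleftrightarrow> PGL_orbit n (proj_class F) \<in> V"
      using T(2) s topspace_zariski[OF F(1) smooth_nonzero[OF F(2) assms(2)]] by (auto simp: set_eq_iff)
  qed
qed

text \<open>The condition is constant along orbits and under scaling, so the preimage in the smooth
  locus is cut out by the corresponding open set of forms.\<close>

lemma openin_moduli_orbit_nonzero:
  assumes Q: "form_poly n d Q" and "0 < n"
  shows "openin (moduli_space d n)
    {PGL_orbit n (proj_class F) | F. homogeneous {..<n} d F \<and> smooth_hypersurface n F \<and> orbit_nonzero n Q F}"
    (is "openin _ ?W")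
proof -
  let ?X = "subtopology (zariski_forms d n) (smooth_locus d n)"
  let ?O = "{proj_class F | F. homogeneous {..<n} d F \<and> F \<noteq> 0 \<and> orbit_nonzero n Q F}"
  have top: "topspace ?X = smooth_locus d n"
    using topspace_zariski smooth_nonzero[OF _ assms(2)] by (auto simp: smooth_locus_def)
  have "?W \<subseteq> PGL_orbit n ` topspace ?X"
    unfolding top by (auto simp: smooth_locus_def)
  moreover have "{x \<in> topspace ?X. PGL_orbit n x \<in> ?W} = ?O \<inter> smooth_locus d n"
    unfolding top
  proof (rule subset_antisym; rule subsetI)
    fix x assume "x \<in> {x \<in> smooth_locus d n. PGL_orbit n x \<in> ?W}"
    then obtain F G where F: "x = proj_class F" "homogeneous {..<n} d F" "smooth_hypersurface n F"
      and G: "PGL_orbit n x = PGL_orbit n (proj_class G)" "homogeneous {..<n} d G" "orbit_nonzero n Q G"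
      unfolding smooth_locus_def by blast
    obtain A c where "A \<in> carrier_mat n n" "invertible_mat A" "c \<noteq> 0" "G = const c * pullback A F"
      using PGL_orbit_eqD[OF G(2), of F] G(1) F(1) by auto
    then have "orbit_nonzero n Q F" using orbit_nonzero_invariant[OF F(2)] G(3) by blast
    then show "x \<in> ?O \<inter> smooth_locus d n"
      using F smooth_nonzero[OF F(3) assms(2)] unfolding smooth_locus_def by blast
  next
    fix x assume x: "x \<in> ?O \<inter> smooth_locus d n"
    then obtain F G where F: "x = proj_class F" "homogeneous {..<n} d F" "smooth_hypersurface n F"
      and G: "x = proj_class G" "homogeneous {..<n} d G" "orbit_nonzero n Q G"
      unfolding smooth_locus_def by blast
    obtain c where c: "c \<noteq> 0" "G = const c * F" using proj_class_eqD[of G F] F(1) G(1) by auto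
    then have "G = const c * pullback (1\<^sub>m n) F" using pullback_one[OF F(2)] by simp
    then have "orbit_nonzero n Q F"
      using orbit_nonzero_invariant[OF F(2) one_carrier_mat invertible_one_mat c(1)] G(3) by simp
    then show "x \<in> {x \<in> smooth_locus d n. PGL_orbit n x \<in> ?W}"
      using F x by blast
  qed
  then have "openin ?X {x \<in> topspace ?X. PGL_orbit n x \<in> ?W}"
    unfolding openin_subtopology using openin_orbit_nonzero[OF Q] by auto
  ultimately show ?thesis
    unfolding moduli_space_def openin_quotient_topology by blast
qed

section \<open>Finiteness of the general fibre\<close>

context smooth_form
begin

lemma hyperplane_section_homogeneous:
  assumes "H \<in> dual_projective_space n"
  shows "homogeneous {..<n} (Suc e) (hyperplane_section n f H)"
  unfolding hyperplane_section_def
  using hom_f hyperplane_coords(1)[OF assms] by (rule homogeneous_pullback_square)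

text \<open>This removes the choice made in \<open>hyperplane_coords\<close>: a section may be
  computed with whichever coordinate matrix a generic argument supplies.\<close>

lemma hyperplane_section_other_coords:
  assumes H: "H \<in> dual_projective_space n"
    and B: "B \<in> carrier_mat (Suc n) n" "bij_betw (\<lambda>y. B *\<^sub>v y) (carrier_vec n) H"
  shows "hyperplane_section_map n f H = PGL_orbit n (proj_class (pullback B f))"
    and "smooth_hypersurface n (pullback B f) \<Longrightarrow> smooth_hypersurface n (hyperplane_section n f H)"
proof -
  obtain A where A: "A \<in> carrier_mat n n" "invertible_mat A" "hyperplane_coords n H = B * A"
    using coords_unique[OF B hyperplane_coords[OF H]] by blast
  have h: "homogeneous {..<n} (Suc e) (pullback B f)"
    using hom_f B(1) by (rule homogeneous_pullback_square)
  have s: "hyperplane_section n f H = pullback A (pullback B f)"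
    unfolding hyperplane_section_def A(3)
    by (rule pullback_pullback[symmetric, where d = "Suc e"]) (use hom_f A B in auto)
  show "hyperplane_section_map n f H = PGL_orbit n (proj_class (pullback B f))"
    unfolding hyperplane_section_map_def s by (rule PGL_orbit_pullback[OF h A(1,2)])
  show "smooth_hypersurface n (hyperplane_section n f H)" if "smooth_hypersurface n (pullback B f)"
    unfolding s using smooth_pullback[OF A(1,2) h that] .
qed

lemma generically_finite:
  "generically_finite_onto_image (smooth_sections n f) (moduli_space (Suc e) n) (hyperplane_section_map n f)"
proof -
  let ?d = "Suc e" and ?U = "smooth_sections n f" and ?\<Phi> = "hyperplane_section_map n f"
  let ?Y = "moduli_space ?d n"
  have n0: "0 < n" using n by simp
  obtain Q where Q: "form_poly n ?d Q" "\<exists>z. Q (pullback (mat (Suc n) n z) f) \<noteq> 0"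
    and fin: "\<And>F. homogeneous {..<n} ?d F \<Longrightarrow> Q F \<noteq> 0 \<Longrightarrow> finite {B \<in> carrier_mat (Suc n) n. pullback B f = F}"
    by (rule finite_preimages) blast
  let ?W0 = "{PGL_orbit n (proj_class F) | F. homogeneous {..<n} ?d F \<and> smooth_hypersurface n F \<and>
      orbit_nonzero n Q F}"
  define W where "W = ?W0 \<inter> ?\<Phi> ` ?U"
  obtain G1 where G1: "vars_in ({..<Suc n} \<times> {..<n}) G1"
    "\<And>z. eval_at z G1 = Q (pullback (mat (Suc n) n z) f)"
    using form_poly_section[OF Q(1) hom_f] by blast
  obtain z1 where z1: "eval_at z1 G1 \<noteq> 0" using Q(2) G1(2) by auto
  \<comment> \<open>One construction for nonemptiness and density: \<open>Q\<close> and the equation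
    \<open>Q'\<close> of a neighbourhood become polynomials in matrix entries, which have a common
    nonzero with a smooth section.\<close>
  have meet: "\<exists>H F. H \<in> ?U \<and> ?\<Phi> H \<in> W \<and> ?\<Phi> H = PGL_orbit n (proj_class F) \<and> Q' F \<noteq> 0 \<and>
      homogeneous {..<n} ?d F \<and> smooth_hypersurface n F"
    if Q': "form_poly n ?d Q'" "Q' (pullback (mat (Suc n) n z0) f) \<noteq> 0" for Q' z0
  proof -
    obtain G2 where G2: "vars_in ({..<Suc n} \<times> {..<n}) G2"
      "\<And>z. eval_at z G2 = Q' (pullback (mat (Suc n) n z) f)"
      using form_poly_section[OF Q'(1) hom_f] by blast
    have "eval_at z0 G2 \<noteq> 0" using G2(2) Q'(2) by simp
    from eval_common_nonzero[OF z1 this] obtain z2 where "eval_at z2 (G1 * G2) \<noteq> 0" by auto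
    moreover have "vars_in ({..<Suc n} \<times> {..<n}) (G1 * G2)" using G1(1) G2(1) by (rule vars_in_mult)
    ultimately obtain z H where z: "eval_at z (G1 * G2) \<noteq> 0"
      "smooth_hypersurface n (pullback (mat (Suc n) n z) f)" and H: "H \<in> dual_projective_space n"
      "bij_betw (\<lambda>y. mat (Suc n) n z *\<^sub>v y) (carrier_vec n) H"
      using generic_smooth_section by metis
    define F where "F = pullback (mat (Suc n) n z) f"
    have B: "mat (Suc n) n z \<in> carrier_mat (Suc n) n" by simp
    have F: "homogeneous {..<n} ?d F"
      unfolding F_def using hom_f B by (rule homogeneous_pullback_square)
    have sF: "smooth_hypersurface n F" using z(2) by (simp add: F_def)
    have QF: "Q F \<noteq> 0" "Q' F \<noteq> 0" using z(1) G1(2) G2(2) by (simp_all add: F_def)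
    have \<Phi>: "?\<Phi> H = PGL_orbit n (proj_class F)"
      unfolding F_def by (rule hyperplane_section_other_coords(1)[OF H(1) B H(2)])
    have HU: "H \<in> ?U"
      unfolding smooth_sections_def
      using hyperplane_section_other_coords(2)[OF H(1) B H(2)] z(2) H(1) by blast
    have "?\<Phi> H \<in> ?W0" using \<Phi> F sF orbit_nonzeroI[where Q = Q, OF F QF(1)] by blast
    then have "?\<Phi> H \<in> W" using HU by (simp add: W_def)
    then show ?thesis using HU \<Phi> QF(2) F sF by blast
  qed
  have "openin (subtopology ?Y (?\<Phi> ` ?U)) W"
    unfolding W_def openin_subtopology using openin_moduli_orbit_nonzero[OF Q(1) n0] by blast
  moreover have "W \<noteq> {}" using meet[OF Q(1)] Q(2) by blast
  moreover have "subtopology ?Y (?\<Phi> ` ?U) closure_of W = ?\<Phi> ` ?U"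
  proof
    have topY: "?\<Phi> ` ?U \<subseteq> topspace ?Y"
    proof
      fix y assume "y \<in> ?\<Phi> ` ?U"
      then obtain H where H: "H \<in> ?U" "y = ?\<Phi> H" by blast
      let ?F = "hyperplane_section n f H"
      have h: "H \<in> dual_projective_space n" "smooth_hypersurface n ?F"
        using H(1) by (auto simp: smooth_sections_def)
      have F: "homogeneous {..<n} ?d ?F" using h(1) by (rule hyperplane_section_homogeneous)
      \<comment> \<open>For the constant 1 the open set is the class of every smooth form, which
        places the image inside the moduli space.\<close>
      have "orbit_nonzero n (\<lambda>F. 1) ?F" using F by (rule orbit_nonzeroI) simp
      then have "y \<in> {PGL_orbit n (proj_class F) | F. homogeneous {..<n} ?d F \<and> smooth_hypersurface n F \<and>
          orbit_nonzero n (\<lambda>F. 1) F}"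
        using F h(2) H(2) unfolding hyperplane_section_map_def by blast
      then show "y \<in> topspace ?Y"
        using openin_subset[OF openin_moduli_orbit_nonzero[OF form_poly_const n0]] by blast
    qed
    then show "subtopology ?Y (?\<Phi> ` ?U) closure_of W \<subseteq> ?\<Phi> ` ?U"
      using closure_of_subset_topspace[of "subtopology ?Y (?\<Phi> ` ?U)" W] by auto
    show "?\<Phi> ` ?U \<subseteq> subtopology ?Y (?\<Phi> ` ?U) closure_of W"
    proof
      fix y assume y: "y \<in> ?\<Phi> ` ?U"
      then obtain H where H: "H \<in> ?U" "y = ?\<Phi> H" by blast
      have hd: "H \<in> dual_projective_space n" using H(1) by (simp add: smooth_sections_def)
      let ?F = "hyperplane_section n f H"
      have F: "homogeneous {..<n} ?d ?F" "smooth_hypersurface n ?F"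
        using hyperplane_section_homogeneous[OF hd] H(1) by (auto simp: smooth_sections_def)
      have "\<exists>w\<in>W. w \<in> T" if T: "openin (subtopology ?Y (?\<Phi> ` ?U)) T" "y \<in> T" for T
      proof -
        obtain V where V: "openin ?Y V" "T = V \<inter> ?\<Phi> ` ?U" using T(1) by (auto simp: openin_subtopology)
        obtain Z where Z: "openin (zariski_forms ?d n) Z"
          "\<And>F. homogeneous {..<n} ?d F \<Longrightarrow> smooth_hypersurface n F \<Longrightarrow>
             proj_class F \<in> Z \<longleftrightarrow> PGL_orbit n (proj_class F) \<in> V"
          using moduli_space_openD[OF V(1) n0] by blast
        have "proj_class ?F \<in> Z"
          using Z(2)[OF F] T(2) V(2) H(2) by (simp add: hyperplane_section_map_def)
        from zariski_neighbourhood[OF Z(1) F(1) this] obtain Q' where Q': "form_poly n ?d Q'" "Q' ?F \<noteq> 0"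
          "\<And>F. homogeneous {..<n} ?d F \<Longrightarrow> F \<noteq> 0 \<Longrightarrow> Q' F \<noteq> 0 \<Longrightarrow> proj_class F \<in> Z" by blast
        have "hyperplane_coords n H = mat (Suc n) n (($$) (hyperplane_coords n H))"
          using hyperplane_coords(1)[OF hd] by (intro eq_matI) auto
        then have "Q' (pullback (mat (Suc n) n (($$) (hyperplane_coords n H))) f) \<noteq> 0"
          using Q'(2) unfolding hyperplane_section_def by simp
        from meet[OF Q'(1) this] obtain H' F' where H': "H' \<in> ?U" "?\<Phi> H' \<in> W"
          "?\<Phi> H' = PGL_orbit n (proj_class F')" "Q' F' \<noteq> 0"
          "homogeneous {..<n} ?d F'" "smooth_hypersurface n F'"
          by blast
        then have "?\<Phi> H' \<in> V"
          using Q'(3)[of F'] Z(2)[of F'] smooth_nonzero[OF _ n0] by simp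
        then show ?thesis using H'(1,2) V(2) by blast
      qed
      then show "y \<in> subtopology ?Y (?\<Phi> ` ?U) closure_of W"
        using y topY by (auto simp: in_closure_of)
    qed
  qed
  moreover have "finite {H \<in> ?U. ?\<Phi> H = y}" if y: "y \<in> W" for y
  proof -
    obtain F0 where F0: "y = PGL_orbit n (proj_class F0)" "homogeneous {..<n} ?d F0" "orbit_nonzero n Q F0"
      using y unfolding W_def by blast
    obtain A0 c0 where A0: "A0 \<in> carrier_mat n n" "invertible_mat A0" "c0 \<noteq> 0"
      "Q (const c0 * pullback A0 F0) \<noteq> 0" using F0(3) unfolding orbit_nonzero_def by blast
    define F where "F = const c0 * pullback A0 F0"
    have hA0: "homogeneous {..<n} ?d (pullback A0 F0)"
      using F0(2) A0(1) by (rule homogeneous_pullback_square)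
    have F: "homogeneous {..<n} ?d F" unfolding F_def by (rule homogeneous_const_mult[OF hA0])
    let ?X = "{B \<in> carrier_mat (Suc n) n. pullback B f = F}"
    have finX: "finite ?X" using fin[OF F] A0(4) by (simp add: F_def)
    \<comment> \<open>A hyperplane is the range of each of its coordinate matrices. Every point of
      the fibre has such a matrix over the fixed representative \<open>F\<close>, and there are
      finitely many of those.\<close>
    have "{H \<in> ?U. ?\<Phi> H = y} \<subseteq> (\<lambda>B. (\<lambda>y. B *\<^sub>v y) ` carrier_vec n) ` ?X"
    proof
      fix H assume "H \<in> {H \<in> ?U. ?\<Phi> H = y}"
      then have H: "H \<in> dual_projective_space n" "?\<Phi> H = y" by (auto simp: smooth_sections_def)
      let ?B = "hyperplane_coords n H"
      note B = hyperplane_coords[OF H(1)]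
      let ?G = "hyperplane_section n f H"
      have "PGL_orbit n (proj_class (pullback A0 F0)) = PGL_orbit n (proj_class ?G)"
        using PGL_orbit_pullback[OF F0(2) A0(1,2)] H(2) F0(1) by (simp add: hyperplane_section_map_def)
      from PGL_orbit_eqD[OF hA0 this] obtain A c where A: "A \<in> carrier_mat n n" "invertible_mat A" "c \<noteq> 0"
        and eq: "pullback A0 F0 = const c * pullback A ?G" by blast
      \<comment> \<open>Equality of orbits determines the form up to a scalar; being a
        \<open>?d\<close>-th power, the scalar can be moved into the matrix.\<close>
      have "\<exists>s. s ^ ?d = c0 * c"
      proof -
        have "card {s. s ^ ?d = c0 * c} = ?d" using card_nth_roots[of "c0 * c" ?d] A(3) A0(3) by simp
        then have "{s. s ^ ?d = c0 * c} \<noteq> {}" by (metis card.empty nat.distinct(1))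
        then show ?thesis by blast
      qed
      then obtain s where s: "s ^ ?d = c0 * c" by blast
      have s0: "s \<noteq> 0" using s A(3) A0(3) by auto
      define B' where "B' = s \<cdot>\<^sub>m (?B * A)"
      have BA: "?B * A \<in> carrier_mat (Suc n) n" using B(1) A(1) by simp
      have B': "B' \<in> carrier_mat (Suc n) n" unfolding B'_def using BA by simp
      have "pullback (?B * A) f = pullback A (pullback ?B f)"
        by (rule pullback_pullback[symmetric, where d = ?d]) (use hom_f A B in auto)
      moreover have "pullback B' f = const (s ^ ?d) * pullback (?B * A) f"
        unfolding B'_def by (rule pullback_smult) (use hom_f B in simp)
      ultimately have "pullback B' f = F"
        unfolding F_def eq s hyperplane_section_def by (simp add: const_mult mult.assoc)
      moreover have "H = (\<lambda>y. B' *\<^sub>v y) ` carrier_vec n"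
      proof -
        obtain A' where A': "A' \<in> carrier_mat n n" "A * A' = 1\<^sub>m n" using invertible_matE[OF A(1,2)] by blast
        have B'v: "B' *\<^sub>v y = ?B *\<^sub>v (s \<cdot>\<^sub>v (A *\<^sub>v y))" if y: "y \<in> carrier_vec n" for y
        proof -
          have "B' *\<^sub>v y = s \<cdot>\<^sub>v ((?B * A) *\<^sub>v y)"
            unfolding B'_def using BA y by (intro eq_vecI) (auto simp: scalar_prod_smult_left row_smult)
          also have "(?B * A) *\<^sub>v y = ?B *\<^sub>v (A *\<^sub>v y)" using B(1) A(1) y by (rule assoc_mult_mat_vec)
          also have "s \<cdot>\<^sub>v (?B *\<^sub>v (A *\<^sub>v y)) = ?B *\<^sub>v (s \<cdot>\<^sub>v (A *\<^sub>v y))"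
            using mult_mat_vec[OF B(1), of "A *\<^sub>v y" s] A(1) y by simp
          finally show ?thesis .
        qed
        have "(\<lambda>y. B' *\<^sub>v y) ` carrier_vec n \<subseteq> H"
        proof
          fix x assume "x \<in> (\<lambda>y. B' *\<^sub>v y) ` carrier_vec n"
          then obtain y where y: "y \<in> carrier_vec n" "x = B' *\<^sub>v y" by blast
          have "s \<cdot>\<^sub>v (A *\<^sub>v y) \<in> carrier_vec n" using A(1) y(1) by simp
          then show "x \<in> H" unfolding y(2) B'v[OF y(1)] using bij_betwE[OF B(2)] by blast
        qed
        moreover have "H \<subseteq> (\<lambda>y. B' *\<^sub>v y) ` carrier_vec n"
        proof
          fix x assume "x \<in> H"
          then obtain y where y: "x = ?B *\<^sub>v y" "y \<in> carrier_vec n"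
            using bij_betw_imp_surj_on[OF B(2)] by blast
          let ?y = "A' *\<^sub>v ((1 / s) \<cdot>\<^sub>v y)"
          have y': "?y \<in> carrier_vec n" using A'(1) y(2) by simp
          have "A *\<^sub>v ?y = (1 / s) \<cdot>\<^sub>v y"
            using assoc_mult_mat_vec[OF A(1) A'(1), of "(1 / s) \<cdot>\<^sub>v y"] A'(2) y(2) by simp
          then have "s \<cdot>\<^sub>v (A *\<^sub>v ?y) = y" using s0 y(2) by (simp add: smult_smult_assoc)
          then have "x = B' *\<^sub>v ?y" using B'v[OF y'] y(1) by simp
          then show "x \<in> (\<lambda>y. B' *\<^sub>v y) ` carrier_vec n" using y' by blast
        qed
        ultimately show ?thesis by blast
      qed
      ultimately show "H \<in> (\<lambda>B. (\<lambda>y. B *\<^sub>v y) ` carrier_vec n) ` ?X" using B' by blast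
    qed
    then show ?thesis using finX finite_subset by blast
  qed
  ultimately show ?thesis unfolding generically_finite_onto_image_def by blast
qed

end

theorem corollary3p4:
  fixes f :: "nat mpoly" and n d :: nat
  assumes "n \<ge> 3" and "d \<ge> n + 2"
    and "homogeneous {..<Suc n} d f"
    and "smooth_hypersurface (Suc n) f"
  shows "generically_finite_onto_image (smooth_sections n f) (moduli_space d n)
           (hyperplane_section_map n f)"
proof -
  have d: "d = Suc (d - 1)" using assms(2) by simp
  \<comment> \<open>From \<open>n \<ge> 3\<close> and \<open>d \<ge> n + 2\<close> one gets
    \<open>d \<ge> 5\<close>, hence \<open>d - 1 \<ge> 4\<close>.\<close>
  interpret smooth_form f n "d - 1"
    by unfold_locales (use assms d in auto)
  show ?thesis using generically_finite d by simp
qed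

end
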